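(* Let $k\ge 1$ and either $\beta\in(0,k\wedge 2)$, or $k=1=\beta$, and let $u=\{u(t,x): t\ge 0, x\in\mathbb{R}^k\}$ be (a continuous version of) the solution of the linear stochastic wave equation described in the context. Let $I=[a,a']\times[-b,b]^k$ with $0<a<a'<\infty$ and $0<b<\infty$. For $(t,x),(t',x')$ let $\sigma[(t,x),(t',x')]=\big(\mathbb{E}[(u(t,x)-u(t',x'))^2]\big)^{1/2}$ and \[ \gamma[(t,x),(t',x')]=\sigma[(t,x),(t',x')]\sqrt{\log\big(1+\sigma[(t,x),(t',x')]^{-1}\big)}. \] Then there is a positive finite constant $K$ such that \[ \lim_{\varepsilon\to0+}\ \sup_{\substack{(t,x),(t',x')\in I,\\ \sigma[(t,x),(t',x')]\le\varepsilon}}\frac{|u(t,x)-u(t',x')|}{\gamma[(t,x),(t',x')]}=K\quad\text{almost surely.} \]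
   Context: Consider the stochastic wave equation $\partial_t^2 u(t,x)=\Delta u(t,x)+\dot W(t,x)$ for $t\ge0$, $x\in\mathbb{R}^k$, with zero initial conditions $u(0,x)=\partial_t u(0,x)=0$. If $k=1=\beta$, $\dot W$ is space-time Gaussian white noise; if $k\ge1$ and $\beta\in(0,k\wedge 2)$, $\dot W$ is a centered Gaussian noise, white in time, with spatial covariance given by the Riesz kernel: $\mathbb{E}(\dot W(t,x)\dot W(s,y))=\delta(t-s)|x-y|^{-\beta}$. The (real-valued, mild) solution is $u(t,x)=\int_0^t\int_{\mathbb{R}^k}G(t-s,x-y)\,W(ds\,dy)$, where $W$ is the martingale measure induced by $\dot W$ and $G$ is the fundamental solution of the wave equation, whose spatial Fourier transform is $\mathscr{F}(G(t,\cdot))(\xi)=\sin(t|\xi|)/|\xi|$. Equivalently, $u$ is the centered Gaussian random field with covariance $\mathbb{E}[u(t,x)u(s,y)]=c_{k,\beta}\int_0^{t\wedge s}dr\int_{\mathbb{R}^k}|\xi|^{\beta-k}e^{-i(x-y)\cdot\xi}\frac{\sin((t-r)|\xi|)\sin((s-r)|\xi|)}{|\xi|^2}\,d\xi$ for a constant $c_{k,\beta}>0$; it admits a version with continuous sample paths, which is the one considered. *)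

theory Defs
  imports "HOL-Probability.Probability"
begin

text \<open>The constant c_{k,beta} of the spectral covariance formula: (2 pi)^{-k} times the
  Fourier constant of the Riesz kernel; for space-time white noise (k = 1 = beta) it is 1/(2 pi).\<close>
definition wave_const :: "nat \<Rightarrow> real \<Rightarrow> real" where
  "wave_const k \<beta> =
     (if k = 1 \<and> \<beta> = 1 then 1 / (2 * pi)
      else (2 * pi) powr (- real k) * pi powr (real k / 2) * 2 powr (real k - \<beta>)
           * Gamma ((real k - \<beta>) / 2) / Gamma (\<beta> / 2))"

definition wave_cov :: "real \<Rightarrow> real \<Rightarrow> real ^ 'n \<Rightarrow> real \<Rightarrow> real ^ 'n \<Rightarrow> complex" where
  "wave_cov \<beta> t x s y =
     complex_of_real (wave_const CARD('n) \<beta>) *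
     (LINT r:{0..min t s}|lborel.
        (LINT \<xi>|(lborel :: (real ^ 'n) measure).
           complex_of_real (norm \<xi> powr (\<beta> - real CARD('n)))
           * exp (- \<i> * complex_of_real ((x - y) \<bullet> \<xi>))
           * complex_of_real (sin ((t - r) * norm \<xi>) * sin ((s - r) * norm \<xi>) / (norm \<xi>)\<^sup>2)))"

definition centered_gaussian :: "'a measure \<Rightarrow> ('a \<Rightarrow> real) \<Rightarrow> bool" where
  "centered_gaussian M X \<longleftrightarrow>
     X \<in> borel_measurable M \<and>
     ((AE \<omega> in M. X \<omega> = 0) \<or> (\<exists>\<sigma>>0. distributed M lborel X (normal_density 0 \<sigma>)))"

text \<open>u is (a continuous version of) the solution of the linear stochastic wave equation:
  a centered Gaussian random field on [0,\<infinity>) x R^k with the covariance above and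
  continuous sample paths.\<close>
definition stoch_wave_solution ::
  "'a measure \<Rightarrow> real \<Rightarrow> ('a \<Rightarrow> real \<times> (real ^ 'n) \<Rightarrow> real) \<Rightarrow> bool" where
  "stoch_wave_solution M \<beta> u \<longleftrightarrow>
     prob_space M \<and>
     (\<forall>F (c :: real \<times> (real ^ 'n) \<Rightarrow> real). finite F \<and> F \<subseteq> {p. 0 \<le> fst p} \<longrightarrow>
        centered_gaussian M (\<lambda>\<omega>. \<Sum>p\<in>F. c p * u \<omega> p)) \<and>
     (\<forall>t x s y. 0 \<le> t \<longrightarrow> 0 \<le> s \<longrightarrow>
        complex_of_real (integral\<^sup>L M (\<lambda>\<omega>. u \<omega> (t, x) * u \<omega> (s, y))) = wave_cov \<beta> t x s y) \<and>
     (\<forall>\<omega>\<in>space M. continuous_on {p. 0 \<le> fst p} (u \<omega>))"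

definition wave_box :: "real \<Rightarrow> real \<Rightarrow> real \<Rightarrow> (real \<times> (real ^ 'n)) set" where
  "wave_box a a' b = {a..a'} \<times> {x. \<forall>i. - b \<le> x $ i \<and> x $ i \<le> b}"

definition wave_sigma :: "'a measure \<Rightarrow> ('a \<Rightarrow> 'p \<Rightarrow> real) \<Rightarrow> 'p \<Rightarrow> 'p \<Rightarrow> real" where
  "wave_sigma M u p q = sqrt (integral\<^sup>L M (\<lambda>\<omega>. (u \<omega> p - u \<omega> q)\<^sup>2))"

definition wave_gamma :: "'a measure \<Rightarrow> ('a \<Rightarrow> 'p \<Rightarrow> real) \<Rightarrow> 'p \<Rightarrow> 'p \<Rightarrow> real" where
  "wave_gamma M u p q = wave_sigma M u p q * sqrt (ln (1 + 1 / wave_sigma M u p q))"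

end

theory Submission
  imports Defs "HOL-Real_Asymp.Real_Asymp"
begin

text \<open>Write \<open>\<sigma>\<close> for the canonical metric and \<open>\<gamma> = \<sigma> sqrt (ln (1 + 1 / \<sigma>))\<close>.
  Along a dense sequence the field is expanded in its Gram-Schmidt innovations, which are independent.
  By Cauchy-Schwarz every coefficient function of this expansion is Lipschitz with respect to \<open>\<sigma>\<close>,
  hence negligible with respect to \<open>\<gamma>\<close> at small scales; so the limit is unchanged when finitely
  many innovations are dropped, and Kolmogorov's zero-one law makes it constant.

  The constant is finite by chaining in the metric \<open>\<sigma>\<close>, which only requires that \<open>\<sigma>\<close> is dominated
  by some power of the Euclidean distance. It is positive because of \<open>N\<close> spatial increments at a fixed
  time whose length is a large negative power of \<open>N\<close> and whose starting points are \<open>b / N\<close> apart: up to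
  an error of smaller order their covariances are second differences of \<open>\<bar>d\<bar> powr (2 - \<beta>)\<close>,
  so the increments are nearly orthogonal, each innovation keeps at least half of the variance, and the
  probability that none of the increments exceeds a small multiple of \<open>\<gamma>\<close> tends to 0.\<close>

section \<open>Gaussian spaces\<close>

text \<open>The zero-one law yields a constant in the extended reals only, so 0 and infinity have to
  be excluded. As the limit is constant, an upper bound on an event of positive probability gives
  finiteness, and a lower bound with any positive factor gives positivity; no constant has to be
  sharp. The obstacle to the lower bound is dependence. The increment length h = b N^(-P) meets two
  competing demands. The gaps b / N are so large compared with h that correlations are of order
  N^(-2), which stays negligible after summing over N variables; yet ln (1 / h) is still comparable
  to ln N. The largest of N nearly independent normal variables reaches about sqrt (ln N) standard
  deviations, and this is the order of sqrt (ln (1 / \<sigma>)). Joint normality is encoded as a set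
  of centered Gaussian variables that is closed under linear combinations.\<close>

locale gaussian_space = prob_space M for M :: "'a measure" +
  fixes G :: "('a \<Rightarrow> real) set"
  assumes gaussian: "X \<in> G \<Longrightarrow> centered_gaussian M X"
    and zero_mem: "(\<lambda>_. 0) \<in> G"
    and lin_mem: "X \<in> G \<Longrightarrow> Y \<in> G \<Longrightarrow> (\<lambda>\<omega>. a * X \<omega> + b * Y \<omega>) \<in> G"
begin

lemma measurable_G [measurable]: "X \<in> G \<Longrightarrow> X \<in> borel_measurable M"
  using gaussian by (auto simp: centered_gaussian_def)

lemma scale_mem: "X \<in> G \<Longrightarrow> (\<lambda>\<omega>. a * X \<omega>) \<in> G"
  using lin_mem[of X X a 0] by simp

lemma add_mem: "X \<in> G \<Longrightarrow> Y \<in> G \<Longrightarrow> (\<lambda>\<omega>. X \<omega> + Y \<omega>) \<in> G"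
  using lin_mem[of X Y 1 1] by simp

lemma diff_mem: "X \<in> G \<Longrightarrow> Y \<in> G \<Longrightarrow> (\<lambda>\<omega>. X \<omega> - Y \<omega>) \<in> G"
  using lin_mem[of X Y 1 "-1"] by simp

lemma uminus_mem: "X \<in> G \<Longrightarrow> (\<lambda>\<omega>. - X \<omega>) \<in> G"
  using scale_mem[of X "-1"] by simp

lemma sum_mem: "finite I \<Longrightarrow> (\<And>i. i \<in> I \<Longrightarrow> X i \<in> G) \<Longrightarrow> (\<lambda>\<omega>. \<Sum>i\<in>I. c i * X i \<omega>) \<in> G"
  by (induction I rule: finite_induct) (auto intro!: zero_mem lin_mem[where b=1, simplified])

definition ip :: "('a \<Rightarrow> real) \<Rightarrow> ('a \<Rightarrow> real) \<Rightarrow> real" where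
  "ip X Y = expectation (\<lambda>\<omega>. X \<omega> * Y \<omega>)"

lemma normal_square:
  assumes D: "distributed M lborel X (normal_density 0 \<sigma>)" and \<sigma>: "\<sigma> > 0"
  shows "integrable M (\<lambda>\<omega>. (X \<omega>)\<^sup>2)" "ip X X = \<sigma>\<^sup>2"
proof -
  show "integrable M (\<lambda>\<omega>. (X \<omega>)\<^sup>2)"
    using integrable_normal_moment[OF \<sigma>, of 0 2]
    by (subst distributed_integrable[OF D, symmetric]) auto
  have "expectation X = 0"
    using normal_distributed_expectation[OF \<sigma> D] .
  with normal_distributed_variance[OF \<sigma> D]
  show "ip X X = \<sigma>\<^sup>2"
    by (simp add: ip_def power2_eq_square)
qed

text \<open>A variable that vanishes almost surely has no density, so
  \<open>centered_gaussian\<close> treats it as a separate alternative. Here both alternatives are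
  tied to the variance \<open>ip X X\<close>.\<close>

lemma G_cases:
  assumes X: "X \<in> G"
  obtains "AE \<omega> in M. X \<omega> = 0" "ip X X = 0"
  | \<sigma> where "\<sigma> > 0" "distributed M lborel X (normal_density 0 \<sigma>)"
      "ip X X = \<sigma>\<^sup>2"
proof (cases "AE \<omega> in M. X \<omega> = 0")
  case True
  have "ip X X = expectation (\<lambda>\<omega>. 0)"
    unfolding ip_def using True X by (intro integral_cong_AE) auto
  with True that(1) show thesis by simp
next
  case False
  with gaussian[OF X] that(2) normal_square(2) show thesis
    by (auto simp: centered_gaussian_def)
qed

lemma integrable_square:
  assumes X: "X \<in> G" shows "integrable M (\<lambda>\<omega>. (X \<omega>)\<^sup>2)"
proof (cases "AE \<omega> in M. X \<omega> = 0")
  case True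
  have "integrable M (\<lambda>\<omega>. (X \<omega>)\<^sup>2) \<longleftrightarrow> integrable M (\<lambda>\<omega>. 0::real)"
    using True X by (intro integrable_cong_AE) auto
  then show ?thesis by simp
next
  case False
  with gaussian[OF X] normal_square(1) show ?thesis
    by (auto simp: centered_gaussian_def)
qed

lemma integrable_mult_G:
  assumes X: "X \<in> G" and Y: "Y \<in> G" shows "integrable M (\<lambda>\<omega>. X \<omega> * Y \<omega>)"
proof (rule Bochner_Integration.integrable_bound)
  show "integrable M (\<lambda>\<omega>. (X \<omega>)\<^sup>2 + (Y \<omega>)\<^sup>2)"
    using X Y by (intro Bochner_Integration.integrable_add integrable_square)
  have "\<bar>x * y\<bar> \<le> x\<^sup>2 + y\<^sup>2" for x y :: real
  proof -
    have "0 \<le> \<bar>x\<bar> * \<bar>y\<bar>" by simp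
    then show ?thesis
      using sum_squares_bound[of "\<bar>x\<bar>" "\<bar>y\<bar>"] unfolding abs_mult power2_abs by linarith
  qed
  then show "AE \<omega> in M. norm (X \<omega> * Y \<omega>) \<le> norm ((X \<omega>)\<^sup>2 + (Y \<omega>)\<^sup>2)"
    by auto
qed (use X Y in measurable)

lemma ip_commute: "ip X Y = ip Y X"
  by (simp add: ip_def mult.commute)

lemma ip_nonneg: "0 \<le> ip X X"
  by (simp add: ip_def)

lemma ip_lin:
  assumes "X \<in> G" "Y \<in> G" "Z \<in> G"
  shows "ip (\<lambda>\<omega>. a * X \<omega> + b * Y \<omega>) Z = a * ip X Z + b * ip Y Z"
  using integrable_mult_G[OF assms(1,3)] integrable_mult_G[OF assms(2,3)]
  by (simp add: ip_def distrib_right mult.assoc)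

lemma ip_diff:
  assumes "X \<in> G" "Y \<in> G" "Z \<in> G"
  shows "ip (\<lambda>\<omega>. X \<omega> - Y \<omega>) Z = ip X Z - ip Y Z"
  using ip_lin[OF assms, of 1 "-1"] by simp

lemma ip_sum:
  assumes "finite I" "\<And>i. i \<in> I \<Longrightarrow> X i \<in> G" "Z \<in> G"
  shows "ip (\<lambda>\<omega>. \<Sum>i\<in>I. c i * X i \<omega>) Z = (\<Sum>i\<in>I. c i * ip (X i) Z)"
  using integrable_mult_G[OF assms(2,3)] assms(1)
  by (simp add: ip_def sum_distrib_right mult.assoc)

lemma ip_square_diff:
  assumes "X \<in> G" "Y \<in> G"
  shows "expectation (\<lambda>\<omega>. (X \<omega> - Y \<omega>)\<^sup>2) = ip X X - 2 * ip X Y + ip Y Y"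
  using ip_diff[OF assms, of "\<lambda>\<omega>. X \<omega> - Y \<omega>"] ip_diff[OF assms, of X] ip_diff[OF assms, of Y] assms
  by (simp add: diff_mem ip_commute[of X "\<lambda>\<omega>. X \<omega> - Y \<omega>"] ip_commute[of Y "\<lambda>\<omega>. X \<omega> - Y \<omega>"]
      ip_commute[of Y X]) (simp add: ip_def power2_eq_square)

lemma ip_Cauchy_Schwarz:
  assumes X: "X \<in> G" and Y: "Y \<in> G"
  shows "\<bar>ip X Y\<bar> \<le> sqrt (ip X X) * sqrt (ip Y Y)"
proof -
  have quad: "0 \<le> a\<^sup>2 * ip X X + 2 * a * b * ip X Y + b\<^sup>2 * ip Y Y" for a b
  proof -
    let ?Z = "\<lambda>\<omega>. a * X \<omega> + b * Y \<omega>"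
    have Z: "?Z \<in> G" by (rule lin_mem[OF X Y])
    have "0 \<le> ip ?Z ?Z" by (rule ip_nonneg)
    also have "\<dots> = a * ip ?Z X + b * ip ?Z Y"
      using ip_lin[OF X Y Z] by (simp add: ip_commute)
    also have "\<dots> = a\<^sup>2 * ip X X + 2 * a * b * ip X Y + b\<^sup>2 * ip Y Y"
      using ip_lin[OF X Y X] ip_lin[OF X Y Y]
      by (simp add: ip_commute[of Y X] power2_eq_square algebra_simps)
    finally show ?thesis .
  qed
  have "(ip X Y)\<^sup>2 \<le> ip X X * ip Y Y"
  proof (cases "ip X X = 0")
    case True
    have "ip X Y = 0"
    proof (rule ccontr)
      assume "ip X Y \<noteq> 0"
      \<comment> \<open>With \<open>ip X X = 0\<close> the quadratic form is affine in its first
        argument; this choice gives it the value -1.\<close>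
      then show False
        using quad[of "- (ip Y Y + 1) / (2 * ip X Y)" 1] True by (simp add: field_simps)
    qed
    with True show ?thesis by simp
  next
    case False
    then have pos: "ip X X > 0" using ip_nonneg[of X] by simp
    have "0 \<le> ip X X * (ip X X * ip Y Y - (ip X Y)\<^sup>2)"
      using quad[of "ip X Y" "- ip X X"] by (simp add: power2_eq_square algebra_simps)
    with pos show ?thesis by (simp add: zero_le_mult_iff)
  qed
  then have "sqrt ((ip X Y)\<^sup>2) \<le> sqrt (ip X X * ip Y Y)"
    by (rule real_sqrt_le_mono)
  then show ?thesis by (simp add: real_sqrt_mult)
qed

lemma L2_triangle:
  assumes X: "X \<in> G" and Y: "Y \<in> G"
  shows "sqrt (ip (\<lambda>\<omega>. X \<omega> + Y \<omega>) (\<lambda>\<omega>. X \<omega> + Y \<omega>)) \<le> sqrt (ip X X) + sqrt (ip Y Y)"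
proof (rule real_le_lsqrt)
  let ?Z = "\<lambda>\<omega>. X \<omega> + Y \<omega>"
  have Z: "?Z \<in> G" by (rule add_mem[OF X Y])
  have "ip ?Z ?Z = ip ?Z X + ip ?Z Y"
    using ip_lin[OF X Y Z, of 1 1] by (simp add: ip_commute)
  also have "\<dots> = ip X X + 2 * ip X Y + ip Y Y"
    using ip_lin[OF X Y X, of 1 1] ip_lin[OF X Y Y, of 1 1]
    by (simp add: ip_commute[of Y X])
  also have "\<dots> \<le> (sqrt (ip X X) + sqrt (ip Y Y))\<^sup>2"
    using ip_Cauchy_Schwarz[OF X Y] ip_nonneg[of X] ip_nonneg[of Y]
    by (simp add: power2_sum)
  finally show "ip ?Z ?Z \<le> (sqrt (ip X X) + sqrt (ip Y Y))\<^sup>2" .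
qed (auto simp: ip_nonneg)

text \<open>Division by the standard deviation reduces to the standard normal law. The degenerate
  case obeys the same formula, so characteristic functions can later be compared through variances
  alone.\<close>

lemma char_G:
  assumes X: "X \<in> G"
  shows "(CLINT \<omega>|M. iexp (X \<omega>)) = exp (- ip X X / 2)"
proof (cases rule: G_cases[OF X])
  case 1
  have "(CLINT \<omega>|M. iexp (X \<omega>)) = (CLINT \<omega>|M. 1)"
    using 1 X by (intro integral_cong_AE) auto
  with 1 show ?thesis by (simp add: prob_space)
next
  case (2 \<sigma>)
  let ?Z = "\<lambda>\<omega>. X \<omega> / \<sigma>"
  have D: "distributed M lborel ?Z std_normal_density"
    using normal_standard_normal_convert[of \<sigma> X 0] 2 by simp
  have "distr M borel ?Z = std_normal_distribution"
    using distributed_distr_eq_density[OF D] by (simp cong: distr_cong)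
  then have "char (distr M borel ?Z) \<sigma> = exp (- \<sigma>\<^sup>2 / 2)"
    by (simp add: char_std_normal_distribution)
  moreover have "char (distr M borel ?Z) \<sigma> = (CLINT \<omega>|M. iexp (X \<omega>))"
    unfolding char_def using 2 X by (subst integral_distr) auto
  ultimately show ?thesis
    using 2 by simp
qed

lemma prob_normal:
  assumes D: "distributed M lborel X (normal_density 0 \<sigma>)" and A: "A \<in> sets borel"
  shows "prob {\<omega>\<in>space M. X \<omega> \<in> A} = (LINT y|lborel. normal_density 0 \<sigma> y * indicator A y)"
proof -
  have [measurable]: "X \<in> borel_measurable M"
    using distributed_measurable[OF D] by simp
  have "(LINT y|lborel. normal_density 0 \<sigma> y * indicator A y) = (LINT \<omega>|M. indicator A (X \<omega>))"
    using A by (intro distributed_integral[OF D]) auto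
  also have "\<dots> = (LINT \<omega>|M. indicator {\<omega>\<in>space M. X \<omega> \<in> A} \<omega>)"
    by (intro Bochner_Integration.integral_cong) (auto simp: indicator_def)
  also have "\<dots> = prob {\<omega>\<in>space M. X \<omega> \<in> A}"
    using A by simp
  finally show ?thesis by simp
qed

text \<open>Half of the Gaussian exponent is spent on the factor
  \<open>exp (- x\<^sup>2 / 4)\<close>; the other half is a normal density of doubled variance,
  whose normalization accounts for \<open>sqrt 2\<close>. The strict inequality in the event keeps
  the bound valid for variance 0.\<close>

lemma tail_upper:
  assumes X: "X \<in> G" and x: "0 \<le> x"
  shows "prob {\<omega>\<in>space M. \<bar>X \<omega>\<bar> > x * sqrt (ip X X)} \<le> sqrt 2 * exp (- x\<^sup>2 / 4)"
proof (cases rule: G_cases[OF X])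
  case 1
  with X have "prob {\<omega>\<in>space M. \<bar>X \<omega>\<bar> > x * sqrt (ip X X)} = 0"
    by (subst prob_eq_0) auto
  then show ?thesis by simp
next
  case (2 \<sigma>)
  let ?e = "\<lambda>k y. exp (- y\<^sup>2 / (k * \<sigma>\<^sup>2))" and ?s = "sqrt (2 * pi) * \<sigma>"
  have s: "sqrt (ip X X) = \<sigma>"
    using 2 by simp
  have pointwise: "normal_density 0 \<sigma> y * indicator {y. \<bar>y\<bar> > x * \<sigma>} y
      \<le> sqrt 2 * exp (- x\<^sup>2 / 4) * normal_density 0 (sqrt 2 * \<sigma>) y" for y
  proof (cases "\<bar>y\<bar> > x * \<sigma>")
    case True
    have "(x * \<sigma>)\<^sup>2 \<le> \<bar>y\<bar>\<^sup>2"
      using True 2(1) x by (intro power_mono) auto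
    then have "x\<^sup>2 \<le> y\<^sup>2 / \<sigma>\<^sup>2"
      using 2(1) by (simp add: power_mult_distrib field_simps)
    then have "- y\<^sup>2 / (2 * \<sigma>\<^sup>2) \<le> - x\<^sup>2 / 4 + - y\<^sup>2 / (4 * \<sigma>\<^sup>2)"
      by (simp add: field_simps)
    then have "?e 2 y \<le> exp (- x\<^sup>2 / 4) * ?e 4 y"
      by (simp add: exp_add[symmetric])
    then have "?e 2 y / ?s
        \<le> exp (- x\<^sup>2 / 4) * ?e 4 y / ?s"
      using 2(1) by (intro divide_right_mono) auto
    moreover have "normal_density 0 \<sigma> y = ?e 2 y / ?s"
      using 2(1) by (simp add: normal_density_def real_sqrt_mult)
    moreover have "sqrt 2 * normal_density 0 (sqrt 2 * \<sigma>) y = ?e 4 y / ?s"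
      using 2(1) by (simp add: normal_density_def real_sqrt_mult power_mult_distrib field_simps)
    ultimately show ?thesis
      using True by (simp add: mult.assoc mult.left_commute[of "sqrt 2"])
  qed simp
  have "prob {\<omega>\<in>space M. \<bar>X \<omega>\<bar> > x * \<sigma>}
      = (LINT y|lborel. normal_density 0 \<sigma> y * indicator {y. \<bar>y\<bar> > x * \<sigma>} y)"
    using prob_normal[OF 2(2), of "{y. \<bar>y\<bar> > x * \<sigma>}"] by simp
  also have "\<dots> \<le> (LINT y|lborel. sqrt 2 * exp (- x\<^sup>2 / 4) * normal_density 0 (sqrt 2 * \<sigma>) y)"
    using 2(1) by (intro integral_mono pointwise integrable_real_mult_indicator) auto
  also have "\<dots> = sqrt 2 * exp (- x\<^sup>2 / 4)"
    using 2(1) by simp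
  finally show ?thesis using s by simp
qed

text \<open>On an interval of one standard deviation beyond the threshold the density is at least
  its value at the right end. The threshold uses a lower bound \<open>v\<close> of the variance
  because innovations are only known to keep a fixed share of it.\<close>

lemma tail_lower:
  assumes X: "X \<in> G" and x: "0 \<le> x" and v: "0 < v" "v \<le> ip X X"
  shows "exp (- (x + 1)\<^sup>2 / 2) / sqrt (2 * pi) \<le> prob {\<omega>\<in>space M. X \<omega> > x * sqrt v}"
proof (cases rule: G_cases[OF X])
  case 1
  then show ?thesis using v by simp
next
  case (2 \<sigma>)
  let ?c = "exp (- (x + 1)\<^sup>2 / 2) / sqrt (2 * pi)"
  have s: "sqrt (ip X X) = \<sigma>"
    using 2 by simp
  have pointwise: "?c / \<sigma> * indicator {x * \<sigma><..(x + 1) * \<sigma>} y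
      \<le> normal_density 0 \<sigma> y * indicator {y. y > x * \<sigma>} y" for y
  proof (cases "y \<in> {x * \<sigma><..(x + 1) * \<sigma>}")
    case True
    have "y\<^sup>2 \<le> ((x + 1) * \<sigma>)\<^sup>2"
      using True 2(1) x by (intro power_mono) (auto intro: order.trans[of 0 "x * \<sigma>"])
    then have "y\<^sup>2 / \<sigma>\<^sup>2 \<le> (x + 1)\<^sup>2"
      unfolding power_mult_distrib using 2(1) by (subst pos_divide_le_eq) auto
    then have "- (x + 1)\<^sup>2 / 2 \<le> - y\<^sup>2 / (2 * \<sigma>\<^sup>2)"
      by (simp add: field_simps)
    then have "exp (- (x + 1)\<^sup>2 / 2) \<le> exp (- y\<^sup>2 / (2 * \<sigma>\<^sup>2))"
      by simp
    then show ?thesis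
      using True 2(1) by (simp add: normal_density_def real_sqrt_mult divide_right_mono)
  qed (auto simp: indicator_def)
  have "?c =
      (LINT y|lborel. ?c / \<sigma> * indicator {x * \<sigma><..(x + 1) * \<sigma>} y)"
    using 2(1) x by (simp add: distrib_right)
  also have "\<dots> \<le> (LINT y|lborel. normal_density 0 \<sigma> y * indicator {y. y > x * \<sigma>} y)"
    using 2(1) by (intro integral_mono pointwise integrable_real_mult_indicator integrable_mult_right integrable_real_indicator) auto
  also have "\<dots> = prob {\<omega>\<in>space M. X \<omega> > x * \<sigma>}"
    using prob_normal[OF 2(2), of "{y. y > x * \<sigma>}"] by simp
  also have "\<dots> \<le> prob {\<omega>\<in>space M. X \<omega> > x * sqrt v}"
  proof -
    have "x * sqrt v \<le> x * \<sigma>"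
      unfolding s[symmetric] using v x by (intro mult_left_mono real_sqrt_le_mono)
    then show ?thesis
      using X by (intro finite_measure_mono) auto
  qed
  finally show ?thesis .
qed

end

section \<open>Orthogonal Gaussian variables are independent\<close>

context prob_space begin

text \<open>Reweighting the measure by a bounded density and applying the one-dimensional uniqueness theorem
  of Levy takes the place of a uniqueness theorem for multivariate characteristic functions.\<close>

lemma char_factor_nonneg:
  assumes [measurable]: "w \<in> borel_measurable M" "Z \<in> borel_measurable M"
    and w: "\<And>\<omega>. \<omega> \<in> space M \<Longrightarrow> 0 \<le> w \<omega>" "\<And>\<omega>. \<omega> \<in> space M \<Longrightarrow> w \<omega> \<le> C"
    and fac: "\<And>\<tau>. (CLINT \<omega>|M. of_real (w \<omega>) * iexp (\<tau> * Z \<omega>))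
        = of_real (expectation w) * (CLINT \<omega>|M. iexp (\<tau> * Z \<omega>))"
    and B: "B \<in> sets borel"
  shows "expectation (\<lambda>\<omega>. w \<omega> * indicator B (Z \<omega>)) = expectation w * prob {\<omega>\<in>space M. Z \<omega> \<in> B}"
proof -
  have iw: "integrable M w"
    using w by (intro integrable_const_bound[where B=C]) auto
  show ?thesis
  proof (cases "expectation w = 0")
    case True
    then have "AE \<omega> in M. w \<omega> = 0"
      using integral_nonneg_eq_0_iff_AE[OF iw] w by auto
    then have "expectation (\<lambda>\<omega>. w \<omega> * indicator B (Z \<omega>)) = expectation (\<lambda>\<omega>. 0)"
      using B by (intro integral_cong_AE) auto
    with True show ?thesis by simp
  next
    case False
    have e: "expectation w > 0"
      using False w by (metis integral_nonneg_AE AE_I2 less_eq_real_def)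
    \<comment> \<open>The maximum makes the density nonnegative everywhere, whereas \<open>w\<close>
      is known to be so only on \<open>space M\<close>.\<close>
    define v where "v \<omega> = max 0 (w \<omega> / expectation w)" for \<omega>
    have v_eq: "v \<omega> = w \<omega> / expectation w" if "\<omega> \<in> space M" for \<omega>
      using w(1)[OF that] e by (simp add: v_def)
    have v_nonneg: "0 \<le> v \<omega>" for \<omega> by (simp add: v_def)
    have [measurable]: "v \<in> borel_measurable M" unfolding v_def by measurable
    have iv: "integrable M v"
      using iw by (subst Bochner_Integration.integrable_cong[OF refl v_eq]) auto
    have ev: "expectation v = 1"
      using e by (subst Bochner_Integration.integral_cong[OF refl v_eq]) auto
    define N where "N = density M v"
    let ?vB = "\<lambda>\<omega>. v \<omega> * indicator B (Z \<omega>)" and ?B = "Z -` B \<inter> space M"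
    have "emeasure N (space N) = 1"
      using ev iv v_nonneg by (simp add: N_def emeasure_density nn_integral_eq_integral cong: nn_integral_cong)
    then interpret N: prob_space N by (intro prob_spaceI) auto
    have [simp]: "space N = space M" "sets N = sets M" by (auto simp: N_def)
    have ZN[measurable]: "Z \<in> borel_measurable N" by (simp add: N_def)
    have "char (distr N borel Z) \<tau> = char (distr M borel Z) \<tau>" for \<tau>
    proof -
      have "char (distr N borel Z) \<tau> = (CLINT \<omega>|N. iexp (\<tau> * Z \<omega>))"
        unfolding char_def by (subst integral_distr) auto
      also have "\<dots> = (CLINT \<omega>|M. v \<omega> *\<^sub>R iexp (\<tau> * Z \<omega>))"
        unfolding N_def using v_nonneg by (subst integral_density) auto
      also have "\<dots> = (CLINT \<omega>|M. of_real (1 / expectation w) * (of_real (w \<omega>) * iexp (\<tau> * Z \<omega>)))"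
        by (intro Bochner_Integration.integral_cong) (auto simp: v_eq scaleR_conv_of_real)
      also have "\<dots> = of_real (1 / expectation w) * (of_real (expectation w) * (CLINT \<omega>|M. iexp (\<tau> * Z \<omega>)))"
        by (subst fac[symmetric]) (rule integral_mult_right_zero)
      also have "\<dots> = (CLINT \<omega>|M. iexp (\<tau> * Z \<omega>))"
        using e by simp
      also have "\<dots> = char (distr M borel Z) \<tau>"
        unfolding char_def by (subst integral_distr) auto
      finally show ?thesis .
    qed
    then have "distr N borel Z = distr M borel Z"
      by (intro Levy_uniqueness real_distribution_distr N.real_distribution_distr ext) auto
    then have "measure (distr N borel Z) B = measure (distr M borel Z) B" by simp
    then have "measure N ?B = prob {\<omega>\<in>space M. Z \<omega> \<in> B}"
      using B by (simp add: measure_distr vimage_def Int_def conj_commute)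
    moreover have "measure N ?B = expectation ?vB"
    proof -
      have "measure N ?B = (LINT \<omega>|N. indicator ?B \<omega>)"
        using B ZN by simp
      also have "\<dots> = (LINT \<omega>|M. v \<omega> *\<^sub>R indicator ?B \<omega>)"
        unfolding N_def using v_nonneg B by (subst integral_density) auto
      also have "\<dots> = expectation ?vB"
        by (intro Bochner_Integration.integral_cong) (auto simp: indicator_def)
      finally show ?thesis .
    qed
    moreover have "expectation ?vB
        = expectation (\<lambda>\<omega>. (1 / expectation w) * (w \<omega> * indicator B (Z \<omega>)))"
      by (intro Bochner_Integration.integral_cong) (auto simp: v_eq)
    ultimately show ?thesis
      using e by (simp add: field_simps)
  qed
qed

text \<open>The weight 1 + w is nonnegative and bounded by 2; the contribution of the constant 1 is
  subtracted afterwards.\<close>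

lemma char_factor_real:
  assumes [measurable]: "w \<in> borel_measurable M" "Z \<in> borel_measurable M"
    and w: "\<And>\<omega>. \<omega> \<in> space M \<Longrightarrow> \<bar>w \<omega>\<bar> \<le> 1"
    and fac: "\<And>\<tau>. (CLINT \<omega>|M. of_real (w \<omega>) * iexp (\<tau> * Z \<omega>))
        = of_real (expectation w) * (CLINT \<omega>|M. iexp (\<tau> * Z \<omega>))"
    and B: "B \<in> sets borel"
  shows "expectation (\<lambda>\<omega>. w \<omega> * indicator B (Z \<omega>)) = expectation w * prob {\<omega>\<in>space M. Z \<omega> \<in> B}"
proof -
  let ?p = "prob {\<omega>\<in>space M. Z \<omega> \<in> B}"
  have iw: "integrable M w"
    using w by (intro integrable_const_bound[where B=1]) auto
  have iZ: "integrable M (\<lambda>\<omega>. iexp (\<tau> * Z \<omega>))" for \<tau>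
    by (intro integrable_iexp) auto
  have iwZ: "integrable M (\<lambda>\<omega>. of_real (w \<omega>) * iexp (\<tau> * Z \<omega>))" for \<tau>
    using w by (intro integrable_const_bound[where B=1]) (auto simp: norm_mult)
  have iwB: "integrable M (\<lambda>\<omega>. w \<omega> * indicator B (Z \<omega>))"
    using w B by (intro integrable_const_bound[where B=1]) (auto simp: indicator_def)
  have iB: "integrable M (\<lambda>\<omega>. indicator B (Z \<omega>) :: real)"
    using B by (intro integrable_const_bound[where B=1]) (auto simp: indicator_def)
  have eB: "expectation (\<lambda>\<omega>. indicator B (Z \<omega>)) = ?p"
  proof -
    have "expectation (\<lambda>\<omega>. indicator B (Z \<omega>)) = expectation (indicator {\<omega>\<in>space M. Z \<omega> \<in> B} :: 'a \<Rightarrow> real)"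
      by (intro Bochner_Integration.integral_cong) (auto simp: indicator_def)
    then show ?thesis using B by simp
  qed
  have "expectation (\<lambda>\<omega>. (1 + w \<omega>) * indicator B (Z \<omega>))
      = expectation (\<lambda>\<omega>. 1 + w \<omega>) * ?p"
  proof (rule char_factor_nonneg[where C=2])
    show "(CLINT \<omega>|M. of_real (1 + w \<omega>) * iexp (\<tau> * Z \<omega>))
        = of_real (expectation (\<lambda>\<omega>. 1 + w \<omega>)) * (CLINT \<omega>|M. iexp (\<tau> * Z \<omega>))" for \<tau>
      using iw iZ[of \<tau>] iwZ[of \<tau>] fac[of \<tau>] by (simp add: distrib_right prob_space)
  qed (use w B in \<open>force simp: abs_le_iff\<close>)+
  then show ?thesis
    using iw iwB iB eB by (simp add: distrib_right prob_space)
qed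

text \<open>Real and imaginary part of the weight are treated separately. Both require the
  factorization for the conjugate weight as well, which comes from conjugating the hypothesis at
  -\<tau>.\<close>

lemma char_factor:
  fixes w :: "'a \<Rightarrow> complex"
  assumes [measurable]: "w \<in> borel_measurable M" "Z \<in> borel_measurable M"
    and w: "\<And>\<omega>. \<omega> \<in> space M \<Longrightarrow> norm (w \<omega>) \<le> 1"
    and fac: "\<And>\<tau>. (CLINT \<omega>|M. w \<omega> * iexp (\<tau> * Z \<omega>))
        = (CLINT \<omega>|M. w \<omega>) * (CLINT \<omega>|M. iexp (\<tau> * Z \<omega>))"
    and B: "B \<in> sets borel"
  shows "(CLINT \<omega>|M. w \<omega> * indicator B (Z \<omega>)) = (CLINT \<omega>|M. w \<omega>) * prob {\<omega>\<in>space M. Z \<omega> \<in> B}"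
proof -
  let ?p = "prob {\<omega>\<in>space M. Z \<omega> \<in> B}" and ?\<phi> = "\<lambda>\<tau>. CLINT \<omega>|M. iexp (\<tau> * Z \<omega>)"
    and ?w = "CLINT \<omega>|M. w \<omega>" and ?wB = "CLINT \<omega>|M. w \<omega> * indicator B (Z \<omega>)"
  have iw: "integrable M w"
    using w by (intro integrable_const_bound[where B=1]) auto
  have iwZ: "integrable M (\<lambda>\<omega>. w \<omega> * iexp (\<tau> * Z \<omega>))" for \<tau>
    using w by (intro integrable_const_bound[where B=1]) (auto simp: norm_mult)
  have [measurable]: "(\<lambda>\<omega>. cnj (w \<omega>)) \<in> borel_measurable M"
    by (rule measurable_compose[OF assms(1) borel_measurable_continuous_onI]) (intro continuous_intros)
  have icwZ: "integrable M (\<lambda>\<omega>. cnj (w \<omega>) * iexp (\<tau> * Z \<omega>))" for \<tau>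
    using w by (intro integrable_const_bound[where B=1]) (auto simp: norm_mult)
  have iwB: "integrable M (\<lambda>\<omega>. w \<omega> * indicator B (Z \<omega>))"
    using w B by (intro integrable_const_bound[where B=1]) (auto simp: indicator_def)
  have cfac: "(CLINT \<omega>|M. cnj (w \<omega>) * iexp (\<tau> * Z \<omega>))
      = cnj ?w * ?\<phi> \<tau>" for \<tau>
  proof -
    have "(CLINT \<omega>|M. cnj (w \<omega>) * iexp (\<tau> * Z \<omega>)) = (CLINT \<omega>|M. cnj (w \<omega> * iexp (- \<tau> * Z \<omega>)))"
      by (simp add: exp_cnj)
    also have "\<dots> = cnj (?w * (CLINT \<omega>|M. iexp (- \<tau> * Z \<omega>)))"
      unfolding Bochner_Integration.integral_cnj fac ..
    also have "\<dots> = cnj ?w * (CLINT \<omega>|M. cnj (iexp (- \<tau> * Z \<omega>)))"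
      by (simp only: complex_cnj_mult Bochner_Integration.integral_cnj)
    finally show ?thesis by (simp add: exp_cnj)
  qed
  have re: "expectation (\<lambda>\<omega>. Re (w \<omega>) * indicator B (Z \<omega>))
      = expectation (\<lambda>\<omega>. Re (w \<omega>)) * ?p"
  proof (rule char_factor_real)
    show "\<bar>Re (w \<omega>)\<bar> \<le> 1" if "\<omega> \<in> space M" for \<omega>
      using w[OF that] abs_Re_le_cmod[of "w \<omega>"] by linarith
    fix \<tau>
    have r: "complex_of_real (Re z) = (z + cnj z) / 2" for z by (simp add: complex_add_cnj)
    show "(CLINT \<omega>|M. of_real (Re (w \<omega>)) * iexp (\<tau> * Z \<omega>))
        = of_real (expectation (\<lambda>\<omega>. Re (w \<omega>))) * ?\<phi> \<tau>"
      using iw iwZ[of \<tau>] icwZ[of \<tau>] fac[of \<tau>] cfac[of \<tau>]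
      unfolding integral_Re[OF iw] r by (simp add: distrib_right add_divide_distrib)
  qed (use B in auto)
  have im: "expectation (\<lambda>\<omega>. Im (w \<omega>) * indicator B (Z \<omega>))
      = expectation (\<lambda>\<omega>. Im (w \<omega>)) * ?p"
  proof (rule char_factor_real)
    show "\<bar>Im (w \<omega>)\<bar> \<le> 1" if "\<omega> \<in> space M" for \<omega>
      using w[OF that] abs_Im_le_cmod[of "w \<omega>"] by linarith
    fix \<tau>
    have r: "complex_of_real (Im z) = (- \<i> / 2) * z + (\<i> / 2) * cnj z" for z
      by (simp add: complex_eq_iff)
    show "(CLINT \<omega>|M. of_real (Im (w \<omega>)) * iexp (\<tau> * Z \<omega>))
        = of_real (expectation (\<lambda>\<omega>. Im (w \<omega>))) * ?\<phi> \<tau>"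
      using iwZ[of \<tau>] icwZ[of \<tau>] fac[of \<tau>] cfac[of \<tau>]
      unfolding integral_Im[OF iw] r
      by (simp only: distrib_right mult.assoc integral_mult_right_zero integrable_mult_right Bochner_Integration.integral_add)
  qed (use B in auto)
  show ?thesis
  proof (rule complex_eqI)
    have "Re ?wB = expectation (\<lambda>\<omega>. Re (w \<omega> * indicator B (Z \<omega>)))"
      using integral_Re[OF iwB] by simp
    also have "\<dots> = expectation (\<lambda>\<omega>. Re (w \<omega>) * indicator B (Z \<omega>))"
      by (intro Bochner_Integration.integral_cong) (auto simp: indicator_def)
    finally show "Re ?wB
        = Re (?w * ?p)"
      using re integral_Re[OF iw] by simp
    have "Im ?wB = expectation (\<lambda>\<omega>. Im (w \<omega> * indicator B (Z \<omega>)))"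
      using integral_Im[OF iwB] by simp
    also have "\<dots> = expectation (\<lambda>\<omega>. Im (w \<omega>) * indicator B (Z \<omega>))"
      by (intro Bochner_Integration.integral_cong) (auto simp: indicator_def)
    finally show "Im ?wB
        = Im (?w * ?p)"
      using im integral_Im[OF iw] by simp
  qed
qed

end

context gaussian_space begin

lemma ip_sum_sum_orthogonal:
  assumes "finite K" "\<And>i. i \<in> K \<Longrightarrow> e i \<in> G" "\<And>i j. i \<in> K \<Longrightarrow> j \<in> K \<Longrightarrow> i \<noteq> j \<Longrightarrow> ip (e i) (e j) = 0"
  shows "ip (\<lambda>\<omega>. \<Sum>i\<in>K. s i * e i \<omega>) (\<lambda>\<omega>. \<Sum>i\<in>K. s i * e i \<omega>) = (\<Sum>i\<in>K. (s i)\<^sup>2 * ip (e i) (e i))"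
proof -
  let ?S = "\<lambda>\<omega>. \<Sum>i\<in>K. s i * e i \<omega>"
  have S: "?S \<in> G" using assms by (intro sum_mem) auto
  have "ip ?S (e j) = s j * ip (e j) (e j)" if "j \<in> K" for j
  proof -
    have "ip ?S (e j) = (\<Sum>i\<in>K. s i * ip (e i) (e j))"
      using assms that by (intro ip_sum) auto
    also have "\<dots> = (\<Sum>i\<in>K. if i = j then s j * ip (e j) (e j) else 0)"
      using assms that by (intro sum.cong) auto
    finally show ?thesis using assms that by simp
  qed
  then have "(\<Sum>i\<in>K. s i * ip (e i) ?S) = (\<Sum>i\<in>K. (s i)\<^sup>2 * ip (e i) (e i))"
    by (intro sum.cong) (auto simp: ip_commute power2_eq_square)
  then show ?thesis
    using ip_sum[OF assms(1,2) S, where c=s] by simp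
qed

text \<open>The induction turns exponentials into indicators one variable at a time. The set
  \<open>K\<close> of variables still inside an exponential has to be arbitrary, since the variable
  to be converted is first absorbed into it.\<close>

lemma orthogonal_char:
  fixes e :: "'i \<Rightarrow> 'a \<Rightarrow> real"
  assumes e: "\<And>i. e i \<in> G" and orth: "\<And>i j. i \<noteq> j \<Longrightarrow> ip (e i) (e j) = 0"
    and J: "finite J" and K: "finite K" "J \<inter> K = {}" and B: "\<And>i. B i \<in> sets borel"
  shows "(CLINT \<omega>|M. (\<Prod>i\<in>J. indicator (B i) (e i \<omega>)) * iexp (\<Sum>i\<in>K. s i * e i \<omega>))
     = (\<Prod>i\<in>J. prob {\<omega>\<in>space M. e i \<omega> \<in> B i}) * (CLINT \<omega>|M. iexp (\<Sum>i\<in>K. s i * e i \<omega>))"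
  using J K
proof (induction J arbitrary: K s rule: finite_induct)
  case (insert j J)
  let ?I = "\<lambda>\<omega>. (\<Prod>i\<in>J. indicator (B i) (e i \<omega>)) :: complex" and ?s = "\<lambda>\<tau>. s(j := \<tau>)"
    and ?S = "\<lambda>K s \<omega>. \<Sum>i\<in>K. s i * e i \<omega>" and ?V = "\<lambda>K s. \<Sum>i\<in>K. (s i)\<^sup>2 * ip (e i) (e i)"
  let ?T = "\<lambda>\<tau>. ?S (insert j K) (?s \<tau>)"
  have [measurable]: "e i \<in> borel_measurable M" for i using e by simp
  have charK: "(CLINT \<omega>|M. iexp (?S K s \<omega>)) = exp (- ?V K s / 2)"
    if "finite K" for K s
    using char_G[OF sum_mem[of K e s]] ip_sum_sum_orthogonal[of K e s] e orth that by simp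
  define w where "w \<omega> = ?I \<omega> * iexp (?S K s \<omega>)" for \<omega>
  have prod_le: "norm (\<Prod>i\<in>J. indicator (B i) (e i \<omega>) :: complex) \<le> 1" for \<omega>
    unfolding prod_norm[symmetric] by (intro prod_le_1) (auto simp: indicator_def)
  have "(CLINT \<omega>|M. w \<omega> * indicator (B j) (e j \<omega>))
      = (CLINT \<omega>|M. w \<omega>) * prob {\<omega>\<in>space M. e j \<omega> \<in> B j}"
  proof (rule char_factor)
    show "w \<in> borel_measurable M" unfolding w_def using B by measurable
    show "norm (w \<omega>) \<le> 1" for \<omega>
      using prod_le[of \<omega>] by (simp add: w_def norm_mult)
    fix \<tau>
    have jK: "j \<notin> K" "finite K" "J \<inter> insert j K = {}" "J \<inter> K = {}" using insert by auto
    have "(CLINT \<omega>|M. w \<omega> * iexp (\<tau> * e j \<omega>))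
        = (CLINT \<omega>|M. ?I \<omega> * iexp (?T \<tau> \<omega>))"
    proof (intro Bochner_Integration.integral_cong refl)
      fix \<omega>
      have "(?T \<tau> \<omega>) = \<tau> * e j \<omega> + (\<Sum>i\<in>K. (s(j := \<tau>)) i * e i \<omega>)"
        using jK by simp
      also have "(\<Sum>i\<in>K. (s(j := \<tau>)) i * e i \<omega>) = (?S K s \<omega>)"
        using jK by (intro sum.cong) auto
      finally show "w \<omega> * iexp (\<tau> * e j \<omega>)
          = ?I \<omega> * iexp (?T \<tau> \<omega>)"
        by (simp add: w_def exp_add[symmetric] distrib_left add.commute mult.assoc)
    qed
    \<comment> \<open>The induction hypothesis is applied to \<open>insert j K\<close>, with \<tau>
      as the coefficient of \<open>e j\<close>.\<close>
    also have "\<dots> = (\<Prod>i\<in>J. prob {\<omega>\<in>space M. e i \<omega> \<in> B i})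
        * (CLINT \<omega>|M. iexp (?T \<tau> \<omega>))"
      using jK by (intro insert.IH) auto
    also have "(CLINT \<omega>|M. iexp (?T \<tau> \<omega>))
        = (CLINT \<omega>|M. iexp (?S K s \<omega>)) * (CLINT \<omega>|M. iexp (\<tau> * e j \<omega>))"
    proof -
      \<comment> \<open>Orthogonality makes variances additive, and by the Gaussian formula this is
        multiplicativity of the characteristic functions.\<close>
      have "?V (insert j K) (?s \<tau>)
          = ?V K s + \<tau>\<^sup>2 * ip (e j) (e j)"
        using jK by (simp add: add.commute) (intro sum.cong; auto)
      then have "exp (- ?V (insert j K) (?s \<tau>) / 2)
          = exp (- ?V K s / 2) * exp (- (\<tau>\<^sup>2 * ip (e j) (e j)) / 2)"
        by (simp only: exp_add[symmetric]) (simp add: field_simps)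
      then show ?thesis
        using charK[of "insert j K" "s(j := \<tau>)"] charK[of K s] charK[of "{j}" "\<lambda>_. \<tau>"] jK
        by (simp only: of_real_mult) simp
    qed
    finally show "(CLINT \<omega>|M. w \<omega> * iexp (\<tau> * e j \<omega>)) = (CLINT \<omega>|M. w \<omega>) * (CLINT \<omega>|M. iexp (\<tau> * e j \<omega>))"
      unfolding w_def using insert.IH[of K s] jK by simp
  qed (use B in auto)
  then show ?case
    using insert by (simp add: w_def mult_ac)
qed simp

lemma orthogonal_indep_vars:
  fixes e :: "'i \<Rightarrow> 'a \<Rightarrow> real"
  assumes e: "\<And>i. e i \<in> G" and orth: "\<And>i j. i \<noteq> j \<Longrightarrow> ip (e i) (e j) = 0"
  shows "indep_vars (\<lambda>_. borel) e UNIV"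
  unfolding indep_vars_def2
proof (intro conjI ballI indep_setsI)
  have [measurable]: "e i \<in> borel_measurable M" for i using e by simp
  show "random_variable borel (e i)" for i by simp
  show "{e i -` A \<inter> space M |A. A \<in> sets borel} \<subseteq> events" for i by auto
  fix A J assume J: "J \<noteq> {}" "J \<subseteq> UNIV" "finite J"
    and "\<forall>j\<in>J. A j \<in> {e j -` A \<inter> space M |A. A \<in> sets borel}"
  then obtain B' where B': "\<And>j. j \<in> J \<Longrightarrow> B' j \<in> sets borel \<and> A j = e j -` B' j \<inter> space M"
    by simp metis
  \<comment> \<open>The empty set outside \<open>J\<close> only serves to have a Borel set for every
    index.\<close>
  define B where "B j = (if j \<in> J then B' j else {})" for j
  have B: "B j \<in> sets borel" for j using B' by (simp add: B_def)
  have A: "A j = {\<omega>\<in>space M. e j \<omega> \<in> B j}" if "j \<in> J" for j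
    using B' that by (auto simp: B_def)
  have "complex_of_real (prob (\<Inter>j\<in>J. A j)) = (CLINT \<omega>|M. complex_of_real (indicator (\<Inter>j\<in>J. A j) \<omega>))"
  proof -
    have "(\<Inter>j\<in>J. A j) \<in> events"
      using A B J by (intro sets.finite_INT) auto
    then show ?thesis by simp
  qed
  also have "\<dots> = (CLINT \<omega>|M. (\<Prod>i\<in>J. indicator (B i) (e i \<omega>)) * iexp (\<Sum>i\<in>{}. 0 * e i \<omega>))"
  proof (intro Bochner_Integration.integral_cong refl)
    fix \<omega> assume "\<omega> \<in> space M"
    then show "complex_of_real (indicator (\<Inter>j\<in>J. A j) \<omega>) = (\<Prod>i\<in>J. indicator (B i) (e i \<omega>)) * iexp (\<Sum>i\<in>{}. 0 * e i \<omega>)"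
      using J A by (auto simp: indicator_def split: if_splits)
  qed
  also have "\<dots> = complex_of_real (\<Prod>j\<in>J. prob (A j))"
    using orthogonal_char[of e J "{}" B "\<lambda>_. 0"] e orth J B A by (simp add: prob_space)
  finally show "prob (\<Inter>j\<in>J. A j) = (\<Prod>j\<in>J. prob (A j))"
    using of_real_eq_iff by blast
qed

end

section \<open>A zero-one law for the modulus of continuity\<close>

text \<open>The constant is the infimum of the levels that \<open>Y\<close> stays below almost
  surely. Comparing with rational levels only keeps the exceptional null sets countable in
  number.\<close>

lemma (in prob_space) zero_one_imp_AE_const:
  fixes Y :: "'a \<Rightarrow> ereal"
  assumes Y[measurable]: "Y \<in> borel_measurable M"
    and zo: "\<And>c. prob {\<omega>\<in>space M. Y \<omega> \<le> c} = 0 \<or> prob {\<omega>\<in>space M. Y \<omega> \<le> c} = 1"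
  shows "\<exists>K. AE \<omega> in M. Y \<omega> = K"
proof -
  let ?r = "\<lambda>r. ereal (real_of_rat r)"
  define S where "S = {c. prob {\<omega>\<in>space M. Y \<omega> \<le> c} = 1}"
  define K where "K = Inf S"
  have "AE \<omega> in M. \<forall>r::rat. K < ?r r \<longrightarrow> Y \<omega> \<le> ?r r"
  proof (subst AE_all_countable, rule allI)
    fix r :: rat
    show "AE \<omega> in M. K < ?r r \<longrightarrow> Y \<omega> \<le> ?r r"
    proof (cases "K < ?r r")
      case True
      then obtain c where "c \<in> S" "c < ?r r"
        unfolding K_def by (auto simp: Inf_less_iff)
      then have "AE \<omega> in M. Y \<omega> \<le> c"
        by (auto simp: S_def prob_Collect_eq_1)
      with \<open>c < _\<close> show ?thesis by (auto elim!: eventually_mono)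
    qed simp
  qed
  moreover have "AE \<omega> in M. \<forall>r::rat. ?r r < K \<longrightarrow> \<not> Y \<omega> \<le> ?r r"
  proof (subst AE_all_countable, rule allI)
    fix r :: rat
    show "AE \<omega> in M. ?r r < K \<longrightarrow> \<not> Y \<omega> \<le> ?r r"
    proof (cases "?r r < K")
      case True
      then have "?r r \<notin> S"
        unfolding K_def by (metis Inf_lower not_le)
      then have "prob {\<omega>\<in>space M. Y \<omega> \<le> ?r r} = 0"
        using zo[of "?r r"] by (simp add: S_def)
      then show ?thesis by (subst (asm) prob_eq_0) (auto elim!: eventually_mono)
    qed simp
  qed
  ultimately have "AE \<omega> in M. Y \<omega> = K"
  proof eventually_elim
    case (elim \<omega>)
    show ?case
    proof (rule antisym; rule ccontr)
      assume "\<not> Y \<omega> \<le> K"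
      then obtain r :: rat where "K < ?r r" "?r r < Y \<omega>"
        using ereal_dense3[of K "Y \<omega>"] by (auto simp: not_le)
      with elim(1) show False by (auto simp: not_le[symmetric])
    next
      assume "\<not> K \<le> Y \<omega>"
      then obtain r :: rat where "Y \<omega> < ?r r" "?r r < K"
        using ereal_dense3[of "Y \<omega>" K] by (auto simp: not_le)
      with elim(2) show False by auto
    qed
  qed
  then show ?thesis by blast
qed

text \<open>For a decreasing \<open>P\<close> the infimum is the limit of the suprema. Values are
  extended reals because finiteness is established only at the end.\<close>

definition lim_modulus :: "(nat \<Rightarrow> ('i \<times> 'i) set) \<Rightarrow> ('i \<Rightarrow> 'i \<Rightarrow> real) \<Rightarrow> ('i \<Rightarrow> real) \<Rightarrow> ereal" where
  "lim_modulus P g x = (INF N. SUP (i, j)\<in>P N. ereal (\<bar>x i - x j\<bar> / g i j))"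

text \<open>A perturbation with increments O(s) is invisible to a modulus measured in g when s =
  o(g). The estimate is one-sided; exchanging x and y turns it into equality.\<close>

lemma lim_modulus_perturb:
  assumes P: "decseq P"
    and g: "\<And>N i j. (i, j) \<in> P N \<Longrightarrow> 0 < g i j"
    and s: "\<And>\<epsilon>. 0 < \<epsilon> \<Longrightarrow> \<exists>N. \<forall>(i, j)\<in>P N. s i j \<le> \<epsilon> * g i j"
    and C: "0 \<le> C" "\<And>i j. \<bar>(x i - x j) - (y i - y j)\<bar> \<le> C * s i j"
  shows "lim_modulus P g x \<le> lim_modulus P g y"
proof (rule ereal_le_epsilon2)
  fix e :: real assume e: "0 < e"
  \<comment> \<open>Dividing by C + 1 instead of C covers C = 0.\<close>
  obtain N0 where N0: "\<And>i j. (i, j) \<in> P N0 \<Longrightarrow> s i j \<le> e / (C + 1) * g i j"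
    using s[of "e / (C + 1)"] e C(1) by force
  let ?S = "\<lambda>x N. SUP (i, j)\<in>P N. ereal (\<bar>x i - x j\<bar> / g i j)"
  have "lim_modulus P g x - ereal e \<le> ?S y N" for N
  proof -
    let ?N = "max N N0"
    have "?S x ?N \<le> ?S y ?N + ereal e"
    proof (intro SUP_least, clarify)
      fix i j assume ij: "(i, j) \<in> P ?N"
      have "P ?N \<subseteq> P N0" using decseqD[OF P, of N0 ?N] by simp
      with ij have ij0: "(i, j) \<in> P N0" by blast
      have gp: "0 < g i j" using g[OF ij] .
      have "C * s i j \<le> C * (e / (C + 1) * g i j)"
        using N0[OF ij0] C(1) by (rule mult_left_mono)
      also have "\<dots> \<le> e * g i j"
        using e C(1) gp by (simp add: field_simps)
      finally have "\<bar>x i - x j\<bar> \<le> \<bar>y i - y j\<bar> + e * g i j"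
        using C(2)[of i j] by linarith
      then have "\<bar>x i - x j\<bar> / g i j \<le> \<bar>y i - y j\<bar> / g i j + e"
        using gp by (simp add: field_simps)
      then have "ereal (\<bar>x i - x j\<bar> / g i j) \<le> ereal (\<bar>y i - y j\<bar> / g i j) + ereal e"
        by simp
      also have "\<dots> \<le> ?S y ?N + ereal e"
        using ij by (intro add_right_mono SUP_upper2[of "(i, j)"]) auto
      finally show "ereal (\<bar>x i - x j\<bar> / g i j) \<le> ?S y ?N + ereal e" .
    qed
    moreover have "lim_modulus P g x \<le> ?S x ?N"
      unfolding lim_modulus_def by (rule INF_lower) simp
    moreover have "?S y ?N \<le> ?S y N"
      using decseqD[OF P, of N ?N] by (intro SUP_subset_mono) auto
    ultimately have "lim_modulus P g x \<le> ?S y N + ereal e"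
      by (meson add_right_mono order.trans)
    then show ?thesis by (simp add: ereal_minus_le)
  qed
  then have "lim_modulus P g x - ereal e \<le> lim_modulus P g y"
    unfolding lim_modulus_def[of P g y] by (rule INF_greatest)
  then show "lim_modulus P g x \<le> lim_modulus P g y + ereal e"
    by (simp add: ereal_minus_le)
qed

lemma lim_modulus_measurable:
  assumes [measurable]: "\<And>i. X i \<in> borel_measurable N" and "\<And>n. countable (P n)"
  shows "(\<lambda>\<omega>. lim_modulus P g (\<lambda>i. X i \<omega>)) \<in> borel_measurable N"
  unfolding lim_modulus_def
  by (intro borel_measurable_INF borel_measurable_SUP) (use assms in \<open>auto simp: split_beta\<close>)

section \<open>Gram-Schmidt innovations and the tail event\<close>

context gaussian_space begin

definition sd :: "('p \<Rightarrow> 'a \<Rightarrow> real) \<Rightarrow> 'p \<Rightarrow> 'p \<Rightarrow> real" where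
  "sd X p q = sqrt (ip (\<lambda>\<omega>. X p \<omega> - X q \<omega>) (\<lambda>\<omega>. X p \<omega> - X q \<omega>))"

text \<open>Gram-Schmidt without normalization: the residual of \<open>X m\<close> after projection
  on its predecessors. Linearly dependent variables may occur in the sequence and then give a
  residual of variance 0.\<close>

function innov :: "(nat \<Rightarrow> 'a \<Rightarrow> real) \<Rightarrow> nat \<Rightarrow> 'a \<Rightarrow> real" where
  "innov X m = (\<lambda>\<omega>. X m \<omega> -
     (\<Sum>i<m. ip (X m) (innov X i) / ip (innov X i) (innov X i) * innov X i \<omega>))"
  by pat_completeness auto
termination by (relation "Wellfounded.measure snd") auto

declare innov.simps [simp del]

lemma ip_eq_0_degenerate:
  assumes "X \<in> G" "Y \<in> G" "ip Y Y = 0" shows "ip X Y = 0"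
  using ip_Cauchy_Schwarz[OF assms(1,2)] assms(3) by simp

context
  fixes X :: "nat \<Rightarrow> 'a \<Rightarrow> real"
  assumes X: "\<And>i. X i \<in> G"
begin

text \<open>If the innovation is almost surely 0, division by zero makes the coefficient 0. The resulting
  expansion of \<^term>\<open>X m\<close> then holds only almost everywhere.\<close>

definition coef :: "nat \<Rightarrow> nat \<Rightarrow> real" where
  "coef m i = ip (X m) (innov X i) / ip (innov X i) (innov X i)"

lemma innov_eq: "innov X m = (\<lambda>\<omega>. X m \<omega> - (\<Sum>i<m. coef m i * innov X i \<omega>))"
  unfolding coef_def by (rule innov.simps)

lemma innov_mem: "innov X m \<in> G"
proof (induction m rule: less_induct)
  case (less m)
  then show ?case
    by (subst innov_eq) (intro diff_mem sum_mem X; simp)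
qed

lemma ip_innov_left:
  assumes "Z \<in> G"
  shows "ip (innov X m) Z = ip (X m) Z - (\<Sum>i<m. coef m i * ip (innov X i) Z)"
  using assms
  by (subst innov_eq) (simp add: ip_diff X sum_mem innov_mem ip_sum)

lemma innov_orth_less: "i < m \<Longrightarrow> ip (innov X m) (innov X i) = 0"
proof (induction m arbitrary: i rule: less_induct)
  case (less m)
  have "ip (innov X m) (innov X i) = ip (X m) (innov X i) - (\<Sum>j<m. coef m j * ip (innov X j) (innov X i))"
    by (rule ip_innov_left[OF innov_mem])
  also have "(\<Sum>j<m. coef m j * ip (innov X j) (innov X i))
      = (\<Sum>j<m. if j = i then coef m i * ip (innov X i) (innov X i) else 0)"
  proof (intro sum.cong refl)
    fix j assume "j \<in> {..<m}"
    then show "coef m j * ip (innov X j) (innov X i) = (if j = i then coef m i * ip (innov X i) (innov X i) else 0)"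
      using less by (cases i j rule: linorder_cases) (auto simp: ip_commute[of _ "innov X i"], metis ip_commute)
  qed
  also have "\<dots> = coef m i * ip (innov X i) (innov X i)"
    using less by simp
  \<comment> \<open>If the innovation has variance 0, the coefficient is 0 by convention, and
    Cauchy-Schwarz makes the right-hand side 0 too.\<close>
  also have "\<dots> = ip (X m) (innov X i)"
    using ip_eq_0_degenerate[OF X[of m] innov_mem[of i]] by (simp add: coef_def)
  finally show ?case by simp
qed

lemma innov_orth: "i \<noteq> m \<Longrightarrow> ip (innov X m) (innov X i) = 0"
  by (metis innov_orth_less ip_commute linorder_neqE_nat)

lemma indep_innov: "indep_vars (\<lambda>_. borel) (innov X) UNIV"
  by (rule orthogonal_indep_vars) (auto simp: innov_mem innov_orth)

lemma ip_X_innov: "ip (X m) (innov X i) = (if i < m then coef m i * ip (innov X i) (innov X i)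
    else if i = m then ip (innov X m) (innov X m) else 0)"
proof -
  have "ip (innov X m) (innov X i) = ip (X m) (innov X i) - (\<Sum>j<m. coef m j * ip (innov X j) (innov X i))"
    by (rule ip_innov_left[OF innov_mem])
  moreover have "(\<Sum>j<m. coef m j * ip (innov X j) (innov X i)) = 0" if "\<not> i < m"
    using that innov_orth by (intro sum.neutral) (auto simp: ip_commute)
  ultimately show ?thesis
    using innov_orth[of i m] ip_eq_0_degenerate[OF X[of m] innov_mem[of i]]
    by (auto simp: coef_def ip_commute)
qed

lemma AE_innov_expansion:
  "AE \<omega> in M. \<forall>m. X m \<omega> = (\<Sum>i\<le>m. coef m i * innov X i \<omega>)"
proof -
  have "AE \<omega> in M. ip (innov X m) (innov X m) = 0 \<longrightarrow> innov X m \<omega> = 0" for m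
    by (cases rule: G_cases[OF innov_mem[of m]]) auto
  then have "AE \<omega> in M. \<forall>m. ip (innov X m) (innov X m) = 0 \<longrightarrow> innov X m \<omega> = 0"
    by (simp add: AE_all_countable)
  then show ?thesis
  proof eventually_elim
    case (elim \<omega>)
    show ?case
    proof
      fix m
      \<comment> \<open>The diagonal coefficient is 1 unless the innovation is degenerate, in which
        case the innovation itself vanishes at this \<omega>.\<close>
      have "coef m m * innov X m \<omega> = innov X m \<omega>"
        using elim[rule_format, of m] ip_X_innov[of m m] by (cases "ip (innov X m) (innov X m) = 0") (auto simp: coef_def)
      moreover have "innov X m \<omega> = X m \<omega> - (\<Sum>i<m. coef m i * innov X i \<omega>)"
        by (subst innov_eq) simp
      ultimately show "X m \<omega> = (\<Sum>i\<le>m. coef m i * innov X i \<omega>)"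
        by (simp only: lessThan_Suc_atMost[symmetric] sum.lessThan_Suc)
    qed
  qed
qed

lemma coef_diff_le:
  "\<bar>coef m i - coef l i\<bar> \<le> sd X m l / sqrt (ip (innov X i) (innov X i))"
proof (cases "ip (innov X i) (innov X i) = 0")
  case False
  let ?v = "ip (innov X i) (innov X i)"
  have v: "0 < ?v" using False ip_nonneg[of "innov X i"] by simp
  have "coef m i - coef l i = ip (\<lambda>\<omega>. X m \<omega> - X l \<omega>) (innov X i) / ?v"
    by (simp add: coef_def ip_diff X innov_mem diff_divide_distrib)
  also have "\<bar>\<dots>\<bar> = \<bar>ip (\<lambda>\<omega>. X m \<omega> - X l \<omega>) (innov X i)\<bar> / ?v"
    using v by (simp only: abs_divide abs_of_pos)
  also have "\<dots> \<le> sd X m l * sqrt ?v / ?v"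
    unfolding sd_def by (rule divide_right_mono[OF ip_Cauchy_Schwarz[OF diff_mem[OF X X] innov_mem] ip_nonneg])
  also have "\<dots> = sd X m l / sqrt ?v"
    using v by (simp add: field_simps)
  finally show ?thesis .
qed (simp add: coef_def)

text \<open>The argument runs on the truncated expansions \<open>Xt n\<close> instead of
  \<open>X\<close>, which agrees with \<open>Xt 0\<close> only almost everywhere. Dropping
  \<open>n\<close> innovations then leaves the limit unchanged at every \<omega>, so its sublevel
  sets belong literally to each tail \<sigma>-algebra.\<close>

theorem lim_modulus_AE_const:
  assumes P: "decseq P"
    and g: "\<And>N i j. (i, j) \<in> P N \<Longrightarrow> 0 < g i j"
    and s: "\<And>\<epsilon>. 0 < \<epsilon> \<Longrightarrow> \<exists>N. \<forall>(i, j)\<in>P N.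
      sd X i j \<le> \<epsilon> * g i j"
  shows "\<exists>K. AE \<omega> in M. lim_modulus P g (\<lambda>i. X i \<omega>) = K"
proof -
  define e where "e = innov X"
  have [measurable]: "e i \<in> borel_measurable M" for i
    using innov_mem by (simp add: e_def)
  define Xt where "Xt n m \<omega> = (\<Sum>i\<in>{n..m}. coef m i * e i \<omega>)" for n m \<omega>
  define L where "L n \<omega> = lim_modulus P g (\<lambda>m. Xt n m \<omega>)" for n \<omega>
  have cP: "countable (P n)" for n by auto
  let ?L = "\<lambda>c. {\<omega>\<in>space M. L 0 \<omega> \<le> c}"
  have L_eq: "L n \<omega> = L 0 \<omega>" for n \<omega>
  proof -
    \<comment> \<open>This Lipschitz constant depends on \<omega>, which is harmless because the
      comparison of the two limits is made for each \<omega> separately.\<close>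
    define C where "C = (\<Sum>k<n. \<bar>e k \<omega>\<bar> / sqrt (ip (e k) (e k)))"
    have C: "0 \<le> C" unfolding C_def by (intro sum_nonneg) (auto simp: ip_nonneg)
    have coef0: "coef m k = 0" if "m < k" for m k
      using that ip_X_innov[of m k] by (simp add: coef_def)
    have split: "Xt 0 m \<omega> - Xt n m \<omega> = (\<Sum>k<n. coef m k * e k \<omega>)" for m
    proof -
      \<comment> \<open>For m < n - 1 the index set on the right is larger, but coefficients above
        the diagonal vanish.\<close>
      have "Xt 0 m \<omega> = (\<Sum>k\<in>{..<n} \<union> {n..m}. coef m k * e k \<omega>)"
        unfolding Xt_def by (rule sum.mono_neutral_left) (auto simp: coef0 not_le)
      also have "\<dots> = (\<Sum>k<n. coef m k * e k \<omega>) + Xt n m \<omega>"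
        unfolding Xt_def by (rule sum.union_disjoint) auto
      finally show ?thesis by simp
    qed
    have bound: "\<bar>(Xt 0 i \<omega> - Xt n i \<omega>) - (Xt 0 j \<omega> - Xt n j \<omega>)\<bar> \<le> C * sd X i j" for i j
    proof -
      have "(Xt 0 i \<omega> - Xt n i \<omega>) - (Xt 0 j \<omega> - Xt n j \<omega>) = (\<Sum>k<n. (coef i k - coef j k) * e k \<omega>)"
        unfolding split by (simp add: sum_subtractf left_diff_distrib)
      also have "\<bar>\<dots>\<bar> \<le> (\<Sum>k<n. \<bar>coef i k - coef j k\<bar> * \<bar>e k \<omega>\<bar>)"
        by (rule order.trans[OF sum_abs]) (simp add: abs_mult)
      also have "\<dots> \<le> (\<Sum>k<n. sd X i j / sqrt (ip (e k) (e k)) * \<bar>e k \<omega>\<bar>)"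
        unfolding e_def by (intro sum_mono mult_right_mono coef_diff_le) auto
      also have "\<dots> = C * sd X i j"
        unfolding C_def sum_distrib_right by (intro sum.cong) auto
      finally show ?thesis .
    qed
    have "lim_modulus P g (\<lambda>m. Xt k m \<omega>) \<le> lim_modulus P g (\<lambda>m. Xt l m \<omega>)"
      if "(k, l) = (n, 0) \<or> (k, l) = (0, n)" for k l
      using bound that by (intro lim_modulus_perturb[OF P g s C]) (auto simp: abs_le_iff algebra_simps)
    then show ?thesis unfolding L_def by (intro antisym) auto
  qed
  define A where "A i = sigma_sets (space M) {e i -` B \<inter> space M | B. B \<in> sets borel}" for i
  have A_space: "A i \<subseteq> Pow (space M)" for i
  proof
    fix x assume "x \<in> A i"
    then have "x \<subseteq> space M"
      unfolding A_def by (rule sigma_sets_into_sp[rotated]) blast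
    then show "x \<in> Pow (space M)" by simp
  qed
  have "prob (?L c) = 0 \<or> prob (?L c) = 1" for c
  proof (rule kolmogorov_0_1_law[of A])
    show "sigma_algebra (space M) (A i)" for i
      unfolding A_def by (rule sigma_algebra_sigma_sets) auto
    show "indep_sets A UNIV"
      using indep_innov unfolding indep_vars_def A_def e_def by simp
    show "(?L c) \<in> tail_events A"
      unfolding tail_events_def
    proof
      fix n
      define N where "N = sigma (space M) (\<Union> (A ` {n..}))"
      have sN: "space N = space M" "sets N = sigma_sets (space M) (\<Union> (A ` {n..}))"
        using A_space unfolding N_def by (auto simp: space_measure_of_conv sets_measure_of_conv)
      have eN: "e i \<in> borel_measurable N" if "n \<le> i" for i
      proof (rule measurableI)
        fix B :: "real set" assume "B \<in> sets borel"
        then show "e i -` B \<inter> space N \<in> sets N"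
          unfolding sN using that by (intro sigma_sets.Basic) (auto simp: A_def intro!: sigma_sets.Basic)
      qed simp
      have "(\<lambda>\<omega>. Xt n m \<omega>) \<in> borel_measurable N" for m
        unfolding Xt_def using eN by (intro borel_measurable_sum borel_measurable_times) auto
      then have [measurable]: "L n \<in> borel_measurable N"
        unfolding L_def by (intro lim_modulus_measurable cP)
      have "{\<omega>\<in>space N. L n \<omega> \<le> c} \<in> sets N" by measurable
      then show "(?L c) \<in> sigma_sets (space M) (\<Union> (A ` {n..}))"
        unfolding sN L_eq[of n] .
    qed
  qed
  moreover have "L 0 \<in> borel_measurable M"
    unfolding L_def
  proof (rule lim_modulus_measurable)
    show "Xt 0 m \<in> borel_measurable M" for m
      unfolding Xt_def by measurable
  qed (rule cP)
  ultimately obtain K where "AE \<omega> in M. L 0 \<omega> = K"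
    using zero_one_imp_AE_const[of "L 0"] by blast
  moreover have "AE \<omega> in M. lim_modulus P g (\<lambda>i. X i \<omega>) = L 0 \<omega>"
    using AE_innov_expansion by eventually_elim (simp add: L_def Xt_def e_def atLeast0AtMost)
  ultimately have "AE \<omega> in M. lim_modulus P g (\<lambda>i. X i \<omega>) = K"
    by eventually_elim simp
  then show ?thesis by blast
qed

end

end

section \<open>Chaining\<close>

lemma geometric_scale:
  fixes r :: real
  assumes "0 < r" "r \<le> 1"
  obtains j where "(1/2) ^ Suc j < r" "r \<le> (1/2) ^ j"
proof -
  define j where "j = (LEAST j. (1/2) ^ Suc j < r)"
  obtain n where "(1/2::real) ^ n < r" using real_arch_pow_inv[of r "1/2"] assms by auto
  moreover have "(1/2::real) ^ Suc n \<le> (1/2) ^ n" by simp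
  ultimately have "\<exists>j. (1/2) ^ Suc j < r" by (intro exI[of _ n]) linarith
  then have "(1/2) ^ Suc j < r" unfolding j_def by (rule LeastI_ex)
  moreover have "r \<le> (1/2) ^ j"
  proof (cases j)
    case (Suc i)
    then show ?thesis using not_less_Least[of i "\<lambda>j. (1/2) ^ Suc j < r"] by (simp add: j_def not_less)
  qed (use assms in simp)
  ultimately show thesis by (rule that)
qed

text \<open>Translates a dyadic level into the logarithm of the modulus. As d \<le> 1/2 forces n
  \<ge> 1, n + 1 \<le> 2 n, and ln 2 \<ge> 1/2 supplies the other factor 2.\<close>

lemma dyadic_scale:
  fixes d :: real
  assumes d: "0 < d" "d \<le> 1 / 2"
  obtains n where "1 \<le> n" "d \<le> (1/2) ^ n" "(1/2) ^ n \<le> 2 * d" "real n + 1 \<le> 4 * ln (1 + 1 / d)"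
proof -
  obtain n where n: "(1/2) ^ Suc n < d" and dn: "d \<le> (1/2) ^ n"
    by (rule geometric_scale[of d]) (use d in auto)
  have n1: "1 \<le> n"
  proof (rule ccontr)
    assume "\<not> 1 \<le> n"
    then have "n = 0" by simp
    with n d show False by simp
  qed
  have "real n * (1 / 2) \<le> real n * ln 2"
    using ln2_ge_two_thirds by (intro mult_left_mono) auto
  also have "\<dots> = ln (2 ^ n)" by (simp add: ln_realpow)
  also have "\<dots> \<le> ln (1 + 1 / d)"
  proof (rule ln_mono)
    have "1 / (1/2) ^ n \<le> 1 / d" using dn d by (intro divide_left_mono) auto
    then show "2 ^ n \<le> 1 + 1 / d" by (simp add: power_divide)
  qed (use d in auto)
  finally have "real n + 1 \<le> 4 * ln (1 + 1 / d)" using n1 by linarith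
  with n n1 dn show thesis by (intro that[of n]) auto
qed

text \<open>Two points at distance about 2^(-n) are joined through their net points of level n; the
  remaining error is a telescoping sum over finer levels. All randomness sits in the assumption
  \<open>mesh\<close> on pairs in two consecutive nets.\<close>

lemma chaining_deterministic:
  fixes x :: "'p \<Rightarrow> real" and d :: "'p \<Rightarrow> 'p \<Rightarrow> real"
  assumes d_sym: "\<And>p q. p \<in> S \<Longrightarrow> q \<in> S \<Longrightarrow> d p q = d q p"
    and d_tri: "\<And>p q r. p \<in> S \<Longrightarrow> q \<in> S \<Longrightarrow> r \<in> S \<Longrightarrow> d p r \<le> d p q + d q r"
    and T: "\<And>n. T n \<subseteq> S"
    and net: "\<And>n p. p \<in> S \<Longrightarrow> \<pi> n p \<in> T n \<and> d p (\<pi> n p) \<le> (1/2) ^ n"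
    and lim: "\<And>p. p \<in> S \<Longrightarrow> (\<lambda>n. x (\<pi> n p)) \<longlonglongrightarrow> x p"
    and \<kappa>: "0 \<le> \<kappa>"
    and mesh: "\<And>n s t. s \<in> T n \<union> T (Suc n) \<Longrightarrow> t \<in> T n \<union> T (Suc n) \<Longrightarrow>
      \<bar>x s - x t\<bar> \<le> \<kappa> * sqrt (real n + 1) * d s t"
    and p: "p \<in> S" and q: "q \<in> S" and dpq: "0 < d p q" "d p q \<le> 1 / 2"
  shows "\<bar>x p - x q\<bar> \<le> 76 * \<kappa> * d p q * sqrt (ln (1 + 1 / d p q))"
proof -
  \<comment> \<open>A closed majorant of the tail sums of the links. Since sqrt (j + 2) \<le> (3/2)
    sqrt (j + 1), one step decreases \<open>b\<close> by at least (8 - 6) (1/2)^j sqrt (j + 1), the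
    size of a link.\<close>
  define b where "b j = 8 * (1/2) ^ j * sqrt (real j + 1)" for j :: nat
  have \<pi>S: "\<pi> n p \<in> S" if "p \<in> S" for n p using net[OF that] T by blast
  have b_step: "2 * (1/2) ^ j * sqrt (real j + 1) \<le> b j - b (Suc j)" for j
  proof -
    have "sqrt (real j + 2) \<le> sqrt ((9/4) * (real j + 1))"
      by (intro real_sqrt_le_mono) simp
    also have "\<dots> = sqrt ((3/2)\<^sup>2) * sqrt (real j + 1)"
      by (subst real_sqrt_mult[symmetric]) (simp add: power2_eq_square)
    finally have "sqrt (real j + 2) \<le> (3/2) * sqrt (real j + 1)" by simp
    then have "(1/2) ^ j * (4 * sqrt (real j + 2)) \<le> (1/2) ^ j * (6 * sqrt (real j + 1))"
      by (intro mult_left_mono) auto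
    moreover have "real (Suc j) + 1 = real j + 2" by simp
    then have "b (Suc j) = (1/2) ^ j * (4 * sqrt (real j + 2))"
      unfolding b_def by simp
    moreover have "b j = (1/2) ^ j * (6 * sqrt (real j + 1)) + 2 * (1/2) ^ j * sqrt (real j + 1)"
      by (simp add: b_def)
    ultimately show ?thesis by linarith
  qed
  have chain: "\<bar>x (\<pi> m p) - x (\<pi> n p)\<bar> \<le> \<kappa> * (b n - b m)" if "p \<in> S" "n \<le> m" for p n m
    using that(2)
  proof (induction m rule: dec_induct)
    case (step m)
    have "d (\<pi> (Suc m) p) (\<pi> m p) \<le> d (\<pi> (Suc m) p) p + d p (\<pi> m p)"
      using that \<pi>S by (intro d_tri) auto
    also have "\<dots> \<le> (1/2) ^ Suc m + (1/2) ^ m"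
      using net[OF that(1), of m] net[OF that(1), of "Suc m"] d_sym[OF that(1) \<pi>S[OF that(1), of "Suc m"]]
      by linarith
    also have "\<dots> \<le> 2 * (1/2) ^ m" by simp
    finally have d2: "d (\<pi> (Suc m) p) (\<pi> m p) \<le> 2 * (1/2) ^ m" .
    have "\<bar>x (\<pi> (Suc m) p) - x (\<pi> m p)\<bar> \<le> \<kappa> * sqrt (real m + 1) * d (\<pi> (Suc m) p) (\<pi> m p)"
      using net[OF that(1)] by (intro mesh) auto
    also have "\<dots> \<le> \<kappa> * sqrt (real m + 1) * (2 * (1/2) ^ m)"
      using \<kappa> d2 by (intro mult_left_mono) auto
    also have "\<dots> \<le> \<kappa> * (b m - b (Suc m))"
      using mult_left_mono[OF b_step[of m] \<kappa>] by (simp add: mult_ac)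
    finally show ?case using step.IH by (simp add: algebra_simps)
  qed simp
  have approx: "\<bar>x p - x (\<pi> n p)\<bar> \<le> \<kappa> * b n" if "p \<in> S" for p n
  proof (rule LIMSEQ_le_const2)
    show "(\<lambda>m. \<bar>x (\<pi> m p) - x (\<pi> n p)\<bar>) \<longlonglongrightarrow> \<bar>x p - x (\<pi> n p)\<bar>"
      by (intro tendsto_intros lim that)
    have "\<kappa> * (b n - b m) \<le> \<kappa> * b n" for m
      using \<kappa> by (intro mult_left_mono) (auto simp: b_def)
    then show "\<exists>N. \<forall>m\<ge>N. \<bar>x (\<pi> m p) - x (\<pi> n p)\<bar> \<le> \<kappa> * b n"
      using chain[OF that] by (meson order.trans)
  qed
  obtain n where n: "1 \<le> n" "d p q \<le> (1/2) ^ n" "(1/2) ^ n \<le> 2 * d p q"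
      "real n + 1 \<le> 4 * ln (1 + 1 / d p q)"
    using dyadic_scale[OF dpq] .
  let ?s = "(1/2) ^ n * sqrt (real n + 1)"
  have "d (\<pi> n p) (\<pi> n q) \<le> d (\<pi> n p) p + (d p q + d q (\<pi> n q))"
    using p q \<pi>S by (meson add_left_mono d_tri order.trans)
  also have "\<dots> \<le> 3 * (1/2) ^ n"
    using net[OF p, of n] net[OF q, of n] n(2) d_sym[OF p \<pi>S[OF p, of n]] by linarith
  finally have dn: "d (\<pi> n p) (\<pi> n q) \<le> 3 * (1/2) ^ n" .
  have "\<bar>x (\<pi> n p) - x (\<pi> n q)\<bar> \<le> \<kappa> * sqrt (real n + 1) * d (\<pi> n p) (\<pi> n q)"
    using net p q by (intro mesh) auto
  also have "\<dots> \<le> \<kappa> * sqrt (real n + 1) * (3 * (1/2) ^ n)"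
    using \<kappa> dn by (intro mult_left_mono) auto
  also have "\<dots> = 3 * (\<kappa> * ?s)" by simp
  finally have "\<bar>x (\<pi> n p) - x (\<pi> n q)\<bar> \<le> 3 * (\<kappa> * ?s)" .
  moreover have "\<kappa> * b n = 8 * (\<kappa> * ?s)"
    by (simp add: b_def)
  \<comment> \<open>8 for each of the two chains and 3 for the link between the net points.\<close>
  ultimately have "\<bar>x p - x q\<bar> \<le> 19 * (\<kappa> * ?s)"
    using approx[OF p, of n] approx[OF q, of n] by linarith
  then have "\<bar>x p - x q\<bar> \<le> 19 * \<kappa> * ?s"
    by simp
  \<comment> \<open>The two factors 2 from \<open>dyadic_scale\<close> turn 19 into 76.\<close>
  also have "\<dots> \<le> 19 * \<kappa> * ((2 * d p q) * (2 * sqrt (ln (1 + 1 / d p q))))"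
  proof (intro mult_left_mono mult_mono)
    have "sqrt (real n + 1) \<le> sqrt (4 * ln (1 + 1 / d p q))"
      using n(4) by (rule real_sqrt_le_mono)
    then show "sqrt (real n + 1) \<le> 2 * sqrt (ln (1 + 1 / d p q))"
      by (simp add: real_sqrt_mult)
  qed (use n \<kappa> dpq in auto)
  finally show ?thesis by (simp add: mult_ac)
qed

context gaussian_space begin

lemma sd_commute: "sd X p q = sd X q p"
  by (simp add: sd_def ip_def algebra_simps)

lemma sd_triangle:
  assumes "X p \<in> G" "X q \<in> G" "X r \<in> G"
  shows "sd X p r \<le> sd X p q + sd X q r"
  using L2_triangle[OF diff_mem[OF assms(1,2)] diff_mem[OF assms(2,3)]]
  by (simp add: sd_def)

text \<open>A union bound over all pairs in consecutive nets: net sizes grow geometrically, while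
  thresholds proportional to sqrt (n + 1) make the Gaussian tails decay geometrically. Only a
  positive probability is claimed for the good event, which suffices for a limit already known to be
  constant.\<close>

theorem chaining_bound:
  fixes X :: "'p \<Rightarrow> 'a \<Rightarrow> real"
  assumes X: "\<And>p. p \<in> S \<Longrightarrow> X p \<in> G"
    and T: "\<And>n. T n \<subseteq> S" "\<And>n. finite (T n)" "\<And>n. real (card (T n)) \<le> A * B ^ n"
    and AB: "1 \<le> A" "1 \<le> B"
    and net: "\<And>n p. p \<in> S \<Longrightarrow> \<pi> n p \<in> T n \<and> sd X p (\<pi> n p) \<le> (1/2) ^ n"
    and lim: "\<And>\<omega> p. \<omega> \<in> space M \<Longrightarrow> p \<in> S \<Longrightarrow> (\<lambda>n. X (\<pi> n p) \<omega>) \<longlonglongrightarrow> X p \<omega>"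
  shows "\<exists>C E. 0 < C \<and> E \<in> events \<and> 0 < prob E \<and>
    (\<forall>\<omega>\<in>E. \<forall>p\<in>S. \<forall>q\<in>S. 0 < sd X p q \<and> sd X p q \<le> 1 / 2 \<longrightarrow>
       \<bar>X p \<omega> - X q \<omega>\<bar> \<le> C * sd X p q * sqrt (ln (1 + 1 / sd X p q)))"
proof -
  \<comment> \<open>With \<kappa>^2 / 4 = ln (B^2 r) each tail is at most sqrt 2 (B^2 r)^(-n-1). The
    factor B^2 cancels the growth of the number of pairs, and r makes the first bound 8 A^2 / r =
    1/4, so that all bad events together have probability at most 1/2.\<close>
  define r where "r = 32 * A\<^sup>2"
  define \<kappa> where "\<kappa> = 2 * sqrt (ln (B\<^sup>2 * r))"
  let ?c = "1 / (B\<^sup>2 * r)"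
  have r: "32 \<le> r" using AB power_mono[of 1 A 2] by (simp add: r_def)
  have Br: "32 \<le> B\<^sup>2 * r"
    using r AB power_mono[of 1 B 2] mult_mono[of 1 "B\<^sup>2" 32 r] by simp
  have \<kappa>: "0 < \<kappa>" using Br by (simp add: \<kappa>_def)
  have \<kappa>2: "\<kappa>\<^sup>2 = 4 * ln (B\<^sup>2 * r)"
    using Br by (simp add: \<kappa>_def power_mult_distrib)
  define U where "U n = T n \<union> T (Suc n)" for n
  have U: "finite (U n)" "U n \<subseteq> S" for n using T by (auto simp: U_def)
  define bad where "bad n s t = {\<omega>\<in>space M. \<bar>X s \<omega> - X t \<omega>\<bar> > \<kappa> * sqrt (real n + 1) * sd X s t}" for n s t
  have XS: "X s \<in> G" if "s \<in> U n" for s n using that U X by blast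
  have bad_ev: "bad n s t \<in> events" if "s \<in> U n" "t \<in> U n" for n s t
    using XS[OF that(1)] XS[OF that(2)] unfolding bad_def by measurable
  have bad_prob: "prob (bad n s t) \<le> sqrt 2 * ?c ^ Suc n" if "s \<in> U n" "t \<in> U n" for n s t
  proof -
    have "prob (bad n s t) \<le> sqrt 2 * exp (- (\<kappa> * sqrt (real n + 1))\<^sup>2 / 4)"
      using tail_upper[OF diff_mem[OF XS[OF that(1)] XS[OF that(2)]], of "\<kappa> * sqrt (real n + 1)"] \<kappa>
      by (simp add: bad_def sd_def)
    also have "- (\<kappa> * sqrt (real n + 1))\<^sup>2 / 4 = real (Suc n) * (- ln (B\<^sup>2 * r))"
      by (simp add: power_mult_distrib \<kappa>2)
    also have "exp \<dots> = ?c ^ Suc n"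
      using Br by (subst exp_of_nat_mult) (simp add: exp_minus divide_inverse)
    finally show ?thesis .
  qed
  define Bad where "Bad n = (\<Union>z\<in>U n \<times> U n. bad n (fst z) (snd z))" for n
  have Bad_ev: "Bad n \<in> events" for n
    unfolding Bad_def using U bad_ev by (intro sets.finite_UN) auto
  have cardU: "real (card (U n)) \<le> 2 * A * B ^ Suc n" for n
  proof -
    have "real (card (U n)) \<le> real (card (T n)) + real (card (T (Suc n)))"
      unfolding U_def using card_Un_le[of "T n" "T (Suc n)"] by linarith
    also have "\<dots> \<le> A * B ^ n + A * B ^ Suc n"
      using T by (intro add_mono)
    also have "A * B ^ n \<le> A * B ^ Suc n"
      using AB by (intro mult_left_mono power_increasing) auto
    finally show ?thesis by simp
  qed
  have Bad_prob: "prob (Bad n) \<le> (1/2) * (1/2) ^ Suc n" for n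
  proof -
    have "prob (Bad n) \<le> (\<Sum>z\<in>U n \<times> U n. prob (bad n (fst z) (snd z)))"
      unfolding Bad_def using U bad_ev
      by (intro finite_measure_subadditive_finite) auto
    also have "\<dots> \<le> (\<Sum>z\<in>U n \<times> U n. sqrt 2 * ?c ^ Suc n)"
      using bad_prob by (intro sum_mono) auto
    also have "\<dots> = (real (card (U n)))\<^sup>2 * (sqrt 2 * ?c ^ Suc n)"
      by (simp add: card_cartesian_product power2_eq_square)
    also have "\<dots> \<le> (2 * A * B ^ Suc n)\<^sup>2 * (2 * ?c ^ Suc n)"
      using cardU Br sqrt2_less_2 by (intro mult_mono power_mono) auto
    also have "\<dots> = 8 * A\<^sup>2 * (1 / r) ^ Suc n"
    proof -
      have "(B ^ Suc n)\<^sup>2 * ?c ^ Suc n = (B\<^sup>2 * ?c) ^ Suc n"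
        by (simp only: power_mult_distrib power_mult[symmetric] mult.commute)
      also have "B\<^sup>2 * ?c = 1 / r" using AB by simp
      finally have "(B ^ Suc n)\<^sup>2 * ?c ^ Suc n = (1 / r) ^ Suc n" .
      moreover have "(2 * A * z)\<^sup>2 * (2 * w) = 8 * A\<^sup>2 * (z\<^sup>2 * w)" for z w :: real
        by (simp add: power_mult_distrib)
      ultimately show ?thesis by (simp only:)
    qed
    also have "\<dots> = 8 * A\<^sup>2 / r * (1 / r) ^ n" by simp
    also have "8 * A\<^sup>2 / r = 1 / 4" using AB by (simp add: r_def)
    also have "(1/4) * (1 / r) ^ n \<le> (1/4) * (1/2) ^ n"
      using r by (intro mult_left_mono power_mono) (auto simp: field_simps)
    finally show ?thesis by simp
  qed
  define E where "E = space M - (\<Union>n. Bad n)"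
  have E_ev: "E \<in> events" using Bad_ev by (simp add: E_def)
  have sums: "(\<lambda>n. (1/2) * (1/2) ^ Suc n :: real) sums (1/2 * 1)"
    by (intro sums_mult) (use power_half_series in simp)
  have summ: "summable (\<lambda>n. prob (Bad n))"
    by (rule summable_comparison_test'[OF sums_summable[OF sums], of 0]) (use Bad_prob in simp)
  have "prob (\<Union>n. Bad n) \<le> (\<Sum>n. prob (Bad n))"
    using Bad_ev summ by (intro finite_measure_subadditive_countably) auto
  also have "\<dots> \<le> (\<Sum>n. (1/2) * (1/2) ^ Suc n)"
    by (rule suminf_le[OF Bad_prob summ sums_summable[OF sums]])
  also have "\<dots> = 1/2 * 1"
    using sums by (rule sums_unique[symmetric])
  finally have "0 < prob E"
    unfolding E_def using Bad_ev by (subst prob_compl) auto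
  moreover have "\<bar>X p \<omega> - X q \<omega>\<bar> \<le> 76 * \<kappa> * sd X p q * sqrt (ln (1 + 1 / sd X p q))"
    if \<omega>: "\<omega> \<in> E" and p: "p \<in> S" and q: "q \<in> S" and s: "0 < sd X p q" "sd X p q \<le> 1 / 2" for \<omega> p q
  proof (rule chaining_deterministic[where d="sd X" and T=T and S=S and \<pi>=\<pi> and x="\<lambda>p. X p \<omega>"])
    show "(\<lambda>n. X (\<pi> n p) \<omega>) \<longlonglongrightarrow> X p \<omega>" if "p \<in> S" for p
      using \<omega> that by (intro lim) (auto simp: E_def)
    show "\<bar>X s \<omega> - X t \<omega>\<bar> \<le> \<kappa> * sqrt (real n + 1) * sd X s t"
      if "s \<in> T n \<union> T (Suc n)" "t \<in> T n \<union> T (Suc n)" for n s t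
      using \<omega> that by (auto simp: E_def Bad_def bad_def U_def not_less)
    show "sd X p r \<le> sd X p q + sd X q r" if "p \<in> S" "q \<in> S" "r \<in> S" for p q r
      using that X by (intro sd_triangle) auto
  qed (use net T p q s \<kappa> in \<open>auto simp: sd_commute\<close>)
  ultimately show ?thesis
    using \<kappa> E_ev by (intro exI[of _ "76 * \<kappa>"] exI[of _ E]) auto
qed

end

section \<open>Small balls for nearly orthogonal variables\<close>

context gaussian_space begin

text \<open>The induction carries a bound on the later variables because the Gram-Schmidt coefficients
  at the next step are controlled by it.\<close>

lemma near_orthogonal_innov:
  assumes D: "\<And>i. D i \<in> G"
    and V: "0 < V" "\<And>i. i < N \<Longrightarrow> ip (D i) (D i) = V"
    and \<rho>: "0 \<le> \<rho>" "\<And>i j. i < N \<Longrightarrow> j < N \<Longrightarrow> i \<noteq> j \<Longrightarrow> \<bar>ip (D i) (D j)\<bar> \<le> \<rho>" "8 * real N * \<rho> \<le> V"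
    and j: "j < N"
  shows "V / 2 \<le> ip (innov D j) (innov D j) \<and> (\<forall>i. j < i \<and> i < N \<longrightarrow> \<bar>ip (D i) (innov D j)\<bar> \<le> 2 * \<rho>)"
  using j
proof (induction j rule: less_induct)
  case (less j)
  let ?e = "innov D"
  note e_mem = innov_mem[of D, OF D]
  have coef_le: "\<bar>coef D m l\<bar> \<le> 4 * \<rho> / V" if "l < j" "l < m" "m < N" for m l
  proof -
    have v: "V / 2 \<le> ip (?e l) (?e l)" and c: "\<bar>ip (D m) (?e l)\<bar> \<le> 2 * \<rho>"
      using less.IH[of l] that less.prems by auto
    have "\<bar>coef D m l\<bar> = \<bar>ip (D m) (?e l)\<bar> / ip (?e l) (?e l)"
      using v V(1) by (simp add: coef_def[OF D] abs_divide)
    also have "\<dots> \<le> (2 * \<rho>) / (V / 2)"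
      using v c V(1) by (intro frac_le) auto
    finally show ?thesis by simp
  qed
  have sum_le: "\<bar>\<Sum>l<j. coef D m l * ip (?e l) (D i)\<bar> \<le> \<rho>"
    if "j \<le> m" "m < N" "j \<le> i" "i < N" for m i
  proof -
    have "\<bar>\<Sum>l<j. coef D m l * ip (?e l) (D i)\<bar> \<le> (\<Sum>l<j. \<bar>coef D m l\<bar> * \<bar>ip (?e l) (D i)\<bar>)"
      by (rule order.trans[OF sum_abs]) (simp add: abs_mult)
    also have "\<dots> \<le> (\<Sum>l<j. (4 * \<rho> / V) * (2 * \<rho>))"
    proof (intro sum_mono mult_mono)
      fix l assume "l \<in> {..<j}"
      then have l: "l < j" by simp
      show "\<bar>coef D m l\<bar> \<le> 4 * \<rho> / V" using coef_le[OF l] l that by simp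
      show "\<bar>ip (?e l) (D i)\<bar> \<le> 2 * \<rho>"
        using less.IH[of l] l that less.prems by (simp add: ip_commute)
    qed (use V(1) \<rho>(1) in auto)
    \<comment> \<open>The assumption 8 N \<rho> \<le> V makes the whole correction at most \<rho>,
      so the bound 2 \<rho> on later variables does not deteriorate with j.\<close>
    also have "\<dots> = (8 * real j * \<rho>) * \<rho> / V" by (simp add: power2_eq_square)
    also have "\<dots> \<le> V * \<rho> / V"
    proof (intro divide_right_mono mult_right_mono)
      have "8 * real j * \<rho> \<le> 8 * real N * \<rho>"
        using less.prems \<rho>(1) by (intro mult_right_mono) auto
      with \<rho>(3) show "8 * real j * \<rho> \<le> V" by linarith
    qed (use V(1) \<rho>(1) in auto)
    finally show ?thesis using V(1) by simp
  qed
  have off: "\<bar>ip (D i) (?e j)\<bar> \<le> 2 * \<rho>" if "j < i" "i < N" for i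
  proof -
    have "ip (?e j) (D i) = ip (D j) (D i) - (\<Sum>l<j. coef D j l * ip (?e l) (D i))"
      by (rule ip_innov_left[OF D D])
    then show ?thesis
      using \<rho>(2)[of j i] sum_le[of j i] that less.prems
      by (simp add: ip_commute)
  qed
  have "ip (?e j) (?e j) = ip (D j) (?e j)"
    using ip_X_innov[of D, OF D, of j j] by simp
  also have "\<dots> = ip (D j) (D j) - (\<Sum>l<j. coef D j l * ip (?e l) (D j))"
    using ip_innov_left[of D, OF D D[of j], of j] by (simp add: ip_commute)
  finally have "V - \<rho> \<le> ip (?e j) (?e j)"
    using sum_le[of j j] V(2)[OF less.prems] less.prems by linarith
  moreover have "8 * \<rho> \<le> V"
  proof -
    have "8 * 1 * \<rho> \<le> 8 * real N * \<rho>"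
      using less.prems \<rho>(1) by (intro mult_right_mono mult_left_mono) auto
    with \<rho>(3) show ?thesis by simp
  qed
  ultimately have "V / 2 \<le> ip (?e j) (?e j)" using \<rho>(1) by linarith
  with off show ?case by blast
qed

text \<open>Given the past, \<open>D m\<close> is its innovation shifted by a known amount. A
  nonnegative shift forces the innovation below the upper level, a negative one forces it above the
  lower level; only the sign of the shift matters, and one-sided tails of the innovation give a
  factor 1 - q at each step.\<close>

theorem small_ball_prob:
  assumes D: "\<And>i. D i \<in> G"
    and v: "0 < v" "\<And>i. i < N \<Longrightarrow> v \<le> ip (innov D i) (innov D i)"
    and x: "0 \<le> x"
  shows "prob {\<omega>\<in>space M. \<forall>i<N. \<bar>D i \<omega>\<bar> \<le> x * sqrt v} \<le> (1 - exp (- (x + 1)\<^sup>2 / 2) / sqrt (2 * pi)) ^ N"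
proof -
  define q where "q = exp (- (x + 1)\<^sup>2 / 2) / sqrt (2 * pi)"
  define b where "b = x * sqrt v"
  let ?e = "innov D"
  let ?f = "\<lambda>\<omega> k. ?e k \<omega>"
  have e_mem: "?e i \<in> G" for i by (rule innov_mem[of D, OF D])
  have [measurable]: "?e i \<in> borel_measurable M" for i using e_mem by simp
  have [measurable]: "D i \<in> borel_measurable M" for i using D by simp
  \<comment> \<open>The predictable shift, written as a function of innovation coordinates so that
    past events become sets in a product space.\<close>
  define L where "L i y = (\<Sum>k<i. coef D i k * y k)" for i and y :: "nat \<Rightarrow> real"
  have D_eq: "D i \<omega> = ?e i \<omega> + L i (?f \<omega>)" for i \<omega>
    using fun_cong[OF innov_eq[of D, OF D, of i], of \<omega>] by (simp add: L_def)
  have [measurable]: "(\<lambda>\<omega>. L i (?f \<omega>)) \<in> borel_measurable M" for i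
    unfolding L_def by measurable
  define small where "small m = {\<omega>\<in>space M. \<forall>i<m. \<bar>D i \<omega>\<bar> \<le> b}" for m
  have [measurable]: "small m \<in> events" for m unfolding small_def by measurable
  define past where "past Q m = {\<omega>\<in>small m. Q (L m (?f \<omega>))}" for Q m
  have past_ev[measurable]: "past Q m \<in> events" if [measurable]: "Measurable.pred borel Q" for Q m
  proof -
    have "past Q m = {\<omega>\<in>space M. \<omega> \<in> small m \<and> Q (L m (?f \<omega>))}"
      by (auto simp: past_def small_def)
    also have "\<dots> \<in> events" by measurable
    finally show ?thesis .
  qed
  have indep: "prob (past Q m \<inter> {\<omega>\<in>space M. ?e m \<omega> \<in> B}) = prob (past Q m) * prob {\<omega>\<in>space M. ?e m \<omega> \<in> B}"
    if Q[measurable]: "Measurable.pred borel Q" and B: "B \<in> sets borel" for Q B m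
  proof -
    let ?A = "PiM {..<m} (\<lambda>_. borel :: real measure)" and ?B = "PiM {m} (\<lambda>_. borel :: real measure)"
    let ?X = "\<lambda>\<omega>. restrict (\<lambda>i. ?e i \<omega>) {..<m}" and ?Y = "\<lambda>\<omega>. restrict (\<lambda>i. ?e i \<omega>) {m}"
    have ind: "indep_var ?A ?X ?B ?Y"
      using indep_innov[of D, OF D] by (rule indep_var_restrict) auto
    have comp: "(\<lambda>y. y k) \<in> borel_measurable ?A" if "k < m" for k
      using that by (intro measurable_component_singleton) auto
    have Lm[measurable]: "L i \<in> borel_measurable ?A" if "i \<le> m" for i
      unfolding L_def using that by (intro borel_measurable_sum borel_measurable_times comp) auto
    \<comment> \<open>The past event in terms of the first m innovations: y i + L i y is the value
      of \<open>D i\<close>.\<close>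
    define SA where "SA = {y\<in>space ?A. (\<forall>i\<in>{..<m}. \<bar>y i + L i y\<bar> \<le> b) \<and> Q (L m y)}"
    define SB where "SB = {y\<in>space ?B. y m \<in> B}"
    have meas: "(\<lambda>y. y i + L i y) \<in> borel_measurable ?A" if "i \<in> {..<m}" for i
      using that by (intro borel_measurable_add comp Lm) auto
    have SA: "SA \<in> sets ?A"
    proof -
      have "{y\<in>space ?A. \<bar>y i + L i y\<bar> \<le> b} \<in> sets ?A" if "i \<in> {..<m}" for i
        using meas[OF that] by measurable
      then have "{y\<in>space ?A. \<forall>i\<in>{..<m}. \<bar>y i + L i y\<bar> \<le> b} \<in> sets ?A"
        by (intro sets.sets_Collect_finite_All) auto
      moreover have "{y\<in>space ?A. Q (L m y)} \<in> sets ?A"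
        using measurable_compose[OF Lm[of m] Q] by (simp add: pred_def)
      moreover have "SA = {y\<in>space ?A. \<forall>i\<in>{..<m}. \<bar>y i + L i y\<bar> \<le> b} \<inter> {y\<in>space ?A. Q (L m y)}"
        by (auto simp: SA_def)
      ultimately show ?thesis by (simp only: sets.Int)
    qed
    have SB: "SB \<in> sets ?B"
      unfolding SB_def using B by measurable
    have sp: "?X \<omega> \<in> space ?A" "?Y \<omega> \<in> space ?B" for \<omega> by (auto simp: space_PiM)
    have Lr: "L i (?X \<omega>) = L i (?f \<omega>)" if "i \<le> m" for i \<omega>
      unfolding L_def using that by (intro sum.cong) auto
    have "?X -` SA \<inter> space M = past Q m"
      using sp by (auto simp: SA_def past_def small_def D_eq Lr)
    moreover have "?Y -` SB \<inter> space M = {\<omega>\<in>space M. ?e m \<omega> \<in> B}"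
      using sp by (auto simp: SB_def)
    moreover have "(\<lambda>\<omega>. (?X \<omega>, ?Y \<omega>)) -` (SA \<times> SB) \<inter> space M = (?X -` SA \<inter> space M) \<inter> (?Y -` SB \<inter> space M)"
      by auto
    ultimately show ?thesis
      using indep_varD[OF ind SA SB] by simp
  qed
  let ?p = "\<lambda>m. prob {\<omega>\<in>space M. ?e m \<omega> > b}" and ?n = "\<lambda>m. prob {\<omega>\<in>space M. - ?e m \<omega> > b}"
  have tail: "q \<le> ?p m" "q \<le> ?n m" if "m < N" for m
  proof -
    show "q \<le> ?p m"
      unfolding q_def b_def using v that by (intro tail_lower e_mem x) auto
    have "ip (\<lambda>\<omega>. - ?e m \<omega>) (\<lambda>\<omega>. - ?e m \<omega>) = ip (?e m) (?e m)" by (simp add: ip_def)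
    then show "q \<le> ?n m"
      unfolding q_def b_def using v that by (intro tail_lower uminus_mem e_mem x) auto
  qed
  \<comment> \<open>Multiplying the induction hypothesis by 1 - q needs q \<le> 1, which the tail
    bound provides as soon as there is an index below N.\<close>
  have q1: "q \<le> 1 \<or> N = 0" using order.trans[OF tail(1)[of 0] prob_le_1] by auto
  have "prob (small m) \<le> (1 - q) ^ m" if "m \<le> N" for m
    using that
  proof (induction m)
    case (Suc m)
    define P where "P = {\<omega>\<in>space M. ?e m \<omega> \<in> {..b}}"
    define P' where "P' = {\<omega>\<in>space M. ?e m \<omega> \<in> {-b..}}"
    let ?Q = "\<lambda>z::real. 0 \<le> z" and ?Q' = "\<lambda>z::real. z < 0"
    have [measurable]: "P \<in> events" "P' \<in> events" unfolding P_def P'_def by measurable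
    have P: "prob P \<le> 1 - q"
    proof -
      have "P = space M - {\<omega>\<in>space M. ?e m \<omega> > b}" by (auto simp: P_def)
      then show ?thesis using tail(1)[of m] Suc.prems by (simp add: prob_compl)
    qed
    have P': "prob P' \<le> 1 - q"
    proof -
      have "P' = space M - {\<omega>\<in>space M. - ?e m \<omega> > b}" by (auto simp: P'_def)
      then show ?thesis using tail(2)[of m] Suc.prems by (simp add: prob_compl)
    qed
    have "small (Suc m) \<subseteq> (past ?Q m \<inter> P) \<union> (past ?Q' m \<inter> P')"
    proof
      fix \<omega> assume "\<omega> \<in> small (Suc m)"
      then have "\<omega> \<in> space M" "\<omega> \<in> small m" "\<bar>?e m \<omega> + L m (?f \<omega>)\<bar> \<le> b"
        by (auto simp: small_def D_eq)
      then show "\<omega> \<in> (past ?Q m \<inter> P) \<union> (past ?Q' m \<inter> P')"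
        by (cases "0 \<le> L m (?f \<omega>)") (auto simp: past_def P_def P'_def)
    qed
    then have "prob (small (Suc m)) \<le> prob ((past ?Q m \<inter> P) \<union> (past ?Q' m \<inter> P'))"
      by (intro finite_measure_mono) auto
    also have "\<dots> \<le> prob (past ?Q m \<inter> P) + prob (past ?Q' m \<inter> P')"
      by (intro measure_Un_le) auto
    also have "\<dots> = prob (past ?Q m) * prob P + prob (past ?Q' m) * prob P'"
      unfolding P_def P'_def by (subst (1 2) indep) auto
    also have "\<dots> \<le> prob (past ?Q m) * (1 - q) + prob (past ?Q' m) * (1 - q)"
      using P P' by (intro add_mono mult_left_mono) auto
    also have "\<dots> = prob (past ?Q m \<union> past ?Q' m) * (1 - q)"
      by (subst finite_measure_Union) (auto simp: past_def distrib_right past_ev[unfolded past_def])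
    also have "past ?Q m \<union> past ?Q' m = small m"
      by (auto simp: past_def)
    also have "prob (small m) * (1 - q) \<le> (1 - q) ^ m * (1 - q)"
      using Suc q1 by (intro mult_right_mono) auto
    finally show ?case by (simp add: mult.commute)
  qed (simp add: small_def prob_space)
  from this[of N] show ?thesis by (simp add: small_def b_def q_def)
qed

end

section \<open>Integrals of powers of the norm\<close>

lemma integral_dominated:
  fixes f g :: "'a \<Rightarrow> real"
  assumes g: "integrable M g" and [measurable]: "f \<in> borel_measurable M" and b: "\<And>x. \<bar>f x\<bar> \<le> g x"
  shows "integrable M f" "\<bar>integral\<^sup>L M f\<bar> \<le> integral\<^sup>L M g"
proof -
  show int: "integrable M f"
    by (rule Bochner_Integration.integrable_bound[OF g]) (use b in \<open>auto intro!: AE_I2 order.trans[OF _ abs_ge_self]\<close>)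
  have "\<bar>integral\<^sup>L M f\<bar> \<le> (LINT x|M. \<bar>f x\<bar>)" by (rule integral_abs_bound)
  also have "\<dots> \<le> integral\<^sup>L M g" using int g b by (intro integral_mono) auto
  finally show "\<bar>integral\<^sup>L M f\<bar> \<le> integral\<^sup>L M g" .
qed

text \<open>Takes the place of polar coordinates: the function is dominated by a sum of constants on
  balls, whose volumes scale with the dimension. The origin lies in no dyadic shell and is discarded
  as a null set.\<close>

lemma nn_integral_dyadic_bound:
  fixes f :: "'a::euclidean_space \<Rightarrow> real"
  assumes [measurable]: "f \<in> borel_measurable borel"
    and a: "\<And>j::nat. 0 \<le> a j" and R: "\<And>j. 0 \<le> R j"
    and f: "\<And>\<xi>. \<xi> \<noteq> 0 \<Longrightarrow> 0 < f \<xi> \<Longrightarrow> \<exists>j. f \<xi> \<le> a j \<and> norm \<xi> \<le> R j"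
    and summ: "summable (\<lambda>j. a j * R j ^ DIM('a))"
  shows "(\<integral>\<^sup>+\<xi>. ennreal (f \<xi>) \<partial>lborel) < \<infinity>"
proof -
  let ?B = "\<lambda>j. cball (0::'a) (R j)"
  have "(\<integral>\<^sup>+\<xi>. ennreal (f \<xi>) \<partial>lborel) \<le> (\<integral>\<^sup>+\<xi>. (\<Sum>j. ennreal (a j) * indicator (?B j) \<xi>) \<partial>lborel)"
  proof (intro nn_integral_mono_AE)
    have "AE \<xi> in lborel. \<xi> \<noteq> (0::'a)" by (rule AE_lborel_singleton)
    then show "AE \<xi> in lborel. ennreal (f \<xi>) \<le> (\<Sum>j. ennreal (a j) * indicator (?B j) \<xi>)"
    proof eventually_elim
      case (elim \<xi>)
      show ?case
      proof (cases "0 < f \<xi>")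
        case True
        with f[OF elim] obtain j where j: "f \<xi> \<le> a j" "norm \<xi> \<le> R j" by blast
        have "ennreal (f \<xi>) \<le> ennreal (a j) * indicator (?B j) \<xi>"
          using j by (auto simp: indicator_def intro!: ennreal_leI)
        also have "\<dots> \<le> (\<Sum>i. ennreal (a i) * indicator (?B i) \<xi>)"
          using sum_le_suminf[of "\<lambda>i. ennreal (a i) * indicator (?B i) \<xi>" "{j}"]
          by (simp only: sum.insert finite.intros empty_iff sum.empty add_0_right not_False_eq_True) auto
        finally show ?thesis .
      qed (simp add: ennreal_neg not_less)
    qed
  qed
  also have "\<dots> = (\<Sum>j. ennreal (a j) * emeasure lborel (?B j))"
  proof -
    have "(\<integral>\<^sup>+\<xi>. (\<Sum>j. ennreal (a j) * indicator (?B j) \<xi>) \<partial>lborel)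
        = (\<Sum>j. \<integral>\<^sup>+\<xi>. ennreal (a j) * indicator (?B j) \<xi> \<partial>lborel)"
    proof (rule nn_integral_suminf)
      show "(\<lambda>\<xi>. ennreal (a j) * indicator (?B j) \<xi>) \<in> borel_measurable lborel" for j
        by (intro borel_measurable_times_ennreal borel_measurable_indicator) auto
    qed
    also have "\<dots> = (\<Sum>j. ennreal (a j) * emeasure lborel (?B j))"
      by (intro suminf_cong nn_integral_cmult_indicator) auto
    finally show ?thesis .
  qed
  also have "\<dots> = (\<Sum>j. ennreal (unit_ball_vol (real DIM('a)) * (a j * R j ^ DIM('a))))"
    using a R by (intro suminf_cong) (simp add: emeasure_cball ennreal_mult[symmetric] mult_ac)
  also have "\<dots> < \<infinity>"
    using summ a R by (subst suminf_ennreal2) (auto intro!: summable_mult)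
  finally show ?thesis .
qed

text \<open>The radial majorant for all spectral integrals; a and c are the margins of integrability
  at the origin and at infinity.\<close>

definition two_power :: "real \<Rightarrow> real \<Rightarrow> 'a::euclidean_space \<Rightarrow> real" where
  "two_power a c \<xi> = (if norm \<xi> < 1 then norm \<xi> powr (a - real DIM('a)) else norm \<xi> powr (- c - real DIM('a)))"

lemma two_power_nonneg: "0 \<le> two_power a c \<xi>"
  by (simp add: two_power_def)

lemma two_power_measurable [measurable]: "two_power a c \<in> borel_measurable borel"
  unfolding two_power_def by measurable

lemma integrable_two_power:
  assumes ac: "0 < a" "0 < c"
  shows "integrable lborel (two_power a c :: 'a::euclidean_space \<Rightarrow> real)"
proof (rule integrableI_nonneg)
  let ?d = "DIM('a)"
  have geo: "summable (\<lambda>j. K * (2 powr (- e)) ^ j)" if "0 < e" for K e :: real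
    using that by (intro summable_mult summable_geometric) (simp add: powr_minus field_simps)
  define f where "f \<xi> = (if norm \<xi> < 1 then norm \<xi> powr (a - real ?d) else 0)" for \<xi> :: 'a
  define g where "g \<xi> = (if norm \<xi> < 1 then 0 else norm \<xi> powr (- c - real ?d))" for \<xi> :: 'a
  have [measurable]: "f \<in> borel_measurable borel" "g \<in> borel_measurable borel"
    unfolding f_def g_def by measurable
  have half: "(1/2::real) ^ j = 2 powr (- real j)" for j
    by (simp add: powr_minus_divide powr_realpow power_one_over)
  let ?x = "\<lambda>j. - real j * a + (real j + 1) * real ?d"
  have fin_f: "(\<integral>\<^sup>+\<xi>. ennreal (f \<xi>) \<partial>lborel) < \<infinity>"
  proof (rule nn_integral_dyadic_bound)
    fix \<xi> :: 'a assume \<xi>: "\<xi> \<noteq> 0" "0 < f \<xi>"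
    then have r: "0 < norm \<xi>" "norm \<xi> < 1" by (auto simp: f_def split: if_splits)
    obtain j where j: "(1/2) ^ Suc j < norm \<xi>" "norm \<xi> \<le> (1/2) ^ j"
      by (rule geometric_scale[of "norm \<xi>"]) (use r in auto)
    have "f \<xi> = norm \<xi> powr a * norm \<xi> powr (- real ?d)"
      using r by (simp add: f_def powr_add[symmetric])
    \<comment> \<open>The sign of a minus the dimension is not fixed, so the increasing factor is
      bounded at the outer radius of the shell and the decreasing one at the inner radius.\<close>
    also have "\<dots> \<le> ((1/2) ^ j) powr a * ((1/2) ^ Suc j) powr (- real ?d)"
      using j r ac by (intro mult_mono powr_mono2 powr_mono2') auto
    also have "\<dots> = 2 powr (?x j)"
      by (simp only: half powr_powr powr_add[symmetric]) (simp add: algebra_simps)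
    finally show "\<exists>j. f \<xi> \<le> 2 powr (?x j) \<and> norm \<xi> \<le> 2 powr (- real j)"
      using j unfolding half by (intro exI[of _ j]) auto
  next
    have "2 powr (?x j) * (2 powr (- real j)) ^ ?d
        = 2 powr real ?d * (2 powr (- a)) ^ j" for j
      by (simp add: powr_realpow[symmetric] powr_powr powr_add[symmetric] algebra_simps)
    then show "summable (\<lambda>j. 2 powr (?x j) * (2 powr (- real j)) ^ ?d)"
      by (simp only: geo[OF ac(1)])
  qed auto
  have fin_g: "(\<integral>\<^sup>+\<xi>. ennreal (g \<xi>) \<partial>lborel) < \<infinity>"
  proof (rule nn_integral_dyadic_bound)
    fix \<xi> :: 'a assume \<xi>: "\<xi> \<noteq> 0" "0 < g \<xi>"
    then have r: "1 \<le> norm \<xi>" by (auto simp: g_def split: if_splits)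
    define j where "j = nat \<lfloor>log 2 (norm \<xi>)\<rfloor>"
    have l: "0 \<le> log 2 (norm \<xi>)" using r by (subst zero_le_log_cancel_iff) auto
    have j: "real j \<le> log 2 (norm \<xi>)" "log 2 (norm \<xi>) \<le> real j + 1"
      using l by (auto simp: j_def of_nat_nat)
    have n: "2 powr log 2 (norm \<xi>) = norm \<xi>" using r by (subst powr_log_cancel) auto
    have j1: "2 powr real j \<le> norm \<xi>" "norm \<xi> \<le> 2 powr (real j + 1)"
      using powr_mono[OF j(1), of 2] powr_mono[OF j(2), of 2] n by auto
    have "g \<xi> = norm \<xi> powr (- c - real ?d)" using r by (simp add: g_def)
    also have "\<dots> \<le> (2 powr real j) powr (- c - real ?d)"
      using j1 r ac by (intro powr_mono2') auto
    finally show "\<exists>j. g \<xi> \<le> 2 powr (real j * (- c - real ?d)) \<and> norm \<xi> \<le> 2 powr (real j + 1)"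
      using j1 by (intro exI[of _ j]) (auto simp: powr_powr)
  next
    have "2 powr (real j * (- c - real ?d)) * (2 powr (real j + 1)) ^ ?d
        = 2 powr real ?d * (2 powr (- c)) ^ j" for j
      by (simp add: powr_realpow[symmetric] powr_powr powr_add[symmetric] algebra_simps)
    then show "summable (\<lambda>j. 2 powr (real j * (- c - real ?d)) * (2 powr (real j + 1)) ^ ?d)"
      by (simp only: geo[OF ac(2)])
  qed auto
  have "(\<integral>\<^sup>+\<xi>. ennreal (two_power a c (\<xi>::'a)) \<partial>lborel) = (\<integral>\<^sup>+\<xi>. ennreal (f \<xi>) + ennreal (g \<xi>) \<partial>lborel)"
    by (intro nn_integral_cong) (auto simp: two_power_def f_def g_def)
  also have "\<dots> = (\<integral>\<^sup>+\<xi>. ennreal (f \<xi>) \<partial>lborel) + (\<integral>\<^sup>+\<xi>. ennreal (g \<xi>) \<partial>lborel)"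
    by (intro nn_integral_add) auto
  also have "\<dots> < \<infinity>" using fin_f fin_g by simp
  finally show "(\<integral>\<^sup>+\<xi>. ennreal (two_power a c (\<xi>::'a)) \<partial>lborel) < \<infinity>" .
qed (auto simp: two_power_nonneg)

text \<open>Interpolates between the quadratic bound for small y and the trivial bound 2.\<close>

lemma one_minus_cos_le: "1 - cos y \<le> 2 * \<bar>y\<bar> powr \<kappa>" if "0 \<le> \<kappa>" "\<kappa> \<le> 2" for y \<kappa> :: real
proof (cases "\<bar>y\<bar> \<le> 1")
  case True
  have "(sin (y / 2))\<^sup>2 \<le> (y / 2)\<^sup>2"
    using abs_sin_x_le_abs_x[of "y / 2"] by (subst abs_le_square_iff[symmetric]) auto
  then have "1 - cos y \<le> y\<^sup>2 / 2"
    using cos_double_sin[of "y / 2"] by (simp add: power_divide)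
  show ?thesis
  proof (cases "y = 0")
    case False
    have "y\<^sup>2 = \<bar>y\<bar> powr 2" using False by (simp add: powr_numeral)
    also have "\<dots> \<le> \<bar>y\<bar> powr \<kappa>" using True False that by (intro powr_mono') auto
    finally show ?thesis using \<open>1 - cos y \<le> y\<^sup>2 / 2\<close> zero_le_power2[of y] by linarith
  qed simp
next
  case False
  then have "1 \<le> \<bar>y\<bar> powr \<kappa>" using that by (simp add: ge_one_powr_ge_zero)
  then show ?thesis using cos_ge_minus_one[of y] by linarith
qed

section \<open>Spectral form of the covariance\<close>

text \<open>The spectral density of the noise combined with the denominator of the two wave kernels.
  Its value at the origin is 0.\<close>

definition mu :: "real \<Rightarrow> 'a::euclidean_space \<Rightarrow> real" where
  "mu \<beta> \<xi> = norm \<xi> powr (\<beta> - real DIM('a)) / (norm \<xi>)\<^sup>2"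

lemma mu_measurable [measurable]: "mu \<beta> \<in> borel_measurable borel"
  unfolding mu_def by measurable

lemma mu_nonneg: "0 \<le> mu \<beta> \<xi>"
  by (simp add: mu_def)

text \<open>Near the origin a quadratic factor cancels the denominator in \<open>mu\<close>; at
  infinity growth of order \<theta> leaves the margin 2 - \<beta> - \<theta>.\<close>

lemma mu_bound:
  fixes \<xi> :: "'a::euclidean_space"
  assumes small: "norm \<xi> < 1 \<Longrightarrow> \<bar>w\<bar> \<le> C * (norm \<xi>)\<^sup>2"
    and large: "1 \<le> norm \<xi> \<Longrightarrow> \<bar>w\<bar> \<le> C * norm \<xi> powr \<theta>"
  shows "mu \<beta> \<xi> * \<bar>w\<bar> \<le> C * two_power \<beta> (2 - \<beta> - \<theta>) \<xi>"
proof (cases "norm \<xi> < 1")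
  case True
  have "mu \<beta> \<xi> * \<bar>w\<bar> \<le> mu \<beta> \<xi> * (C * (norm \<xi>)\<^sup>2)"
    by (intro mult_left_mono small True mu_nonneg)
  also have "\<dots> = C * two_power \<beta> (2 - \<beta> - \<theta>) \<xi>"
    using True by (simp add: mu_def two_power_def)
  finally show ?thesis .
next
  case False
  then have r: "1 \<le> norm \<xi>" by simp
  have "mu \<beta> \<xi> * \<bar>w\<bar> \<le> mu \<beta> \<xi> * (C * norm \<xi> powr \<theta>)"
    by (intro mult_left_mono large r mu_nonneg)
  also have "\<dots> = C * norm \<xi> powr (\<beta> - real DIM('a) - 2 + \<theta>)"
  proof -
    have "mu \<beta> \<xi> = norm \<xi> powr (\<beta> - real DIM('a) - 2)"
      using r by (simp add: mu_def powr_diff powr_numeral)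
    then show ?thesis by (simp add: powr_add)
  qed
  also have "\<dots> = C * two_power \<beta> (2 - \<beta> - \<theta>) \<xi>"
    using r by (simp add: two_power_def algebra_simps)
  finally show ?thesis .
qed

lemma integrable_mu_bounded:
  fixes w :: "'a::euclidean_space \<Rightarrow> real"
  assumes [measurable]: "w \<in> borel_measurable borel" and \<beta>: "0 < \<beta>" "\<theta> < 2 - \<beta>"
    and small: "\<And>\<xi>. norm \<xi> < 1 \<Longrightarrow> \<bar>w \<xi>\<bar> \<le> C * (norm \<xi>)\<^sup>2"
    and large: "\<And>\<xi>. 1 \<le> norm \<xi> \<Longrightarrow> \<bar>w \<xi>\<bar> \<le> C * norm \<xi> powr \<theta>"
  shows "integrable lborel (\<lambda>\<xi>. mu \<beta> \<xi> * w \<xi>)"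
    and "\<bar>LINT \<xi>|lborel. mu \<beta> \<xi> * w \<xi>\<bar> \<le> C * (LINT \<xi>|lborel. two_power \<beta> (2 - \<beta> - \<theta>) (\<xi>::'a))"
proof -
  let ?g = "\<lambda>\<xi>::'a. C * two_power \<beta> (2 - \<beta> - \<theta>) \<xi>"
  have b: "\<bar>mu \<beta> \<xi> * w \<xi>\<bar> \<le> ?g \<xi>" for \<xi> :: 'a
    using mu_bound[OF small large, of \<xi>] by (simp add: abs_mult mu_nonneg)
  have g: "integrable lborel ?g"
    using \<beta> by (intro integrable_mult_right integrable_two_power) auto
  show "integrable lborel (\<lambda>\<xi>. mu \<beta> \<xi> * w \<xi>)"
    and "\<bar>LINT \<xi>|lborel. mu \<beta> \<xi> * w \<xi>\<bar> \<le> C * (LINT \<xi>|lborel. two_power \<beta> (2 - \<beta> - \<theta>) (\<xi>::'a))"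
    using integral_dominated[OF g _ b] by simp_all
qed

text \<open>The time integral of the two wave kernels at a frequency of norm \<rho>, isolated by
  interchanging the order of integration.\<close>

definition Phi :: "real \<Rightarrow> real \<Rightarrow> real \<Rightarrow> real" where
  "Phi t s \<rho> = (LINT r|lborel. indicator {0..min t s} r * (sin ((t - r) * \<rho>) * sin ((s - r) * \<rho>)))"

lemma abs_sin_le_linear:
  fixes \<rho> :: real
  assumes "0 \<le> \<rho>" "r \<in> {0..T}" "u \<le> T"
  shows "\<bar>sin (max 0 (u - r) * \<rho>)\<bar> \<le> T * \<rho>"
proof -
  have "\<bar>sin (max 0 (u - r) * \<rho>)\<bar> \<le> max 0 (u - r) * \<rho>"
    using abs_sin_x_le_abs_x[of "max 0 (u - r) * \<rho>"] assms(1) by (simp add: abs_mult)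
  also have "\<dots> \<le> T * \<rho>" using assms by (intro mult_right_mono) auto
  finally show ?thesis .
qed

text \<open>Fubini, justified by a majorant with \<theta> = 0. Taking the real part turns the
  exponential into a cosine and loses nothing for the solution, whose covariance is the real number
  represented by \<open>wave_cov\<close>.\<close>

lemma wave_cov_spectral:
  fixes x y :: "real ^ 'n"
  assumes \<beta>: "0 < \<beta>" "\<beta> < 2" and t: "0 \<le> t" and s: "0 \<le> s"
  shows "integrable lborel (\<lambda>\<xi>. mu \<beta> \<xi> * (cos ((x - y) \<bullet> \<xi>) * Phi t s (norm \<xi>)))"
    and "Re (wave_cov \<beta> t x s y) = wave_const CARD('n) \<beta> *
       (LINT \<xi>|lborel. mu \<beta> \<xi> * (cos ((x - y) \<bullet> \<xi>) * Phi t s (norm \<xi>)))"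
proof -
  define w where "w r \<xi> = sin ((t - r) * norm \<xi>) * sin ((s - r) * norm \<xi>)" for r and \<xi> :: "real ^ 'n"
  define H where "H r \<xi> = indicator {0..min t s} r *\<^sub>R (complex_of_real (norm \<xi> powr (\<beta> - real CARD('n)))
           * exp (- \<i> * complex_of_real ((x - y) \<bullet> \<xi>)) * complex_of_real (w r \<xi> / (norm \<xi>)\<^sup>2))" for r \<xi>
  \<comment> \<open>t s comes from the linear bound of both sines at low frequency, 1 from
    boundedness at high frequency.\<close>
  define C where "C = max 1 (t * s)"
  let ?g = "\<lambda>r (\<xi> :: real ^ 'n). indicator {0..min t s} r * (C * two_power \<beta> (2 - \<beta> - 0) \<xi>)"
    and ?E = "\<lambda>\<xi>. exp (- \<i> * complex_of_real ((x - y) \<bullet> \<xi>))"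
    and ?W = "\<lambda>\<xi>. mu \<beta> \<xi> * (cos ((x - y) \<bullet> \<xi>) * Phi t s (norm \<xi>))"
    and ?I = "LINT \<xi>|lborel. LINT r|lborel. H r \<xi>"
  have w_small: "\<bar>w r \<xi>\<bar> \<le> C * (norm \<xi>)\<^sup>2" if "r \<in> {0..min t s}" for r \<xi>
  proof -
    have a: "\<bar>sin ((u - r) * norm \<xi>)\<bar> \<le> u * norm \<xi>" if "r \<le> u" "0 \<le> r" for u
      using abs_sin_le_linear[of "norm \<xi>" r u u] that by simp
    have "\<bar>w r \<xi>\<bar> \<le> (t * norm \<xi>) * (s * norm \<xi>)"
      unfolding w_def abs_mult using that t s by (intro mult_mono a) auto
    also have "\<dots> = (t * s) * (norm \<xi>)\<^sup>2" by (simp add: power2_eq_square)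
    also have "\<dots> \<le> C * (norm \<xi>)\<^sup>2" by (intro mult_right_mono) (auto simp: C_def)
    finally show ?thesis .
  qed
  have w_large: "\<bar>w r \<xi>\<bar> \<le> C * norm \<xi> powr 0" if "1 \<le> norm \<xi>" for r \<xi>
  proof -
    have "\<bar>w r \<xi>\<bar> \<le> 1 * 1"
      unfolding w_def abs_mult by (intro mult_mono) auto
    then show ?thesis using that by (auto simp: C_def)
  qed
  have [measurable]: "case_prod H \<in> borel_measurable (lborel \<Otimes>\<^sub>M lborel)"
    unfolding H_def w_def by measurable
  have H_norm: "norm (H r \<xi>) \<le> ?g r \<xi>" for r \<xi>
  proof (cases "r \<in> {0..min t s}")
    case True
    have "norm (H r \<xi>) = mu \<beta> \<xi> * \<bar>w r \<xi>\<bar>"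
      using True by (simp add: H_def norm_mult norm_divide norm_power mu_def)
    also have "\<dots> \<le> C * two_power \<beta> (2 - \<beta> - 0) \<xi>"
      using True by (intro mu_bound w_small w_large) auto
    finally show ?thesis using True by simp
  qed (simp add: H_def)
  have int_dom: "integrable (lborel \<Otimes>\<^sub>M lborel)
      (\<lambda>(r, \<xi>). ?g r \<xi>)"
  proof (rule lborel_pair.Fubini_integrable)
    have tp: "integrable lborel (\<lambda>\<xi>::real^'n. C * two_power \<beta> (2 - \<beta> - 0) \<xi>)"
      using \<beta> by (intro integrable_mult_right integrable_two_power) auto
    then show "AE r in lborel. integrable lborel
        (\<lambda>\<xi>. case (r, \<xi>) of (r, \<xi>) \<Rightarrow> ?g r \<xi>)"
      by auto
    have eq: "(\<lambda>r. LINT \<xi>|lborel. norm (case (r, \<xi>) of (r, \<xi>) \<Rightarrow>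
          ?g r \<xi>))
        = (\<lambda>r. indicator {0..min t s} r * (LINT \<xi>|lborel. \<bar>C * two_power \<beta> (2 - \<beta> - 0) (\<xi> :: real ^ 'n)\<bar>))"
      by (auto simp: abs_mult fun_eq_iff)
    show "integrable lborel (\<lambda>r. LINT \<xi>|lborel. norm (case (r, \<xi>) of (r, \<xi>) \<Rightarrow>
          ?g r \<xi>))"
      by (subst eq) (intro integrable_mult_left integrable_real_indicator; auto simp: emeasure_lborel_Icc_eq)
  qed measurable
  have int: "integrable (lborel \<Otimes>\<^sub>M lborel) (case_prod H)"
    by (rule Bochner_Integration.integrable_bound[OF int_dom])
      (use H_norm in \<open>auto intro!: AE_I2 order.trans[OF _ abs_ge_self]\<close>)
  have inner: "(LINT r|lborel. H r \<xi>)
      = complex_of_real (mu \<beta> \<xi>) * ?E \<xi> * complex_of_real (Phi t s (norm \<xi>))" for \<xi>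
  proof -
    have "H r \<xi> = (complex_of_real (mu \<beta> \<xi>) * ?E \<xi>)
        * complex_of_real (indicator {0..min t s} r * (sin ((t - r) * norm \<xi>) * sin ((s - r) * norm \<xi>)))" for r
      by (simp add: H_def w_def mu_def scaleR_conv_of_real)
    then show ?thesis
      by (simp only: integral_mult_right_zero integral_complex_of_real Phi_def)
  qed
  have int2: "integrable lborel (\<lambda>\<xi>. LINT r|lborel. H r \<xi>)"
    by (rule lborel_pair.integrable_snd[OF int])
  have Re_inner: "Re (LINT r|lborel. H r \<xi>) = ?W \<xi>" for \<xi>
    by (simp add: inner Re_exp)
  show "integrable lborel (\<lambda>\<xi>. ?W \<xi>)"
    using integrable_Re[OF int2] by (simp only: Re_inner)
  have "wave_cov \<beta> t x s y = complex_of_real (wave_const CARD('n) \<beta>) * (LINT r|lborel. LINT \<xi>|lborel. H r \<xi>)"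
    unfolding wave_cov_def set_lebesgue_integral_def H_def w_def
    by (simp only: integral_scaleR_right)
  also have "(LINT r|lborel. LINT \<xi>|lborel. H r \<xi>) = (?I)"
    by (rule lborel_pair.Fubini_integral[OF int, symmetric])
  finally have "Re (wave_cov \<beta> t x s y) = wave_const CARD('n) \<beta> * Re (?I)"
    by simp
  also have "Re (?I) = (LINT \<xi>|lborel. Re (LINT r|lborel. H r \<xi>))"
    by (rule integral_Re[OF int2, symmetric])
  finally show "Re (wave_cov \<beta> t x s y) = wave_const CARD('n) \<beta> *
       (LINT \<xi>|lborel. ?W \<xi>)"
    by (simp only: Re_inner)
qed

section \<open>Regularity of the covariance\<close>

lemma abs_sin_diff_le:
  fixes a b :: real
  shows "\<bar>sin a - sin b\<bar> \<le> \<bar>a - b\<bar>"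
proof -
  have "\<bar>sin a - sin b\<bar> = 2 * (\<bar>sin ((a - b) / 2)\<bar> * \<bar>cos ((a + b) / 2)\<bar>)"
    by (simp add: sin_diff_sin abs_mult)
  also have "\<dots> \<le> 2 * (\<bar>(a - b) / 2\<bar> * 1)"
    by (intro mult_left_mono mult_mono abs_sin_x_le_abs_x) auto
  finally show ?thesis by simp
qed

lemma sin_diff_le_powr:
  fixes a b \<theta> :: real
  assumes "0 < \<theta>" "\<theta> \<le> 1"
  shows "\<bar>sin a - sin b\<bar> \<le> 2 * \<bar>a - b\<bar> powr \<theta>"
proof (cases "\<bar>a - b\<bar> \<le> 1")
  case True
  have "\<bar>sin a - sin b\<bar> \<le> \<bar>a - b\<bar>" by (rule abs_sin_diff_le)
  also have "\<dots> \<le> 2 * \<bar>a - b\<bar> powr \<theta>"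
  proof (cases "a = b")
    case False
    have "\<bar>a - b\<bar> powr 1 \<le> \<bar>a - b\<bar> powr \<theta>"
      using True False assms by (intro powr_mono') auto
    then show ?thesis using False by simp
  qed simp
  finally show ?thesis .
next
  case False
  then have "1 \<le> \<bar>a - b\<bar> powr \<theta>" using assms by (simp add: ge_one_powr_ge_zero)
  moreover have "\<bar>sin a - sin b\<bar> \<le> 2"
    using abs_sin_le_one[of a] abs_sin_le_one[of b] by linarith
  ultimately show ?thesis by linarith
qed

lemma Phi_measurable [measurable]: "Phi t s \<in> borel_measurable borel"
  unfolding Phi_def by measurable

lemma Phi_commute: "Phi t s \<rho> = Phi s t \<rho>"
  by (simp add: Phi_def min.commute mult.commute[of "sin ((t - _) * _)"])

lemma integral_Icc_bound:
  fixes f :: "real \<Rightarrow> real"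
  assumes [measurable]: "f \<in> borel_measurable borel" and T: "0 \<le> T"
    and f: "\<And>r. r \<in> {0..T} \<Longrightarrow> \<bar>f r\<bar> \<le> B"
  shows "integrable lborel (\<lambda>r. indicator {0..T} r * f r)"
    and "\<bar>LINT r|lborel. indicator {0..T} r * f r\<bar> \<le> T * B"
proof -
  have g: "integrable lborel (\<lambda>r. indicator {0..T} r * B)"
    by (intro integrable_mult_left integrable_real_indicator) (auto simp: emeasure_lborel_Icc_eq)
  have b: "\<bar>indicator {0..T} r * f r\<bar> \<le> indicator {0..T} r * B" for r
    using f[of r] by (auto simp: indicator_def)
  show "integrable lborel (\<lambda>r. indicator {0..T} r * f r)"
    and "\<bar>LINT r|lborel. indicator {0..T} r * f r\<bar> \<le> T * B"
    using integral_dominated[OF g _ b] T by simp_all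
qed

text \<open>Cutting the arguments off at 0 makes a sine vanish beyond its own time, so that all
  pairs of times share the domain {0..T} and can be subtracted under one integral.\<close>

lemma Phi_eq:
  assumes "t \<le> T" "s \<le> T"
  shows "Phi t s \<rho> = (LINT r|lborel. indicator {0..T} r * (sin (max 0 (t - r) * \<rho>) * sin (max 0 (s - r) * \<rho>)))"
  unfolding Phi_def using assms
  by (intro Bochner_Integration.integral_cong) (auto simp: indicator_def max_def min_def)

lemma Phi_bound:
  assumes t: "0 \<le> t" "t \<le> T" and s: "0 \<le> s" "s \<le> T" and \<rho>: "0 \<le> \<rho>"
  shows "\<bar>Phi t s \<rho>\<bar> \<le> T" "\<bar>Phi t s \<rho>\<bar> \<le> T ^ 3 * \<rho>\<^sup>2"
proof -
  note a = abs_sin_le_linear[OF \<rho>]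
  have "\<bar>Phi t s \<rho>\<bar> \<le> T * (1 * 1)"
    unfolding Phi_eq[OF t(2) s(2)] using t
    by (intro integral_Icc_bound) (auto simp: abs_mult intro!: mult_le_one)
  then show "\<bar>Phi t s \<rho>\<bar> \<le> T" by simp
  have "\<bar>Phi t s \<rho>\<bar> \<le> T * ((T * \<rho>) * (T * \<rho>))"
    unfolding Phi_eq[OF t(2) s(2)] using t s \<rho>
    by (intro integral_Icc_bound) (auto simp: abs_mult intro!: mult_mono a)
  then show "\<bar>Phi t s \<rho>\<bar> \<le> T ^ 3 * \<rho>\<^sup>2"
    by (simp add: power2_eq_square power3_eq_cube mult_ac)
qed

text \<open>The difference contains one plain sine and one difference of sines. At low frequency
  both are bounded linearly in \<rho>, which gives the quadratic factor; at high frequency the first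
  is bounded by 1 and the second is Hoelder of order \<theta>.\<close>

lemma Phi_diff_bound:
  assumes t: "0 \<le> t" "t \<le> T" and s: "0 \<le> s" "s \<le> T" and \<rho>: "0 \<le> \<rho>" and T: "1 \<le> T"
    and \<theta>: "0 < \<theta>" "\<theta> \<le> 1"
  shows "\<rho> < 1 \<Longrightarrow> \<bar>Phi t t \<rho> - Phi t s \<rho>\<bar> \<le> 2 * T ^ 3 * \<bar>t - s\<bar> powr \<theta> * \<rho>\<^sup>2"
    and "1 \<le> \<rho> \<Longrightarrow> \<bar>Phi t t \<rho> - Phi t s \<rho>\<bar> \<le> 2 * T ^ 3 * \<bar>t - s\<bar> powr \<theta> * \<rho> powr \<theta>"
proof -
  let ?g = "\<lambda>u r. sin (max 0 (u - r) * \<rho>)"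
  let ?D = "\<bar>t - s\<bar> powr \<theta> * \<rho> powr \<theta>"
  have m: "(\<lambda>r. ?g t r * (?g t r - ?g s r)) \<in> borel_measurable borel" by measurable
  have i: "integrable lborel (\<lambda>r. indicator {0..T} r * (?g u r * ?g v r))" for u v
    by (rule integral_Icc_bound(1)[where B="1 * 1"]) (use T in \<open>auto simp: abs_mult intro!: mult_le_one\<close>)
  have diff: "Phi t t \<rho> - Phi t s \<rho> = (LINT r|lborel. indicator {0..T} r * (?g t r * (?g t r - ?g s r)))"
    unfolding Phi_eq[OF t(2) t(2)] Phi_eq[OF t(2) s(2)]
    by (subst Bochner_Integration.integral_diff[OF i i, symmetric]) (simp add: algebra_simps)
  have md: "\<bar>max 0 (t - r) * \<rho> - max 0 (s - r) * \<rho>\<bar> \<le> \<bar>t - s\<bar> * \<rho>" for r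
    unfolding left_diff_distrib[symmetric] abs_mult using \<rho> by (intro mult_mono) auto
  note gt = abs_sin_le_linear[OF \<rho> _ t(2)]
  have T3: "T \<le> T ^ 3" using T power_increasing[of 1 3 T] by simp
  show "\<bar>Phi t t \<rho> - Phi t s \<rho>\<bar> \<le> 2 * T ^ 3 * \<bar>t - s\<bar> powr \<theta> * \<rho>\<^sup>2" if "\<rho> < 1"
  proof -
    \<comment> \<open>Both times lie in [0, T] and T \<ge> 1, so the surplus power 1 - \<theta> of
      the time difference costs at most a factor T.\<close>
    have d: "\<bar>t - s\<bar> \<le> T * \<bar>t - s\<bar> powr \<theta>"
    proof (cases "t = s")
      case False
      have "\<bar>t - s\<bar> = \<bar>t - s\<bar> powr (1 - \<theta>) * \<bar>t - s\<bar> powr \<theta>"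
        using False by (simp add: powr_add[symmetric])
      also have "\<bar>t - s\<bar> powr (1 - \<theta>) \<le> T powr (1 - \<theta>)"
        using t s \<theta> by (intro powr_mono2) auto
      also have "T powr (1 - \<theta>) \<le> T powr 1"
        using T \<theta> by (intro powr_mono) auto
      finally show ?thesis using T by (simp add: mult_right_mono)
    qed simp
    have "\<bar>Phi t t \<rho> - Phi t s \<rho>\<bar> \<le> T * ((T * \<rho>) * (\<bar>t - s\<bar> * \<rho>))"
      unfolding diff
    proof (rule integral_Icc_bound(2)[OF m])
      fix r assume r: "r \<in> {0..T}"
      have "\<bar>?g t r - ?g s r\<bar> \<le> \<bar>t - s\<bar> * \<rho>"
        using abs_sin_diff_le[of "max 0 (t - r) * \<rho>" "max 0 (s - r) * \<rho>"] md[of r] by linarith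
      then show "\<bar>?g t r * (?g t r - ?g s r)\<bar> \<le> (T * \<rho>) * (\<bar>t - s\<bar> * \<rho>)"
        unfolding abs_mult using gt[OF r] T \<rho> by (intro mult_mono) auto
    qed (use T in simp)
    also have "\<dots> = T\<^sup>2 * \<rho>\<^sup>2 * \<bar>t - s\<bar>" by (simp add: power2_eq_square mult_ac)
    also have "\<dots> \<le> T\<^sup>2 * \<rho>\<^sup>2 * (T * \<bar>t - s\<bar> powr \<theta>)"
      by (intro mult_left_mono d) auto
    also have "\<dots> = T ^ 3 * \<bar>t - s\<bar> powr \<theta> * \<rho>\<^sup>2" by (simp add: power2_eq_square power3_eq_cube mult_ac)
    also have "\<dots> \<le> 2 * (T ^ 3 * \<bar>t - s\<bar> powr \<theta> * \<rho>\<^sup>2)" using T by simp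
    finally show ?thesis by (simp add: mult_ac)
  qed
  show "\<bar>Phi t t \<rho> - Phi t s \<rho>\<bar> \<le> 2 * T ^ 3 * \<bar>t - s\<bar> powr \<theta> * \<rho> powr \<theta>" if "1 \<le> \<rho>"
  proof -
    have "\<bar>Phi t t \<rho> - Phi t s \<rho>\<bar> \<le> T * (1 * (2 * ?D))"
      unfolding diff
    proof (rule integral_Icc_bound(2)[OF m])
      fix r assume r: "r \<in> {0..T}"
      have "\<bar>?g t r - ?g s r\<bar> \<le> 2 * \<bar>max 0 (t - r) * \<rho> - max 0 (s - r) * \<rho>\<bar> powr \<theta>"
        by (rule sin_diff_le_powr[OF \<theta>])
      also have "\<dots> \<le> 2 * (\<bar>t - s\<bar> * \<rho>) powr \<theta>"
        using md \<theta> by (intro mult_left_mono powr_mono2) auto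
      also have "\<dots> = 2 * ?D"
        using \<rho> by (simp add: powr_mult)
      finally show "\<bar>?g t r * (?g t r - ?g s r)\<bar> \<le> 1 * (2 * ?D)"
        unfolding abs_mult by (intro mult_mono) auto
    qed (use T in simp)
    also have "\<dots> = T * (2 * ?D)" by simp
    also have "\<dots> \<le> T ^ 3 * (2 * ?D)"
      using T3 by (intro mult_right_mono) auto
    finally show ?thesis by (simp add: mult_ac)
  qed
qed

text \<open>Inserting \<open>Phi t s\<close> twice separates two time differences from a purely
  spatial term with 1 - cos. The exponent \<theta> need not be optimal, as chaining accepts any
  positive power.\<close>

theorem spectral_increment_bound:
  fixes z :: "'a::euclidean_space"
  assumes t: "0 \<le> t" "t \<le> T" and s: "0 \<le> s" "s \<le> T" and T: "1 \<le> T"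
    and \<theta>: "0 < \<theta>" "\<theta> \<le> 1" and \<beta>: "0 < \<beta>" "\<theta> < 2 - \<beta>"
  shows "\<bar>LINT \<xi>|lborel. mu \<beta> \<xi> * (Phi t t (norm \<xi>) - 2 * (cos (z \<bullet> \<xi>) * Phi t s (norm \<xi>)) + Phi s s (norm \<xi>))\<bar>
    \<le> 4 * T ^ 3 * (\<bar>t - s\<bar> powr \<theta> + norm z powr \<theta>) * (LINT \<xi>|lborel. two_power \<beta> (2 - \<beta> - \<theta>) (\<xi>::'a))"
proof (rule integrable_mu_bounded(2)[OF _ \<beta>])
  fix \<xi> :: 'a
  let ?\<rho> = "norm \<xi>"
  let ?c = "1 - cos (z \<bullet> \<xi>)" and ?P = "Phi t s ?\<rho>"
  let ?w = "Phi t t ?\<rho> - 2 * (cos (z \<bullet> \<xi>) * ?P) + Phi s s ?\<rho>"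
  have eq: "?w = (Phi t t ?\<rho> - ?P) + (Phi s s ?\<rho> - Phi s t ?\<rho>) + 2 * (?c * ?P)"
    by (simp add: Phi_commute[of s t] algebra_simps)
  have "\<bar>2 * (?c * ?P)\<bar> = 2 * (?c * \<bar>?P\<bar>)"
    by (simp add: abs_mult)
  then have w: "\<bar>?w\<bar> \<le> \<bar>Phi t t ?\<rho> - ?P\<bar> + \<bar>Phi s s ?\<rho> - Phi s t ?\<rho>\<bar> + 2 * (?c * \<bar>?P\<bar>)"
    unfolding eq by linarith
  have c: "?c \<le> 2 * (norm z powr \<theta> * ?\<rho> powr \<theta>)"
  proof -
    have "?c \<le> 2 * \<bar>z \<bullet> \<xi>\<bar> powr \<theta>"
      using \<theta> by (intro one_minus_cos_le) auto
    also have "\<dots> \<le> 2 * (norm z * ?\<rho>) powr \<theta>"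
      using \<theta> by (intro mult_left_mono powr_mono2 Cauchy_Schwarz_ineq2) auto
    finally show ?thesis by (simp add: powr_mult)
  qed
  have T3: "T \<le> T ^ 3" using T power_increasing[of 1 3 T] by simp
  show "\<bar>?w\<bar> \<le> 4 * T ^ 3 * (\<bar>t - s\<bar> powr \<theta> + norm z powr \<theta>) * ?\<rho>\<^sup>2" if \<rho>: "?\<rho> < 1"
  proof -
    have "?c * \<bar>?P\<bar> \<le> (2 * norm z powr \<theta>) * (T ^ 3 * ?\<rho>\<^sup>2)"
    proof (intro mult_mono)
      have "norm z powr \<theta> * ?\<rho> powr \<theta> \<le> norm z powr \<theta> * 1"
        using \<rho> \<theta> by (intro mult_left_mono) (auto simp: powr_le1)
      with c show "?c \<le> 2 * norm z powr \<theta>" by linarith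
    qed (use Phi_bound(2)[OF t s, of ?\<rho>] in auto)
    with w Phi_diff_bound(1)[OF t s norm_ge_zero T \<theta> \<rho>] Phi_diff_bound(1)[OF s t norm_ge_zero T \<theta> \<rho>]
    show ?thesis by (simp add: abs_minus_commute[of s t] algebra_simps)
  qed
  show "\<bar>?w\<bar> \<le> 4 * T ^ 3 * (\<bar>t - s\<bar> powr \<theta> + norm z powr \<theta>) * ?\<rho> powr \<theta>" if \<rho>: "1 \<le> ?\<rho>"
  proof -
    have "?c * \<bar>?P\<bar> \<le> (2 * (norm z powr \<theta> * ?\<rho> powr \<theta>)) * T ^ 3"
      using c Phi_bound(1)[OF t s, of ?\<rho>] T3 by (intro mult_mono) auto
    with w Phi_diff_bound(2)[OF t s norm_ge_zero T \<theta> \<rho>] Phi_diff_bound(2)[OF s t norm_ge_zero T \<theta> \<rho>]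
    show ?thesis by (simp add: abs_minus_commute[of s t] algebra_simps)
  qed
qed measurable

section \<open>Covariance of spatial increments\<close>

text \<open>The constant t / 2 leaves a homogeneous spectral density with exact scaling; the
  oscillating remainder gains a factor 1 / \<rho> and is of smaller order at small scales.\<close>

lemma Phi_diag:
  assumes t: "0 \<le> t" and \<rho>: "0 < \<rho>"
  shows "Phi t t \<rho> = t / 2 - sin (2 * t * \<rho>) / (4 * \<rho>)"
proof -
  let ?F = "\<lambda>r. r / 2 + sin (2 * (t - r) * \<rho>) / (4 * \<rho>)"
  let ?f = "\<lambda>r. sin ((t - r) * \<rho>) * sin ((t - r) * \<rho>)"
  have d: "DERIV ?F r :> ?f r" for r
  proof -
    have "DERIV ?F r :> 1 / 2 - cos (2 * ((t - r) * \<rho>)) / 2"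
      using \<rho> by (auto intro!: derivative_eq_intros simp: field_simps)
    also have "1 / 2 - cos (2 * ((t - r) * \<rho>)) / 2 = ?f r"
      by (simp add: cos_double_sin power2_eq_square diff_divide_distrib)
    finally show ?thesis .
  qed
  have "Phi t t \<rho> = (LINT r|lborel. ?f r * indicator {0..t} r)"
    by (simp add: Phi_def mult.commute)
  also have "\<dots> = ?F t - ?F 0"
    by (rule integral_FTC_Icc_real[OF t d]) (intro continuous_intros)
  finally show ?thesis by simp
qed

text \<open>Up to a factor, the variogram along e of the self-similar field with spectral density
  \<open>mu\<close>, a fractional Brownian field of Hurst index (2 - \<beta>) / 2.\<close>

definition cos_energy :: "real \<Rightarrow> 'a::euclidean_space \<Rightarrow> real \<Rightarrow> real" where
  "cos_energy \<beta> e z = (LINT \<xi>|lborel. mu \<beta> \<xi> * (1 - cos (z * (e \<bullet> \<xi>))))"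

lemma cos_increment_small:
  fixes e \<xi> :: "'a::euclidean_space"
  assumes e: "norm e = 1" and \<kappa>: "0 \<le> \<kappa>" "\<kappa> \<le> 2"
  shows "1 - cos (z * (e \<bullet> \<xi>)) \<le> 2 * (\<bar>z\<bar> powr \<kappa> * norm \<xi> powr \<kappa>)"
proof -
  have "1 - cos (z * (e \<bullet> \<xi>)) \<le> 2 * \<bar>z * (e \<bullet> \<xi>)\<bar> powr \<kappa>"
    using \<kappa> by (rule one_minus_cos_le)
  also have "\<bar>z * (e \<bullet> \<xi>)\<bar> \<le> \<bar>z\<bar> * norm \<xi>"
    using Cauchy_Schwarz_ineq2[of e \<xi>] e by (simp add: abs_mult mult_left_mono)
  then have "2 * \<bar>z * (e \<bullet> \<xi>)\<bar> powr \<kappa> \<le> 2 * (\<bar>z\<bar> * norm \<xi>) powr \<kappa>"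
    using \<kappa> by (intro mult_left_mono powr_mono2) auto
  finally show ?thesis by (simp add: powr_mult)
qed

lemma cos_energy_integrable:
  fixes e :: "'a::euclidean_space"
  assumes \<beta>: "0 < \<beta>" "\<beta> < 2" and e: "norm e = 1"
  shows "integrable lborel (\<lambda>\<xi>. mu \<beta> \<xi> * (1 - cos (z * (e \<bullet> \<xi>))))"
proof (rule integrable_mu_bounded(1)[where \<theta>=0 and C="max 2 (2 * z\<^sup>2)"])
  fix \<xi> :: 'a
  let ?y = "z * (e \<bullet> \<xi>)"
  have pos: "0 \<le> 1 - cos (?y)" by simp
  show "\<bar>1 - cos (?y)\<bar> \<le> max 2 (2 * z\<^sup>2) * (norm \<xi>)\<^sup>2"
  proof (cases "\<xi> = 0")
    case False
    have "1 - cos (?y) \<le> 2 * (\<bar>z\<bar> powr 2 * norm \<xi> powr 2)"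
      by (rule cos_increment_small[OF e]) auto
    also have "\<dots> = 2 * z\<^sup>2 * (norm \<xi>)\<^sup>2"
      by (cases "z = 0") (use False in \<open>auto simp: powr_numeral\<close>)
    also have "\<dots> \<le> max 2 (2 * z\<^sup>2) * (norm \<xi>)\<^sup>2"
      by (intro mult_right_mono) auto
    finally show ?thesis using pos by simp
  qed simp
  show "\<bar>1 - cos (?y)\<bar> \<le> max 2 (2 * z\<^sup>2) * norm \<xi> powr 0" if "1 \<le> norm \<xi>"
  proof -
    have "1 - cos (?y) \<le> 2" using cos_ge_minus_one[of "?y"] by linarith
    also have "\<dots> \<le> max 2 (2 * z\<^sup>2)" by simp
    finally show ?thesis using that pos by auto
  qed
qed (use \<beta> in auto)

text \<open>Homogeneity of \<open>mu\<close> under the substitution of z \<xi> for \<xi>.\<close>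

lemma cos_energy_scaling:
  fixes e :: "'a::euclidean_space"
  assumes \<beta>: "0 < \<beta>" "\<beta> < 2"
  shows "cos_energy \<beta> e z = \<bar>z\<bar> powr (2 - \<beta>) * cos_energy \<beta> e 1"
proof (cases "z = 0")
  case True
  then show ?thesis by (simp add: cos_energy_def)
next
  case False
  let ?f = "\<lambda>\<xi>::'a. mu \<beta> \<xi> * (1 - cos (e \<bullet> \<xi>))"
  have mu_scale: "mu \<beta> (z *\<^sub>R \<xi>) = \<bar>z\<bar> powr (\<beta> - real DIM('a) - 2) * mu \<beta> \<xi>" for \<xi> :: 'a
    using False by (simp add: mu_def powr_mult powr_diff powr_numeral power_mult_distrib)
  have "cos_energy \<beta> e 1 = (LINT \<xi>|lborel. ?f \<xi>)" by (simp add: cos_energy_def)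
  also have "\<dots> = (LINT \<xi>|density (distr lborel borel (\<lambda>x. 0 + z *\<^sub>R x)) (\<lambda>_. ennreal (\<bar>z\<bar> ^ DIM('a))). ?f \<xi>)"
    using lborel_affine[OF False, of "0 :: 'a"] by simp
  also have "\<dots> = (LINT \<xi>|distr lborel borel (\<lambda>x. 0 + z *\<^sub>R x). \<bar>z\<bar> ^ DIM('a) *\<^sub>R ?f \<xi>)"
    by (subst integral_density) auto
  also have "\<dots> = (LINT \<xi>|lborel. \<bar>z\<bar> ^ DIM('a) *\<^sub>R ?f (0 + z *\<^sub>R \<xi>))"
    by (subst integral_distr) auto
  also have "\<dots> = (LINT \<xi>|lborel. (\<bar>z\<bar> ^ DIM('a) * \<bar>z\<bar> powr (\<beta> - real DIM('a) - 2)) * (mu \<beta> \<xi> * (1 - cos (z * (e \<bullet> \<xi>)))))"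
    by (simp add: mu_scale mult_ac)
  also have "\<dots> = \<bar>z\<bar> powr (\<beta> - 2) * cos_energy \<beta> e z"
    using False by (simp add: cos_energy_def powr_realpow[symmetric] powr_add[symmetric])
  finally have "\<bar>z\<bar> powr (2 - \<beta>) * cos_energy \<beta> e 1 = (\<bar>z\<bar> powr (2 - \<beta>) * \<bar>z\<bar> powr (\<beta> - 2)) * cos_energy \<beta> e z"
    by simp
  then show ?thesis using False by (simp add: powr_add[symmetric])
qed

text \<open>The integrand is strictly positive on the ball of radius 1/4 around e / 2, where the
  inner product with e stays in (0, 1).\<close>

lemma cos_energy_pos:
  fixes e :: "'a::euclidean_space"
  assumes \<beta>: "0 < \<beta>" "\<beta> < 2" and e: "norm e = 1"
  shows "0 < cos_energy \<beta> e 1"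
proof -
  let ?f = "\<lambda>\<xi>::'a. mu \<beta> \<xi> * (1 - cos (1 * (e \<bullet> \<xi>)))"
  have nonneg: "0 \<le> ?f \<xi>" for \<xi> by (simp add: mu_nonneg)
  let ?B = "ball (e /\<^sub>R 2) (1/4)"
  have int: "integrable lborel ?f" by (rule cos_energy_integrable[OF \<beta> e])
  have "cos_energy \<beta> e 1 \<noteq> 0"
  proof
    assume "cos_energy \<beta> e 1 = 0"
    then have "AE \<xi> in lborel. ?f \<xi> = 0"
      unfolding cos_energy_def using integral_nonneg_eq_0_iff_AE[OF int] nonneg by simp
    moreover have "?f \<xi> \<noteq> 0" if "\<xi> \<in> ?B" for \<xi>
    proof -
      have "e \<bullet> \<xi> - 1 / 2 = e \<bullet> (\<xi> - e /\<^sub>R 2)"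
        using e by (simp add: inner_diff_right dot_square_norm)
      also have "\<bar>\<dots>\<bar> \<le> norm (\<xi> - e /\<^sub>R 2)"
        using Cauchy_Schwarz_ineq2[of e "\<xi> - e /\<^sub>R 2"] e by simp
      also have "\<dots> < 1 / 4" using that by (simp add: dist_norm norm_minus_commute)
      finally have "\<bar>e \<bullet> \<xi> - 1 / 2\<bar> < 1 / 4" .
      then have y: "0 < e \<bullet> \<xi>" "e \<bullet> \<xi> < 1" by linarith+
      have "cos (e \<bullet> \<xi>) < cos 0"
        using y pi_gt3 by (intro cos_monotone_0_pi) auto
      moreover have "\<xi> \<noteq> 0" using y by auto
      ultimately show ?thesis by (simp add: mu_def)
    qed
    ultimately have "AE \<xi> in lborel. \<xi> \<notin> ?B"
      by (auto elim!: eventually_mono)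
    then have null: "emeasure lborel ?B = 0"
      by (subst (asm) AE_iff_measurable[of ?B]) auto
    show False
    proof -
      have "0 < unit_ball_vol (real DIM('a)) * (1 / 4) ^ DIM('a)"
        by (intro mult_pos_pos) auto
      with null show False
        by (simp add: emeasure_ball ennreal_eq_0_iff)
    qed
  qed
  moreover have "0 \<le> cos_energy \<beta> e 1"
    unfolding cos_energy_def by (intro integral_nonneg_AE AE_I2 nonneg)
  ultimately show ?thesis by simp
qed

text \<open>Up to the constant of the noise, the covariance at time t of two increments of length h
  along e with starting points d apart. The cosine factor is 2 cos (d y) - cos ((d + h) y) - cos ((d
  - h) y).\<close>

definition incr_cov :: "real \<Rightarrow> 'a::euclidean_space \<Rightarrow> real \<Rightarrow> real \<Rightarrow> real \<Rightarrow> real" where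
  "incr_cov \<beta> e t d h =
     (LINT \<xi>|lborel. mu \<beta> \<xi> * (2 * (cos (d * (e \<bullet> \<xi>)) * (1 - cos (h * (e \<bullet> \<xi>)))) * Phi t t (norm \<xi>)))"

text \<open>The part t / 2 of \<open>Phi_diag\<close> gives the second difference by scaling. In the
  rest the gain 1 / |\<xi>| is traded for the extra power h^\<delta>: \<delta> \<le> \<beta> keeps
  the exponent of the cosine bound at most 2, \<delta> < 1 keeps integrability at infinity. The
  bound is uniform in d.\<close>

lemma incr_cov_approx:
  fixes e :: "'a::euclidean_space"
  assumes \<beta>: "0 < \<beta>" "\<beta> < 2" and e: "norm e = 1" and t: "0 \<le> t"
    and \<delta>: "0 < \<delta>" "\<delta> \<le> \<beta>" "\<delta> < 1" and h: "0 < h" "h \<le> 1"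
  shows "\<bar>incr_cov \<beta> e t d h - t * cos_energy \<beta> e 1 / 2 *
      (\<bar>d + h\<bar> powr (2 - \<beta>) + \<bar>d - h\<bar> powr (2 - \<beta>) - 2 * \<bar>d\<bar> powr (2 - \<beta>))\<bar>
    \<le> max 1 (2 * t) * h powr (2 - \<beta> + \<delta>) * (LINT \<xi>|lborel. two_power \<beta> (1 - \<delta>) (\<xi>::'a))"
proof -
  let ?y = "\<lambda>\<xi>::'a. e \<bullet> \<xi>"
  let ?k = "2 - \<beta> + \<delta>" and ?H = "h powr (2 - \<beta> + \<delta>)" and ?c = "\<lambda>\<xi>. 1 - cos (h * (e \<bullet> \<xi>))"
  define w where "w \<xi> = cos (d * ?y \<xi>) * ?c \<xi> * (sin (2 * t * norm \<xi>) / (2 * norm \<xi>))" for \<xi>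
  let ?C = "max 1 (2 * t) * ?H"
  have [measurable]: "w \<in> borel_measurable borel" unfolding w_def by measurable
  have small: "\<bar>w \<xi>\<bar> \<le> ?C * (norm \<xi>)\<^sup>2" if "norm \<xi> < 1" for \<xi>
  proof (cases "\<xi> = 0")
    case False
    then have \<rho>: "0 < norm \<xi>" by simp
    have s: "\<bar>sin (2 * t * norm \<xi>) / (2 * norm \<xi>)\<bar> \<le> t"
    proof -
      have "\<bar>sin (2 * t * norm \<xi>)\<bar> \<le> 2 * t * norm \<xi>"
        using abs_sin_x_le_abs_x[of "2 * t * norm \<xi>"] t by (simp add: abs_mult)
      then show ?thesis using \<rho> by (simp add: abs_divide field_simps)
    qed
    have c: "?c \<xi> \<le> 2 * (?H * (norm \<xi>)\<^sup>2)"
    proof -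
      have "?c \<xi> \<le> 2 * (h powr 2 * norm \<xi> powr 2)"
        using cos_increment_small[OF e, of 2 h \<xi>] h by simp
      also have "\<dots> \<le> 2 * (?H * (norm \<xi>)\<^sup>2)"
        using h \<rho> \<delta> by (intro mult_left_mono mult_mono powr_mono') (auto simp: powr_numeral)
      finally show ?thesis .
    qed
    have "\<bar>w \<xi>\<bar> \<le> 1 * (2 * (?H * (norm \<xi>)\<^sup>2)) * t"
      unfolding w_def abs_mult using c s t by (intro mult_mono) auto
    also have "\<dots> = (2 * t) * (?H * (norm \<xi>)\<^sup>2)" by simp
    also have "\<dots> \<le> max 1 (2 * t) * (?H * (norm \<xi>)\<^sup>2)"
      by (intro mult_right_mono) auto
    finally show ?thesis by (simp add: mult_ac)
  qed (simp add: w_def)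
  have large: "\<bar>w \<xi>\<bar> \<le> ?C * norm \<xi> powr (1 - \<beta> + \<delta>)" if \<rho>: "1 \<le> norm \<xi>" for \<xi>
  proof -
    have s: "\<bar>sin (2 * t * norm \<xi>) / (2 * norm \<xi>)\<bar> \<le> 1 / (2 * norm \<xi>)"
      using \<rho> by (simp add: abs_divide divide_right_mono)
    have c: "?c \<xi> \<le> 2 * (?H * norm \<xi> powr ?k)"
      using cos_increment_small[OF e, of "2 - \<beta> + \<delta>" h \<xi>] h \<delta> \<beta> by simp
    have "\<bar>w \<xi>\<bar> \<le> 1 * (2 * (?H * norm \<xi> powr ?k)) * (1 / (2 * norm \<xi>))"
      unfolding w_def abs_mult using c s by (intro mult_mono) auto
    also have "\<dots> = ?H * (norm \<xi> powr ?k / norm \<xi> powr 1)"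
      using \<rho> by simp
    also have "norm \<xi> powr ?k / norm \<xi> powr 1 = norm \<xi> powr (1 - \<beta> + \<delta>)"
      using powr_diff[of "norm \<xi>" "2 - \<beta> + \<delta>" 1] by (simp add: algebra_simps)
    also have "?H * norm \<xi> powr (1 - \<beta> + \<delta>) \<le> max 1 (2 * t) * (?H * norm \<xi> powr (1 - \<beta> + \<delta>))"
      using mult_right_mono[of 1 "max 1 (2 * t)" "?H * norm \<xi> powr (1 - \<beta> + \<delta>)"] by simp
    finally show ?thesis by (simp add: mult_ac)
  qed
  have \<theta>: "1 - \<beta> + \<delta> < 2 - \<beta>" using \<delta> by simp
  note bnd = integrable_mu_bounded[where w=w and \<beta>=\<beta> and \<theta>="1 - \<beta> + \<delta>" and C="?C", OF _ \<beta>(1) \<theta> small large]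
  let ?E = "\<lambda>z \<xi>::'a. mu \<beta> \<xi> * (1 - cos (z * ?y \<xi>))"
  have E: "integrable lborel (?E z)" for z by (rule cos_energy_integrable[OF \<beta> e])
  let ?F = "\<lambda>\<xi>. ?E (d + h) \<xi> + ?E (d - h) \<xi> - 2 * ?E d \<xi>"
  have pointwise: "mu \<beta> \<xi> * (2 * (cos (d * ?y \<xi>) * ?c \<xi>) * Phi t t (norm \<xi>))
      = t / 2 * ?F \<xi> - mu \<beta> \<xi> * w \<xi>" for \<xi>
  proof (cases "\<xi> = 0")
    case False
    have trig: "cos ((d + h) * ?y \<xi>) + cos ((d - h) * ?y \<xi>) = 2 * (cos (d * ?y \<xi>) * cos (h * ?y \<xi>))"
      by (simp add: distrib_right left_diff_distrib cos_add cos_diff)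
    define U where "U = 2 * (cos (d * ?y \<xi>) * ?c \<xi>)"
    have gen: "t / 2 * (m * a + m * b - 2 * (m * c)) = t / 2 * (m * (a + b - 2 * c))" for m a b c :: real
      by (simp add: algebra_simps)
    have "2 * (cos (d * ?y \<xi>) * ?c \<xi>)
        = (1 - cos ((d + h) * ?y \<xi>)) + (1 - cos ((d - h) * ?y \<xi>)) - 2 * (1 - cos (d * ?y \<xi>))"
      using trig by (simp add: right_diff_distrib)
    then have "t / 2 * ?F \<xi>
        = t / 2 * (mu \<beta> \<xi> * (2 * (cos (d * ?y \<xi>) * ?c \<xi>)))"
      by (simp only: gen)
    then have E1: "t / 2 * ?F \<xi> = t / 2 * (mu \<beta> \<xi> * U)"
      by (simp only: U_def)
    have P: "Phi t t (norm \<xi>) = t / 2 - sin (2 * t * norm \<xi>) / (4 * norm \<xi>)"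
      using False t by (intro Phi_diag) auto
    have W: "w \<xi> = U / 2 * (sin (2 * t * norm \<xi>) / (2 * norm \<xi>))"
      by (simp add: w_def U_def)
    show ?thesis
      unfolding U_def[symmetric] E1 P W by (simp add: algebra_simps)
  qed (simp add: mu_def)
  have "incr_cov \<beta> e t d h = t / 2 * (cos_energy \<beta> e (d + h) + cos_energy \<beta> e (d - h) - 2 * cos_energy \<beta> e d)
      - (LINT \<xi>|lborel. mu \<beta> \<xi> * w \<xi>)"
    unfolding incr_cov_def pointwise cos_energy_def using E bnd(1) by simp
  then have "incr_cov \<beta> e t d h - t * cos_energy \<beta> e 1 / 2 *
      (\<bar>d + h\<bar> powr (2 - \<beta>) + \<bar>d - h\<bar> powr (2 - \<beta>) - 2 * \<bar>d\<bar> powr (2 - \<beta>)) = - (LINT \<xi>|lborel. mu \<beta> \<xi> * w \<xi>)"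
    using cos_energy_scaling[OF \<beta>, of e "d + h"] cos_energy_scaling[OF \<beta>, of e "d - h"] cos_energy_scaling[OF \<beta>, of e d]
    by (simp add: algebra_simps)
  with bnd(2) show ?thesis by (simp add: mult_ac)
qed

text \<open>The linear Taylor terms at 1 cancel.\<close>

lemma second_difference_powr:
  fixes \<alpha> :: real
  obtains C x0 where "0 < C" "0 < x0" "x0 < 1"
    "\<And>x. 0 < x \<Longrightarrow> x \<le> x0 \<Longrightarrow> \<bar>(1 + x) powr \<alpha> + (1 - x) powr \<alpha> - 2\<bar> \<le> C * x\<^sup>2"
proof -
  let ?f = "\<lambda>x. (1 + x) powr \<alpha> + (1 - x) powr \<alpha> - 2"
  have "?f \<in> O[at_right 0](\<lambda>x. x\<^sup>2)"
    by real_asymp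
  then obtain C where C: "0 < C" "eventually (\<lambda>x. norm (?f x) \<le> C * norm (x\<^sup>2)) (at_right 0)"
    by (rule landau_o.bigE)
  then obtain b where b: "0 < b" "\<And>x. 0 < x \<Longrightarrow> x < b \<Longrightarrow> norm (?f x) \<le> C * norm (x\<^sup>2)"
    unfolding eventually_at_right_field by blast
  show thesis
  proof (rule that[of C "min (b / 2) (1 / 2)"])
    fix x :: real assume x: "0 < x" "x \<le> min (b / 2) (1 / 2)"
    then have "norm (?f x) \<le> C * norm (x\<^sup>2)"
      using b(1) by (intro b(2)) auto
    then show "\<bar>?f x\<bar> \<le> C * x\<^sup>2" by simp
  qed (use C b in auto)
qed

text \<open>At d = 0 the second difference equals 2 h^(2 - \<beta>), and half of it survives the
  error. For x = h / d small it is of order d^(2 - \<beta>) x^2, smaller than the variance by a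
  power of x.\<close>

theorem incr_cov_bounds:
  fixes e :: "'a::euclidean_space"
  assumes \<beta>: "0 < \<beta>" "\<beta> < 2" and e: "norm e = 1" and t: "0 < t" and D: "1 \<le> D"
  obtains v C \<tau> x0 where "0 < v" "0 < C" "0 < \<tau>" "0 < x0" "x0 < 1"
    "\<And>h. 0 < h \<Longrightarrow> h \<le> x0 \<Longrightarrow> v * h powr (2 - \<beta>) \<le> incr_cov \<beta> e t 0 h"
    "\<And>d h. 0 < h \<Longrightarrow> h \<le> x0 * d \<Longrightarrow> h \<le> 1 \<Longrightarrow> d \<le> D \<Longrightarrow>
       \<bar>incr_cov \<beta> e t d h\<bar> \<le> C * h powr (2 - \<beta>) * (h / d) powr \<tau>"
proof -
  define \<delta> where "\<delta> = min \<beta> (1 / 2)"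
  let ?S = "\<lambda>d h. \<bar>d + h\<bar> powr (2 - \<beta>) + \<bar>d - h\<bar> powr (2 - \<beta>) - 2 * \<bar>d\<bar> powr (2 - \<beta>)"
    and ?X = "\<lambda>h x. h powr (2 - \<beta>) * x powr \<delta>"
    and ?I = "LINT \<xi>|lborel. two_power \<beta> (1 - \<delta>) (\<xi>::'a)"
  define A where "A = t * cos_energy \<beta> e 1 / 2"
  define B where "B = max 1 (2 * t) * \<bar>?I\<bar> + 1"
  have \<delta>: "0 < \<delta>" "\<delta> \<le> \<beta>" "\<delta> < 1" using \<beta> by (auto simp: \<delta>_def)
  have A: "0 < A" using cos_energy_pos[OF \<beta> e] t by (simp add: A_def)
  have B: "0 < B" unfolding B_def by (intro add_nonneg_pos mult_nonneg_nonneg) auto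
  have approx: "\<bar>incr_cov \<beta> e t d h - A * ?S d h\<bar>
      \<le> B * ?X h h" if "0 < h" "h \<le> 1" for d h
  proof -
    have "max 1 (2 * t) * h powr (2 - \<beta> + \<delta>) * ?I
        \<le> (max 1 (2 * t) * \<bar>?I\<bar>) * h powr (2 - \<beta> + \<delta>)"
      using mult_left_mono[OF abs_ge_self[of ?I],
          of "max 1 (2 * t) * h powr (2 - \<beta> + \<delta>)"] by (simp add: mult_ac)
    also have "\<dots> \<le> B * h powr (2 - \<beta> + \<delta>)"
      by (intro mult_right_mono) (auto simp: B_def)
    finally show ?thesis
      using incr_cov_approx[OF \<beta> e less_imp_le[OF t] \<delta> that, of d] by (simp add: A_def powr_add)
  qed
  obtain C x1 where C: "0 < C" and x1: "0 < x1" "x1 < 1"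
    and sec: "\<And>x. 0 < x \<Longrightarrow> x \<le> x1 \<Longrightarrow> \<bar>(1 + x) powr (2 - \<beta>) + (1 - x) powr (2 - \<beta>) - 2\<bar> \<le> C * x\<^sup>2"
    using second_difference_powr[of "2 - \<beta>"] by metis
  \<comment> \<open>Below the second bound the error B h^(2 - \<beta> + \<delta>) is at most half of
    the main term 2 A h^(2 - \<beta>).\<close>
  define x0 where "x0 = min x1 ((A / B) powr (1 / \<delta>))"
  have x0: "0 < x0" "x0 < 1" "x0 \<le> x1" using x1 A B by (auto simp: x0_def)
  show thesis
  proof (rule that[of A "A * C + B * D powr \<delta>" \<delta> x0])
    show "0 < A * C + B * D powr \<delta>" using A B C D by (intro add_pos_pos mult_pos_pos) auto
    fix h :: real assume h: "0 < h" "h \<le> x0"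
    have "h powr \<delta> \<le> ((A / B) powr (1 / \<delta>)) powr \<delta>"
      using h \<delta> by (intro powr_mono2) (auto simp: x0_def)
    also have "\<dots> = A / B" using \<delta> A B by (simp add: powr_powr)
    finally have "B * h powr \<delta> \<le> A" using B by (simp add: field_simps)
    then have "(B * h powr \<delta>) * h powr (2 - \<beta>) \<le> A * h powr (2 - \<beta>)"
      by (intro mult_right_mono) auto
    then have "B * ?X h h \<le> A * h powr (2 - \<beta>)" by (simp add: mult_ac)
    moreover have "\<bar>incr_cov \<beta> e t 0 h - 2 * (A * h powr (2 - \<beta>))\<bar> \<le> B * ?X h h"
      using approx[of h 0] h x0 by (simp add: mult_ac)
    ultimately show "A * h powr (2 - \<beta>) \<le> incr_cov \<beta> e t 0 h"
      by (smt (verit))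
  next
    fix d h :: real assume h: "0 < h" "h \<le> x0 * d" "h \<le> 1" and d: "d \<le> D"
    have dpos: "0 < d"
  proof (rule ccontr)
    assume "\<not> 0 < d"
    then have "x0 * d \<le> 0" using x0 by (simp add: mult_le_0_iff)
    with h show False by linarith
  qed
    define x where "x = h / d"
    have x: "0 < x" "x \<le> x0" using h dpos by (auto simp: x_def field_simps)
    have hx: "h = d * x" using dpos by (simp add: x_def)
    have "d + h = d * (1 + x)" "d - h = d * (1 - x)" by (simp_all add: hx algebra_simps)
    moreover have "0 \<le> d * (1 + x)" "0 \<le> d * (1 - x)" using x x0 dpos by auto
    ultimately have ab: "\<bar>d + h\<bar> = d * (1 + x)" "\<bar>d - h\<bar> = d * (1 - x)" by simp_all
    have pw: "(d * (1 + x)) powr (2 - \<beta>) = d powr (2 - \<beta>) * (1 + x) powr (2 - \<beta>)"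
      "(d * (1 - x)) powr (2 - \<beta>) = d powr (2 - \<beta>) * (1 - x) powr (2 - \<beta>)"
      using x x0 dpos by (simp_all add: powr_mult)
    have "?S d h
        = d powr (2 - \<beta>) * ((1 + x) powr (2 - \<beta>) + (1 - x) powr (2 - \<beta>) - 2)"
      unfolding ab pw using dpos by (simp add: algebra_simps)
    also have "\<bar>\<dots>\<bar> \<le> d powr (2 - \<beta>) * (C * x\<^sup>2)"
      using sec[of x] x x0 by (simp add: abs_mult mult_left_mono)
    \<comment> \<open>The first factor combines with d^(2 - \<beta>) to h^(2 - \<beta>); the second
      is the decay, weakened to x^\<delta> below.\<close>
    also have "x\<^sup>2 = x powr (2 - \<beta>) * x powr \<beta>"
      using x by (simp add: powr_add[symmetric] powr_numeral)
    also have "d powr (2 - \<beta>) * (C * (x powr (2 - \<beta>) * x powr \<beta>)) = C * (h powr (2 - \<beta>) * x powr \<beta>)"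
      using x dpos by (simp add: hx powr_mult)
    also have "\<dots> \<le> C * ?X h x"
      using x x0 \<delta> C by (intro mult_left_mono powr_mono') auto
    finally have "A * \<bar>?S d h\<bar>
        \<le> A * (C * ?X h x)"
      using A by (intro mult_left_mono) auto
    then have main: "\<bar>A * ?S d h\<bar>
        \<le> A * (C * ?X h x)"
      using A by (simp add: abs_mult)
    \<comment> \<open>The approximation error has a power of h, not of x; boundedness of d by D
      converts one into the other.\<close>
    have "h powr \<delta> = d powr \<delta> * x powr \<delta>" using x dpos by (simp add: hx powr_mult)
    also have "\<dots> \<le> D powr \<delta> * x powr \<delta>"
      using d dpos \<delta> by (intro mult_right_mono powr_mono2) auto
    finally have "B * ?X h h \<le> B * (h powr (2 - \<beta>) * (D powr \<delta> * x powr \<delta>))"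
      using B by (intro mult_left_mono) auto
    then have "\<bar>incr_cov \<beta> e t d h\<bar> \<le> A * (C * ?X h x) + B * (h powr (2 - \<beta>) * (D powr \<delta> * x powr \<delta>))"
      using approx[OF h(1,3), of d] main by linarith
    then show "\<bar>incr_cov \<beta> e t d h\<bar> \<le> (A * C + B * D powr \<delta>) * h powr (2 - \<beta>) * (h / d) powr \<delta>"
      by (simp add: x_def algebra_simps)
  qed (use A \<delta> x0 in auto)
qed

section \<open>Finite nets and bounds for the oscillation\<close>

text \<open>Rounding coordinates divides space into cubes of side 1 / (dim m). One representative
  inside S is chosen for each cube that meets S, so that the net consists of points of S.\<close>

lemma finite_net:
  fixes S :: "'p::euclidean_space set"
  assumes S: "bounded S"
  obtains K where "1 \<le> K"
    "\<And>m::nat. 1 \<le> m \<Longrightarrow> \<exists>T. finite T \<and> T \<subseteq> S \<and> real (card T) \<le> (K * real m) ^ DIM('p) \<and>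
       (\<forall>p\<in>S. \<exists>q\<in>T. dist p q \<le> 1 / real m)"
proof -
  let ?d = "real DIM('p)"
  have d: "1 \<le> ?d" using DIM_positive[where 'a='p] by linarith
  obtain R where R: "0 < R" "\<And>p. p \<in> S \<Longrightarrow> norm p \<le> R"
    using S unfolding bounded_pos by blast
  define K where "K = 2 * R * ?d + 3"
  show thesis
  proof (rule that[of K])
    show "1 \<le> K" using R d by (simp add: K_def)
    fix m :: nat assume m: "1 \<le> m"
    let ?c = "\<lambda>p b. ?d * real m * (p \<bullet> b)"
    define f where "f p = (\<lambda>b\<in>Basis. \<lfloor>?c p b\<rfloor>)" for p :: 'p
    define n where "n = \<lceil>R * ?d * real m\<rceil>"
    have "-1 < R * ?d * real m"
      by (rule order.strict_trans2[of _ 0]) (use R in auto)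
    then have n0: "0 \<le> n" by (simp add: n_def)
    have f_range: "f ` S \<subseteq> Basis \<rightarrow>\<^sub>E {-n..n}"
    proof (clarsimp simp: f_def)
      fix p b :: 'p assume p: "p \<in> S" and b: "b \<in> Basis"
      have a: "\<bar>p \<bullet> b\<bar> \<le> R" using Basis_le_norm[OF b, of p] R(2)[OF p] by linarith
      have "\<bar>?c p b\<bar> \<le> R * ?d * real m"
        using mult_left_mono[OF a, of "?d * real m"] by (simp add: abs_mult mult_ac)
      also have "\<dots> \<le> real_of_int n" by (simp add: n_def)
      finally show "- n \<le> \<lfloor>?c p b\<rfloor> \<and> \<lfloor>?c p b\<rfloor> \<le> n"
        by (simp add: abs_le_iff le_floor_iff floor_le_iff)
    qed
    have fin: "finite (Basis \<rightarrow>\<^sub>E {-n..n} :: ('p \<Rightarrow> int) set)" by (intro finite_PiE) auto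
    define T where "T = inv_into S f ` (f ` S)"
    show "\<exists>T. finite T \<and> T \<subseteq> S \<and> real (card T) \<le> (K * real m) ^ DIM('p) \<and>
       (\<forall>p\<in>S. \<exists>q\<in>T. dist p q \<le> 1 / real m)"
    proof (intro exI[of _ T] conjI ballI)
      have finf: "finite (f ` S)" using f_range fin by (rule finite_subset)
      then show "finite T" by (simp add: T_def)
      show "T \<subseteq> S" by (auto simp: T_def inv_into_into)
      have "card T \<le> card (f ` S)" unfolding T_def by (rule card_image_le[OF finf])
      also have "\<dots> \<le> card (Basis \<rightarrow>\<^sub>E {-n..n} :: ('p \<Rightarrow> int) set)" by (rule card_mono[OF fin f_range])
      also have "\<dots> = nat (2 * n + 1) ^ DIM('p)" by (simp add: card_PiE)
      finally have "real (card T) \<le> (real (nat (2 * n + 1))) ^ DIM('p)"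
        by (metis of_nat_le_iff of_nat_power)
      also have "\<dots> \<le> (K * real m) ^ DIM('p)"
      proof (rule power_mono)
        have "real_of_int n \<le> R * ?d * real m + 1" unfolding n_def by linarith
        moreover have "real (nat (2 * n + 1)) = 2 * real_of_int n + 1" using n0 by simp
        moreover have "3 \<le> 3 * real m" using m by simp
        ultimately show "real (nat (2 * n + 1)) \<le> K * real m"
          unfolding K_def distrib_right by linarith
      qed simp
      finally show "real (card T) \<le> (K * real m) ^ DIM('p)" .
      fix p assume p: "p \<in> S"
      define q where "q = inv_into S f (f p)"
      have q: "q \<in> T" "f q = f p" using p by (auto simp: q_def T_def f_inv_into_f)
      have comp: "\<bar>(p - q) \<bullet> b\<bar> \<le> 1 / (?d * real m)" if b: "b \<in> Basis" for b
      proof -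
        have "\<lfloor>?c p b\<rfloor> = \<lfloor>?c q b\<rfloor>"
          using fun_cong[OF q(2), of b] b by (simp add: f_def)
        then have "\<bar>?c p b - ?c q b\<bar> \<le> 1" by linarith
        then have "(?d * real m) * \<bar>(p - q) \<bullet> b\<bar> \<le> 1"
          by (simp add: right_diff_distrib[symmetric] abs_mult inner_diff_left)
        then show ?thesis using d m by (simp add: field_simps)
      qed
      have "dist p q \<le> (\<Sum>b\<in>Basis. \<bar>(p - q) \<bullet> b\<bar>)"
        unfolding dist_norm by (rule norm_le_l1)
      also have "\<dots> \<le> (\<Sum>b\<in>(Basis::'p set). 1 / (?d * real m))"
        by (intro sum_mono comp)
      also have "\<dots> = 1 / real m" using d by simp
      finally show "\<exists>q\<in>T. dist p q \<le> 1 / real m" using q by blast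
    qed
  qed
qed

lemma mult_sqrt_ln_pos:
  fixes s :: real
  assumes "0 < s"
  shows "0 < s * sqrt (ln (1 + 1 / s))"
proof -
  have "1 < 1 + 1 / s" using assms by simp
  then have "0 < ln (1 + 1 / s)" by (rule ln_gt_zero)
  then have "0 < sqrt (ln (1 + 1 / s))" by (rule real_sqrt_gt_zero)
  with assms show ?thesis by (rule mult_pos_pos)
qed

context gaussian_space begin

definition gam :: "('p \<Rightarrow> 'a \<Rightarrow> real) \<Rightarrow> 'p \<Rightarrow> 'p \<Rightarrow> real" where
  "gam X p q = sd X p q * sqrt (ln (1 + 1 / sd X p q))"

lemma gam_pos: "0 < sd X p q \<Longrightarrow> 0 < gam X p q"
  unfolding gam_def by (rule mult_sqrt_ln_pos)

text \<open>A Euclidean net of polynomial size becomes a net for \<open>sd\<close>, of geometric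
  size in the level n, when its mesh is a fixed power of 2^(-n).\<close>

lemma Hoelder_upper_bound:
  fixes X :: "'p::euclidean_space \<Rightarrow> 'a \<Rightarrow> real"
  assumes S: "bounded S" and X: "\<And>p. p \<in> S \<Longrightarrow> X p \<in> G"
    and cont: "\<And>\<omega>. \<omega> \<in> space M \<Longrightarrow> continuous_on S (\<lambda>p. X p \<omega>)"
    and C: "0 < C" and \<theta>: "0 < \<theta>"
    and hoelder: "\<And>p q. p \<in> S \<Longrightarrow> q \<in> S \<Longrightarrow> sd X p q \<le> C * dist p q powr \<theta>"
  shows "\<exists>C E. 0 < C \<and> E \<in> events \<and> 0 < prob E \<and>
    (\<forall>\<omega>\<in>E. \<forall>p\<in>S. \<forall>q\<in>S. 0 < sd X p q \<and> sd X p q \<le> 1 / 2 \<longrightarrow> \<bar>X p \<omega> - X q \<omega>\<bar> \<le> C * gam X p q)"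
proof -
  obtain K where K: "1 \<le> K" and net: "\<And>m::nat. 1 \<le> m \<Longrightarrow> \<exists>T. finite T \<and> T \<subseteq> S \<and>
      real (card T) \<le> (K * real m) ^ DIM('p) \<and> (\<forall>p\<in>S. \<exists>q\<in>T. dist p q \<le> 1 / real m)"
    using finite_net[OF S] that by metis
  define L where "L = nat \<lceil>1 / \<theta>\<rceil>"
  have L: "1 / \<theta> \<le> real L" using \<theta> by (simp add: L_def of_nat_nat)
  then have L1: "1 \<le> L" using \<theta> by (cases L) (auto simp: field_simps)
  define M0 where "M0 = max 1 (nat \<lceil>C\<rceil>)"
  have M0: "1 \<le> M0" "C \<le> real M0" by (auto simp: M0_def) linarith
  \<comment> \<open>As L \<theta> \<ge> 1 and M0 \<ge> C, the Hoelder bound at distance 1 / m n is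
    at most C / (M0 2^n), hence at most 2^(-n).\<close>
  define m where "m n = (M0 * 2 ^ n) ^ L" for n :: nat
  have m1: "1 \<le> M0 * 2 ^ n" for n using M0 by simp
  have m: "1 \<le> m n" for n unfolding m_def using one_le_power[OF m1] .
  define T where "T n = (SOME T. finite T \<and> T \<subseteq> S \<and>
      real (card T) \<le> (K * real (m n)) ^ DIM('p) \<and> (\<forall>p\<in>S. \<exists>q\<in>T. dist p q \<le> 1 / real (m n)))" for n
  have T: "finite (T n)" "T n \<subseteq> S" "real (card (T n)) \<le> (K * real (m n)) ^ DIM('p)"
    "\<And>p. p \<in> S \<Longrightarrow> \<exists>q\<in>T n. dist p q \<le> 1 / real (m n)" for n
    using someI_ex[OF net[OF m[of n]]] unfolding T_def[symmetric] by auto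
  define \<pi> where "\<pi> n p = (SOME q. q \<in> T n \<and> dist p q \<le> 1 / real (m n))" for n p
  have \<pi>: "\<pi> n p \<in> T n" "dist p (\<pi> n p) \<le> 1 / real (m n)" if "p \<in> S" for n p
    using someI_ex[OF T(4)[OF that, of n, unfolded Bex_def]] by (auto simp: \<pi>_def)
  \<comment> \<open>Chaining also needs convergence along the nets. A small \<open>sd\<close> says
    nothing about one path, so it is obtained from the Euclidean mesh and path continuity.\<close>
  have dist_half: "1 / real (m n) \<le> (1/2) ^ n" for n
  proof -
    have "2 ^ n \<le> M0 * 2 ^ n" using M0 by simp
    also have "\<dots> = (M0 * 2 ^ n) ^ 1" by simp
    also have "\<dots> \<le> m n" unfolding m_def using L1 m1 by (intro power_increasing) auto
    finally have "real (2 ^ n) \<le> real (m n)" by (rule of_nat_mono)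
    then have "1 / real (m n) \<le> 1 / 2 ^ n" using m[of n] by (intro divide_left_mono) auto
    then show ?thesis by (simp add: power_one_over)
  qed
  have sd_half: "sd X p (\<pi> n p) \<le> (1/2) ^ n" if p: "p \<in> S" for n p
  proof -
    have "sd X p (\<pi> n p) \<le> C * dist p (\<pi> n p) powr \<theta>"
      using \<pi>(1)[OF p, of n] T(2)[of n] p by (intro hoelder) auto
    also have "\<dots> \<le> C * (1 / real (m n)) powr \<theta>"
      using C \<theta> \<pi>(2)[OF p, of n] by (intro mult_left_mono powr_mono2) auto
    also have "(1 / real (m n)) powr \<theta> = (real (M0 * 2 ^ n)) powr (- (real L * \<theta>))"
      using M0 by (simp add: m_def powr_divide powr_realpow[symmetric] powr_powr powr_minus_divide del: of_nat_mult)
    also have "\<dots> \<le> (real (M0 * 2 ^ n)) powr (- 1)"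
    proof (rule powr_mono)
      show "1 \<le> real (M0 * 2 ^ n)" using m1[of n] by (metis of_nat_1 of_nat_mono)
      show "- (real L * \<theta>) \<le> - 1" using L \<theta> by (simp add: field_simps)
    qed
    also have "\<dots> = 1 / (real M0 * 2 ^ n)" using M0 by (simp add: powr_minus_divide)
    also have "C * (1 / (real M0 * 2 ^ n)) \<le> real M0 * (1 / (real M0 * 2 ^ n))"
      using M0 by (intro mult_right_mono) auto
    also have "\<dots> = (1/2) ^ n" using M0 by (simp add: power_one_over)
    finally show ?thesis using C by (simp add: mult_left_mono)
  qed
  have "\<exists>C' E. 0 < C' \<and> E \<in> events \<and> 0 < prob E \<and>
    (\<forall>\<omega>\<in>E. \<forall>p\<in>S. \<forall>q\<in>S. 0 < sd X p q \<and> sd X p q \<le> 1 / 2 \<longrightarrow>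
       \<bar>X p \<omega> - X q \<omega>\<bar> \<le> C' * sd X p q * sqrt (ln (1 + 1 / sd X p q)))"
  proof (rule chaining_bound[where T=T and \<pi>=\<pi> and A="(K * real M0 ^ L) ^ DIM('p)" and B="(2 ^ L) ^ DIM('p)"])
    show "real (card (T n)) \<le> (K * real M0 ^ L) ^ DIM('p) * ((2 ^ L) ^ DIM('p)) ^ n" for n
    proof -
      have "((2 ^ L) ^ DIM('p)) ^ n = (((2::real) ^ n) ^ L) ^ DIM('p)"
        by (simp only: power_mult[symmetric] mult_ac)
      then have "(K * real M0 ^ L) ^ DIM('p) * ((2 ^ L) ^ DIM('p)) ^ n = (K * real (m n)) ^ DIM('p)"
        by (simp add: m_def power_mult_distrib mult_ac)
      with T(3)[of n] show ?thesis by simp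
    qed
    have "1 \<le> K * real M0 ^ L"
      using mult_mono[of 1 K 1 "real M0 ^ L"] K M0 by (simp add: one_le_power)
    then show "1 \<le> (K * real M0 ^ L) ^ DIM('p)" by (rule one_le_power)
    show "1 \<le> ((2::real) ^ L) ^ DIM('p)" by (simp add: one_le_power)
    show "\<pi> n p \<in> T n \<and> sd X p (\<pi> n p) \<le> (1/2) ^ n" if "p \<in> S" for n p
      using \<pi> sd_half that by blast
    show "(\<lambda>n. X (\<pi> n p) \<omega>) \<longlonglongrightarrow> X p \<omega>" if "\<omega> \<in> space M" "p \<in> S" for \<omega> p
    proof -
      have "(\<lambda>n. dist p (\<pi> n p)) \<longlonglongrightarrow> 0"
      proof (rule tendsto_sandwich[of "\<lambda>_. 0" _ _ "\<lambda>n. (1/2) ^ n"])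
        show "\<forall>\<^sub>F n in sequentially. dist p (\<pi> n p) \<le> (1/2) ^ n"
          using \<pi>(2)[OF that(2)] dist_half by (intro always_eventually allI) (meson order.trans)
        show "(\<lambda>n. (1/2) ^ n :: real) \<longlonglongrightarrow> 0" by (rule LIMSEQ_power_zero) simp
      qed auto
      then have "(\<lambda>n. \<pi> n p) \<longlonglongrightarrow> p"
        by (subst tendsto_dist_iff) (simp add: dist_commute)
      then show ?thesis
        using cont[OF that(1)] that(2) \<pi>(1)[OF that(2)] T(2)
        by (intro continuous_on_tendsto_compose[of S "\<lambda>p. X p \<omega>"]) (auto intro!: always_eventually)
    qed
  qed (use T X in auto)
  then show ?thesis by (simp add: gam_def mult.assoc)
qed

text \<open>The probability that all N variables stay small tends to 0. The event of failure for
  every N beyond N0 lies in each of these events and is therefore null; no relation between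
  different N enters.\<close>

lemma lower_oscillation:
  fixes D :: "nat \<Rightarrow> nat \<Rightarrow> 'a \<Rightarrow> real" and V \<rho> :: "nat \<Rightarrow> real"
  assumes D: "\<And>N i. D N i \<in> G"
    and V: "\<And>N. N1 \<le> N \<Longrightarrow> 0 < V N" "\<And>N i. N1 \<le> N \<Longrightarrow> i < N \<Longrightarrow> ip (D N i) (D N i) = V N"
    and \<rho>: "\<And>N. N1 \<le> N \<Longrightarrow> 0 \<le> \<rho> N"
      "\<And>N i j. N1 \<le> N \<Longrightarrow> i < N \<Longrightarrow> j < N \<Longrightarrow> i \<noteq> j \<Longrightarrow> \<bar>ip (D N i) (D N j)\<bar> \<le> \<rho> N"
      "\<And>N. N1 \<le> N \<Longrightarrow> 8 * real N * \<rho> N \<le> V N"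
    and Q: "0 < Q" "\<And>N. N1 \<le> N \<Longrightarrow> ln (1 + 1 / sqrt (V N)) \<le> Q * ln (real N)"
    and N0: "N1 \<le> N0"
  shows "AE \<omega> in M. \<exists>N\<ge>N0. \<exists>i<N. (1 / sqrt (8 * Q)) * (sqrt (V N) * sqrt (ln (1 + 1 / sqrt (V N)))) < \<bar>D N i \<omega>\<bar>"
proof -
  let ?\<gamma> = "\<lambda>N. sqrt (V N) * sqrt (ln (1 + 1 / sqrt (V N)))"
  have [measurable]: "D N i \<in> borel_measurable M" for N i using D by simp
  \<comment> \<open>A tail of order at least N^(-1/4) results, since (x + 1)^2 \<le> 2 x^2 + 2; N
    trials then leave an exponent of order N^(3/4), which tends to infinity.\<close>
  define x where "x N = sqrt (ln (real N)) / 2" for N :: nat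
  define q where "q N = exp (- (x N + 1)\<^sup>2 / 2) / sqrt (2 * pi)" for N
  define bad where "bad N = {\<omega>\<in>space M. \<forall>i<N. \<bar>D N i \<omega>\<bar> \<le> x N * sqrt (V N / 2)}" for N
  have [measurable]: "bad N \<in> events" for N unfolding bad_def by measurable
  have bad_le: "prob (bad N) \<le> exp (- q N * real N)" if N: "N1 \<le> N" "1 \<le> N" for N
  proof -
    have "prob (bad N) \<le> (1 - q N) ^ N"
      unfolding bad_def q_def
    proof (rule small_ball_prob[OF D])
      show "V N / 2 \<le> ip (innov (D N) i) (innov (D N) i)" if "i < N" for i
        using near_orthogonal_innov[where D="D N" and V="V N" and N=N and \<rho>="\<rho> N", OF D V(1)[OF N(1)] V(2)[OF N(1)] \<rho>(1)[OF N(1)] \<rho>(2)[OF N(1)] \<rho>(3)[OF N(1)] that]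
        by blast
    qed (use V(1)[OF N(1)] N in \<open>auto simp: x_def\<close>)
    also have "\<dots> \<le> exp (- q N) ^ N"
    proof (rule power_mono)
      show "1 - q N \<le> exp (- q N)" using exp_ge_add_one_self[of "- q N"] by simp
      have "q N \<le> 1 / 1"
        unfolding q_def using pi_gt3 by (intro frac_le) auto
      then show "0 \<le> 1 - q N" by simp
    qed
    also have "\<dots> = exp (- q N * real N)" by (simp add: exp_of_nat_mult[symmetric] mult.commute)
    finally show ?thesis .
  qed
  define q' where "q' N = exp (- (ln (real N) / 4 + 1)) / sqrt (2 * pi)" for N :: nat
  have q': "q' N \<le> q N" if "1 \<le> N" for N
  proof -
    have "(x N + 1)\<^sup>2 \<le> 2 * (x N)\<^sup>2 + 2"
      using zero_le_power2[of "x N - 1"] by (simp add: power2_eq_square algebra_simps)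
    also have "(x N)\<^sup>2 = ln (real N) / 4" using that by (simp add: x_def power_divide)
    finally have "- (ln (real N) / 4 + 1) \<le> - (x N + 1)\<^sup>2 / 2" by simp
    then show ?thesis unfolding q_def q'_def by (intro divide_right_mono) auto
  qed
  have lim: "(\<lambda>N. exp (- q' N * real N)) \<longlonglongrightarrow> 0"
    unfolding q'_def minus_mult_left[symmetric] by real_asymp
  let ?B = "\<Inter>N\<in>{N0..}. bad N"
  have null: "prob ?B = 0"
  proof -
    have "prob ?B \<le> 0"
    proof (rule tendsto_lowerbound[OF lim])
      show "\<forall>\<^sub>F N in sequentially. prob ?B \<le> exp (- q' N * real N)"
        using eventually_ge_at_top[of "max 1 N0"]
      proof eventually_elim
        case (elim N)
        have "prob ?B \<le> prob (bad N)"
          using elim by (intro finite_measure_mono) auto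
        also have "\<dots> \<le> exp (- q N * real N)" using elim N0 by (intro bad_le) auto
        also have "\<dots> \<le> exp (- q' N * real N)" using q'[of N] elim by (simp add: mult_right_mono)
        finally show ?case .
      qed
    qed simp
    then show ?thesis using measure_nonneg[of M ?B] by linarith
  qed
  have "AE \<omega> in M. \<omega> \<notin> ?B"
    using null by (intro AE_not_in) (auto simp: null_sets_def emeasure_eq_measure)
  with AE_space show ?thesis
  proof eventually_elim
    case (elim \<omega>)
    then obtain N i where N: "N0 \<le> N" "i < N" "x N * sqrt (V N / 2) < \<bar>D N i \<omega>\<bar>"
      by (auto simp: bad_def not_le)
    \<comment> \<open>The 8 collects the halved variance of the innovations and the factor 1/2 in
      x.\<close>
    have "1 / sqrt (8 * Q) * ?\<gamma> N
        \<le> 1 / sqrt (8 * Q) * (sqrt (V N) * sqrt (Q * ln (real N)))"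
      using V(1)[of N] Q N N0 by (intro mult_left_mono real_sqrt_le_mono) auto
    also have "\<dots> = x N * sqrt (V N / 2)"
    proof -
      have "sqrt 8 = 2 * sqrt 2" using real_sqrt_mult[of 4 2] by simp
      then show ?thesis using Q(1) by (simp add: x_def real_sqrt_mult real_sqrt_divide)
    qed
    finally show ?case using N by (intro exI[of _ N] conjI exI[of _ i]) linarith+
  qed
qed

end

section \<open>Exact modulus of a Hoelder Gaussian field\<close>

context gaussian_space begin

text \<open>The zero-one law applies to a sequence, hence to a dense sequence in S; continuity of
  the paths and of \<open>sd\<close> carries the limit over to all of S. The two one-sided bounds
  then make the extended real constant finite and positive.\<close>

theorem exact_modulus:
  fixes X :: "'p::euclidean_space \<Rightarrow> 'a \<Rightarrow> real"
  assumes S: "bounded S" "S \<noteq> {}" and X: "\<And>p. p \<in> S \<Longrightarrow> X p \<in> G"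
    and cont: "\<And>\<omega>. \<omega> \<in> space M \<Longrightarrow> continuous_on S (\<lambda>p. X p \<omega>)"
    and C: "0 < C" and \<theta>: "0 < \<theta>"
    and hoelder: "\<And>p q. p \<in> S \<Longrightarrow> q \<in> S \<Longrightarrow> sd X p q \<le> C * dist p q powr \<theta>"
    and \<eta>: "0 < \<eta>"
    and lower: "\<And>\<epsilon>. 0 < \<epsilon> \<Longrightarrow> AE \<omega> in M. \<exists>p\<in>S. \<exists>q\<in>S. 0 < sd X p q \<and> sd X p q \<le> \<epsilon> \<and>
      \<eta> * gam X p q \<le> \<bar>X p \<omega> - X q \<omega>\<bar>"
  shows "\<exists>K>0. AE \<omega> in M.
    ((\<lambda>\<epsilon>. SUP (p, q)\<in>{(p, q). p \<in> S \<and> q \<in> S \<and> 0 < sd X p q \<and> sd X p q \<le> \<epsilon>}.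
        ereal (\<bar>X p \<omega> - X q \<omega>\<bar> / gam X p q)) \<longlongrightarrow> ereal K) (at_right 0)"
proof -
  define F where "F \<epsilon> \<omega> = (SUP (p, q)\<in>{(p, q). p \<in> S \<and> q \<in> S \<and> 0 < sd X p q \<and> sd X p q \<le> \<epsilon>}.
        ereal (\<bar>X p \<omega> - X q \<omega>\<bar> / gam X p q))" for \<epsilon> \<omega>
  obtain D where D: "countable D" "D \<subseteq> S" "S \<subseteq> closure D"
    using separable by metis
  have "D \<noteq> {}" using D S by auto
  define d where "d = from_nat_into D"
  have range_d: "range d = D"
    unfolding d_def using D(1) \<open>D \<noteq> {}\<close> by (rule range_from_nat_into[rotated])
  have dS: "d i \<in> S" for i using range_d D(2) by blast
  \<comment> \<open>Both inequalities are strict, so they pass from a pair in S to nearby pairs of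
    the dense sequence.\<close>
  define P where "P N = {(i, j). 0 < sd X (d i) (d j) \<and> sd X (d i) (d j) < 1 / (real N + 1)}" for N :: nat
  define g where "g i j = gam X (d i) (d j)" for i j
  let ?L = "\<lambda>\<omega>. lim_modulus P g (\<lambda>i. X (d i) \<omega>)"
    and ?R = "\<lambda>\<omega> p q. \<bar>X p \<omega> - X q \<omega>\<bar> / gam X p q"
    and ?r = "\<lambda>\<omega> i j. \<bar>X (d i) \<omega> - X (d j) \<omega>\<bar> / g i j"
  have P_dec: "decseq P"
  proof (rule decseq_SucI)
    fix N
    have "1 / (real (Suc N) + 1) \<le> 1 / (real N + 1)" by (intro divide_left_mono) auto
    then show "P (Suc N) \<subseteq> P N" by (auto simp: P_def)
  qed
  have sd_small: "\<exists>N. \<forall>(i, j)\<in>P N. sd X (d i) (d j) \<le> \<epsilon> * g i j" if \<epsilon>: "0 < \<epsilon>" for \<epsilon>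
  proof -
    \<comment> \<open>At this scale the logarithmic factor of \<open>gam\<close> is at least 1 /
      \<epsilon>.\<close>
    obtain N :: nat where N: "exp ((1 / \<epsilon>)\<^sup>2) \<le> real N" using real_arch_simple by blast
    have "sd X (d i) (d j) \<le> \<epsilon> * g i j" if "(i, j) \<in> P N" for i j
    proof -
      let ?s = "sd X (d i) (d j)"
      have s: "0 < ?s" "?s < 1 / (real N + 1)" using that by (auto simp: P_def)
      then have "real N + 1 < 1 / ?s" by (simp add: field_simps)
      with N have "exp ((1 / \<epsilon>)\<^sup>2) \<le> 1 + 1 / ?s" by linarith
      then have "(1 / \<epsilon>)\<^sup>2 \<le> ln (1 + 1 / ?s)"
        by (subst ln_ge_iff) (use s in \<open>auto intro: add_pos_pos\<close>)
      then have "1 / \<epsilon> \<le> sqrt (ln (1 + 1 / ?s))"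
        by (rule real_le_rsqrt)
      then have "?s * (1 / \<epsilon>) \<le> g i j"
        using s unfolding g_def gam_def by (intro mult_left_mono) auto
      then show ?thesis using \<epsilon> by (simp add: field_simps)
    qed
    then show ?thesis by blast
  qed
  have "\<exists>K. AE \<omega> in M. ?L \<omega> = K"
  proof (rule lim_modulus_AE_const[of "\<lambda>i. X (d i)"])
    show "\<exists>N. \<forall>(i, j)\<in>P N. sd (\<lambda>i. X (d i)) i j \<le> \<epsilon> * g i j" if "0 < \<epsilon>" for \<epsilon>
      using sd_small[OF that] unfolding sd_def .
    show "0 < g i j" if "(i, j) \<in> P N" for N i j
      using that gam_pos[of X "d i" "d j"] by (auto simp: P_def g_def)
  qed (use X dS P_dec in auto)
  then obtain K where K: "AE \<omega> in M. ?L \<omega> = K" by blast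

  let ?SN = "\<lambda>N \<omega>. SUP (i, j)\<in>P N. ereal (?r \<omega> i j)"
  have SN_le: "?SN N \<omega> \<le> F (1 / (real N + 1)) \<omega>" for N \<omega>
  proof (rule SUP_least, clarify)
    fix i j assume "(i, j) \<in> P N"
    then show "ereal (?r \<omega> i j)
        \<le> F (1 / (real N + 1)) \<omega>"
      unfolding F_def using dS by (intro SUP_upper2[of "(d i, d j)"]) (auto simp: P_def g_def)
  qed
  have F_mono: "F \<epsilon> \<omega> \<le> F \<epsilon>' \<omega>" if "\<epsilon> \<le> \<epsilon>'" for \<epsilon> \<epsilon>' \<omega>
    unfolding F_def using that by (intro SUP_subset_mono) auto
  have F_le: "F \<epsilon> \<omega> \<le> ?SN N \<omega>" if \<epsilon>: "\<epsilon> < 1 / (real N + 1)" and \<omega>: "\<omega> \<in> space M" for \<epsilon> N \<omega>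
    unfolding F_def
  proof (rule SUP_least, clarify)
    fix p q assume p: "p \<in> S" and q: "q \<in> S" and s: "0 < sd X p q" "sd X p q \<le> \<epsilon>"
    obtain pk where pk: "\<And>k. pk k \<in> D" "pk \<longlonglongrightarrow> p"
      using p D(3) closure_sequential[of p D] by blast
    obtain qk where qk: "\<And>k. qk k \<in> D" "qk \<longlonglongrightarrow> q"
      using q D(3) closure_sequential[of q D] by blast
    have S': "pk k \<in> S" "qk k \<in> S" for k using pk qk D(2) by auto
    have dist0: "(\<lambda>k. C * dist p (pk k) powr \<theta> + C * dist q (qk k) powr \<theta>) \<longlonglongrightarrow> 0"
    proof -
      have "(\<lambda>k. C * dist p (pk k) powr \<theta> + C * dist q (qk k) powr \<theta>) \<longlonglongrightarrow> C * 0 + C * 0"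
        using pk(2) qk(2) \<theta>
        by (intro tendsto_add tendsto_mult tendsto_const tendsto_zero_powrI[where b=\<theta>])
          (auto simp: tendsto_dist_iff[of _ p] tendsto_dist_iff[of _ q] dist_commute)
      then show ?thesis by simp
    qed
    have "(\<lambda>k. sd X (pk k) (qk k)) \<longlonglongrightarrow> sd X p q"
    proof (rule Lim_transform_bound[OF _ dist0, THEN LIM_zero_cancel])
      show "\<forall>\<^sub>F k in sequentially. norm (sd X (pk k) (qk k) - sd X p q) \<le> norm (C * dist p (pk k) powr \<theta> + C * dist q (qk k) powr \<theta>)"
      proof (intro always_eventually allI)
        fix k
        have "sd X (pk k) (qk k) \<le> sd X (pk k) p + (sd X p q + sd X q (qk k))"
          using sd_triangle[of X "pk k" p "qk k"] sd_triangle[of X p q "qk k"] X p q S' by fastforce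
        moreover have "sd X p q \<le> sd X p (pk k) + (sd X (pk k) (qk k) + sd X (qk k) q)"
          using sd_triangle[of X p "pk k" q] sd_triangle[of X "pk k" "qk k" q] X p q S' by fastforce
        moreover have "sd X p (pk k) \<le> C * dist p (pk k) powr \<theta>" "sd X q (qk k) \<le> C * dist q (qk k) powr \<theta>"
          using hoelder p q S' by auto
        ultimately show "norm (sd X (pk k) (qk k) - sd X p q) \<le> norm (C * dist p (pk k) powr \<theta> + C * dist q (qk k) powr \<theta>)"
          using sd_commute[of X p "pk k"] sd_commute[of X q "qk k"] by simp
      qed
    qed
    note sd_lim = this
    have gam_lim: "(\<lambda>k. gam X (pk k) (qk k)) \<longlonglongrightarrow> gam X p q"
    proof -
      have "1 + 1 / sd X p q \<noteq> 0" using s by (simp add: add_nonneg_eq_0_iff)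
      then show ?thesis
        unfolding gam_def using s by (intro tendsto_intros sd_lim) auto
    qed
    have X_lim: "(\<lambda>k. X (pk k) \<omega>) \<longlonglongrightarrow> X p \<omega>" "(\<lambda>k. X (qk k) \<omega>) \<longlonglongrightarrow> X q \<omega>"
      using S' p q pk(2) qk(2)
      by (auto intro!: continuous_on_tendsto_compose[OF cont[OF \<omega>]] always_eventually)
    have "(\<lambda>k. ereal (?R \<omega> (pk k) (qk k))) \<longlonglongrightarrow> ereal (?R \<omega> p q)"
      using gam_pos[OF s(1)] by (intro tendsto_intros X_lim gam_lim) auto
    moreover have "\<forall>\<^sub>F k in sequentially. ereal (?R \<omega> (pk k) (qk k)) \<le> ?SN N \<omega>"
      using order_tendstoD(1)[OF sd_lim s(1)] order_tendstoD(2)[OF sd_lim order.strict_trans1[OF s(2) \<epsilon>]]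
    proof eventually_elim
      case (elim k)
      obtain i j where ij: "pk k = d i" "qk k = d j" using pk(1)[of k] qk(1)[of k] range_d by blast
      then have "(i, j) \<in> P N" using elim by (simp add: P_def)
      then show ?case unfolding ij by (intro SUP_upper2[of "(i, j)"]) (auto simp: g_def)
    qed
    ultimately show "ereal (?R \<omega> p q) \<le> ?SN N \<omega>"
      by (rule tendsto_upperbound) simp
  qed
  have F_lim: "((\<lambda>\<epsilon>. F \<epsilon> \<omega>) \<longlongrightarrow> ?L \<omega>) (at_right 0)" if \<omega>: "\<omega> \<in> space M" for \<omega>
  proof (rule order_tendstoI)
    fix a assume a: "a < ?L \<omega>"
    have "a < F \<epsilon> \<omega>" if \<epsilon>: "0 < \<epsilon>" for \<epsilon>
    proof -
      obtain N :: nat where "1 / \<epsilon> \<le> real N" using real_arch_simple by blast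
      then have N: "1 / (real N + 1) \<le> \<epsilon>" using \<epsilon> by (simp add: field_simps)
      have "?L \<omega> \<le> ?SN N \<omega>"
        unfolding lim_modulus_def by (rule INF_lower) simp
      also have "\<dots> \<le> F (1 / (real N + 1)) \<omega>" by (rule SN_le)
      also have "\<dots> \<le> F \<epsilon> \<omega>" by (rule F_mono[OF N])
      finally show ?thesis using a by (rule order.strict_trans2[rotated])
    qed
    then show "\<forall>\<^sub>F \<epsilon> in at_right 0. a < F \<epsilon> \<omega>"
      by (auto simp: eventually_at_right_field intro!: exI[of _ 1])
  next
    fix a assume "?L \<omega> < a"
    then obtain N where N: "?SN N \<omega> < a" unfolding lim_modulus_def by (auto simp: INF_less_iff)
    have "F \<epsilon> \<omega> < a" if "\<epsilon> < 1 / (real N + 1)" for \<epsilon>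
      using F_le[OF that \<omega>] N by (rule order.strict_trans1)
    then show "\<forall>\<^sub>F \<epsilon> in at_right 0. F \<epsilon> \<omega> < a"
      by (auto simp: eventually_at_right_field intro!: exI[of _ "1 / (real N + 1)"])
  qed
  have K_lower: "ereal \<eta> \<le> K"
  proof -
    have "AE \<omega> in M. \<forall>n::nat. \<exists>p\<in>S. \<exists>q\<in>S. 0 < sd X p q \<and> sd X p q \<le> 1 / (real n + 2) \<and>
        \<eta> * gam X p q \<le> \<bar>X p \<omega> - X q \<omega>\<bar>"
      by (subst AE_all_countable) (intro allI lower; simp)
    with AE_space K have "AE \<omega> in M. ereal \<eta> \<le> K"
    proof eventually_elim
      case (elim \<omega>)
      have "ereal \<eta> \<le> ?SN N \<omega>" for N
      proof -
        obtain p q where pq: "p \<in> S" "q \<in> S" "0 < sd X p q" "sd X p q \<le> 1 / (real N + 2)"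
            "\<eta> * gam X p q \<le> \<bar>X p \<omega> - X q \<omega>\<bar>"
          using elim(3) by blast
        have "\<eta> \<le> \<bar>X p \<omega> - X q \<omega>\<bar> / gam X p q"
          using pq gam_pos[OF pq(3)] by (simp add: field_simps)
        then have "ereal \<eta> \<le> F (1 / (real N + 2)) \<omega>"
          unfolding F_def using pq by (intro SUP_upper2[of "(p, q)"]) auto
        \<comment> \<open>N + 2 was used in place of N + 1 because \<open>F_le\<close> asks for a
          strictly smaller scale.\<close>
        also have "\<dots> \<le> ?SN N \<omega>"
          using elim(1) by (intro F_le) (auto simp: field_simps)
        finally show ?thesis .
      qed
      then have "ereal \<eta> \<le> ?L \<omega>"
        unfolding lim_modulus_def by (rule INF_greatest)
      with elim(2) show ?case by simp
    qed
    then show ?thesis by simp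
  qed
  obtain C' E where E: "E \<in> events" "0 < prob E"
    and upper: "\<And>\<omega> p q. \<omega> \<in> E \<Longrightarrow> p \<in> S \<Longrightarrow> q \<in> S \<Longrightarrow> 0 < sd X p q \<Longrightarrow> sd X p q \<le> 1 / 2 \<Longrightarrow>
      \<bar>X p \<omega> - X q \<omega>\<bar> \<le> C' * gam X p q"
    using Hoelder_upper_bound[OF S(1) X cont C \<theta> hoelder] by metis
  have K_upper: "K \<le> ereal C'"
  proof -
    \<comment> \<open>An event of positive probability meets the almost sure event on which the
      limit is constant; a single such \<omega> bounds the constant.\<close>
    have "\<exists>\<omega>\<in>E. ?L \<omega> = K"
    proof (rule ccontr)
      assume "\<not> ?thesis"
      with K have "AE \<omega> in M. \<omega> \<notin> E" by (auto elim!: eventually_mono)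
      then have "prob E = 0" using E(1) by (simp add: prob_eq_0)
      with E(2) show False by simp
    qed
    then obtain \<omega> where \<omega>: "\<omega> \<in> E" "?L \<omega> = K" by blast
    have "?L \<omega> \<le> ?SN 1 \<omega>"
      unfolding lim_modulus_def by (rule INF_lower) simp
    also have "\<dots> \<le> ereal C'"
    proof (rule SUP_least, clarify)
      fix i j assume "(i, j) \<in> P 1"
      then have s: "0 < sd X (d i) (d j)" "sd X (d i) (d j) \<le> 1 / 2" by (auto simp: P_def)
      show "ereal (?r \<omega> i j) \<le> ereal C'"
        using upper[OF \<omega>(1) dS dS s] gam_pos[OF s(1)] by (simp add: g_def field_simps)
    qed
    finally show ?thesis using \<omega>(2) by simp
  qed
  obtain k where k: "K = ereal k" using K_lower K_upper by (cases K) auto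
  have "0 < k" using K_lower \<eta> k by simp
  moreover have "AE \<omega> in M. ((\<lambda>\<epsilon>. F \<epsilon> \<omega>) \<longlongrightarrow> ereal k) (at_right 0)"
    using AE_space K
  proof eventually_elim
    case (elim \<omega>)
    then show ?case using F_lim[OF elim(1)] k by simp
  qed
  ultimately show ?thesis unfolding F_def by blast
qed

end

section \<open>The stochastic wave equation\<close>

lemma wave_const_pos:
  assumes "(0 < \<beta> \<and> \<beta> < min (real k) 2) \<or> (k = 1 \<and> \<beta> = 1)"
  shows "0 < wave_const k \<beta>"
  using assms by (auto simp: wave_const_def intro!: mult_pos_pos divide_pos_pos Gamma_real_pos)

text \<open>Exactly the combinations that \<open>stoch_wave_solution\<close> declares to be centered
  Gaussian.\<close>

definition wave_space :: "('a \<Rightarrow> real \<times> (real ^ 'n) \<Rightarrow> real) \<Rightarrow> ('a \<Rightarrow> real) set" where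
  "wave_space u = {\<lambda>\<omega>. \<Sum>p\<in>F. c p * u \<omega> p | F c. finite F \<and> F \<subseteq> {p. 0 \<le> fst p}}"

lemma wave_space_mem: "0 \<le> fst p \<Longrightarrow> (\<lambda>\<omega>. u \<omega> p) \<in> wave_space u"
  unfolding wave_space_def by (auto intro!: exI[of _ "{p}"] exI[of _ "\<lambda>_. 1"])

lemma gaussian_space_wave:
  fixes u :: "'a \<Rightarrow> real \<times> (real ^ 'n) \<Rightarrow> real"
  assumes sol: "stoch_wave_solution M \<beta> u"
  shows "gaussian_space M (wave_space u)"
proof (intro gaussian_space.intro gaussian_space_axioms.intro)
  show "prob_space M" using sol by (simp add: stoch_wave_solution_def)
  show "centered_gaussian M X" if "X \<in> wave_space u" for X
    using sol that unfolding stoch_wave_solution_def wave_space_def by blast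
  show "(\<lambda>_. 0) \<in> wave_space u"
    unfolding wave_space_def by (auto intro!: exI[of _ "{}"])
  fix X Y a b assume "X \<in> wave_space u" "Y \<in> wave_space u"
  then obtain F c F' c' where X: "X = (\<lambda>\<omega>. \<Sum>p\<in>F. c p * u \<omega> p)" "finite F" "F \<subseteq> {p. 0 \<le> fst p}"
    and Y: "Y = (\<lambda>\<omega>. \<Sum>p\<in>F'. c' p * u \<omega> p)" "finite F'" "F' \<subseteq> {p. 0 \<le> fst p}"
    unfolding wave_space_def by blast
  define c'' where "c'' p = a * (if p \<in> F then c p else 0) + b * (if p \<in> F' then c' p else 0)" for p
  have "a * X \<omega> + b * Y \<omega> = (\<Sum>p\<in>F \<union> F'. c'' p * u \<omega> p)" for \<omega>
  proof -
    have "X \<omega> = (\<Sum>p\<in>F \<union> F'. (if p \<in> F then c p else 0) * u \<omega> p)"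
      unfolding X(1) using X(2) Y(2) by (intro sum.mono_neutral_cong_left) auto
    moreover have "Y \<omega> = (\<Sum>p\<in>F \<union> F'. (if p \<in> F' then c' p else 0) * u \<omega> p)"
      unfolding Y(1) using X(2) Y(2) by (intro sum.mono_neutral_cong_left) auto
    ultimately show ?thesis
      by (simp add: c''_def sum_distrib_left sum.distrib[symmetric] distrib_right mult.assoc)
  qed
  then show "(\<lambda>\<omega>. a * X \<omega> + b * Y \<omega>) \<in> wave_space u"
    unfolding wave_space_def using X Y
    by (intro CollectI exI[of _ "F \<union> F'"] exI[of _ c'']) auto
qed

lemma (in gaussian_space) ip_diff_diff:
  assumes "A \<in> G" "B \<in> G" "C \<in> G" "D \<in> G"
  shows "ip (\<lambda>\<omega>. A \<omega> - B \<omega>) (\<lambda>\<omega>. C \<omega> - D \<omega>) = ip A C - ip A D - (ip B C - ip B D)"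
proof -
  have "ip Z (\<lambda>\<omega>. C \<omega> - D \<omega>) = ip Z C - ip Z D" if "Z \<in> G" for Z
    using ip_diff[OF assms(3,4) that] by (simp only: ip_commute[of _ Z])
  then show ?thesis
    using ip_diff[OF assms(1,2) diff_mem[OF assms(3,4)]] assms by (simp only:)
qed

section \<open>Increments of the solution\<close>

locale wave_solution =
  fixes M :: "'a measure" and u :: "'a \<Rightarrow> real \<times> (real ^ 'n) \<Rightarrow> real" and \<beta> :: real
  assumes \<beta>_range: "(0 < \<beta> \<and> \<beta> < min (real CARD('n)) 2) \<or> (CARD('n) = 1 \<and> \<beta> = 1)"
    and sol: "stoch_wave_solution M \<beta> u"
begin

sublocale gaussian_space M "wave_space u"
  by (rule gaussian_space_wave[OF sol])

lemma \<beta>: "0 < \<beta>" "\<beta> < 2"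
  using \<beta>_range by auto

definition c0 :: real where "c0 = wave_const CARD('n) \<beta>"

lemma c0_pos: "0 < c0"
  unfolding c0_def using \<beta>_range by (rule wave_const_pos)

definition X :: "real \<times> (real ^ 'n) \<Rightarrow> 'a \<Rightarrow> real" where "X p \<omega> = u \<omega> p"

lemma X_mem: "0 \<le> fst p \<Longrightarrow> X p \<in> wave_space u"
  unfolding X_def by (rule wave_space_mem)

lemma spectral_integrable:
  fixes z :: "real ^ 'n"
  assumes "0 \<le> t" "0 \<le> s"
  shows "integrable lborel (\<lambda>\<xi>. mu \<beta> \<xi> * (cos (z \<bullet> \<xi>) * Phi t s (norm \<xi>)))"
  using wave_cov_spectral(1)[OF \<beta> assms, of z 0] by simp

lemma ip_X:
  assumes "0 \<le> t" "0 \<le> s"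
  shows "ip (X (t, x)) (X (s, y)) = c0 * (LINT \<xi>|lborel. mu \<beta> \<xi> * (cos ((x - y) \<bullet> \<xi>) * Phi t s (norm \<xi>)))"
proof -
  have "complex_of_real (ip (X (t, x)) (X (s, y))) = wave_cov \<beta> t x s y"
    using sol assms unfolding stoch_wave_solution_def ip_def X_def by blast
  then have "ip (X (t, x)) (X (s, y)) = Re (wave_cov \<beta> t x s y)"
    by (metis Re_complex_of_real)
  then show ?thesis
    using wave_cov_spectral(2)[OF \<beta> assms] by (simp add: c0_def)
qed

lemma sd_square:
  assumes t: "0 \<le> t" and s: "0 \<le> s"
  shows "(sd X (t, x) (s, y))\<^sup>2 = c0 * (LINT \<xi>|lborel. mu \<beta> \<xi> *
    (Phi t t (norm \<xi>) - 2 * (cos ((x - y) \<bullet> \<xi>) * Phi t s (norm \<xi>)) + Phi s s (norm \<xi>)))"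
proof -
  let ?w = "\<lambda>(z :: real ^ 'n) t s \<xi>. mu \<beta> \<xi> * (cos (z \<bullet> \<xi>) * Phi t s (norm \<xi>))"
  have mem: "X (t, x) \<in> wave_space u" "X (s, y) \<in> wave_space u"
    using t s by (auto intro: X_mem)
  have "(sd X (t, x) (s, y))\<^sup>2 = expectation (\<lambda>\<omega>. (X (t, x) \<omega> - X (s, y) \<omega>)\<^sup>2)"
    by (simp add: sd_def ip_def power2_eq_square)
  also have "\<dots> = ip (X (t, x)) (X (t, x)) - 2 * ip (X (t, x)) (X (s, y)) + ip (X (s, y)) (X (s, y))"
    by (rule ip_square_diff[OF mem])
  also have "\<dots> = c0 * ((LINT \<xi>|lborel. ?w 0 t t \<xi>)
      - 2 * (LINT \<xi>|lborel. ?w (x - y) t s \<xi>)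
      + (LINT \<xi>|lborel. ?w 0 s s \<xi>))"
    using ip_X[OF t t, of x x] ip_X[OF t s, of x y] ip_X[OF s s, of y y] by (simp add: algebra_simps)
  also have "\<dots> = c0 * (LINT \<xi>|lborel. ?w 0 t t \<xi>
      - 2 * (?w (x - y) t s \<xi>)
      + ?w 0 s s \<xi>)"
    using spectral_integrable[OF t t, of 0] spectral_integrable[OF t s, of "x - y"] spectral_integrable[OF s s, of 0]
    by simp
  also have "(LINT \<xi>|lborel. ?w 0 t t \<xi>
      - 2 * (?w (x - y) t s \<xi>)
      + ?w 0 s s \<xi>)
    = (LINT \<xi>|lborel. mu \<beta> \<xi> * (Phi t t (norm \<xi>) - 2 * (cos ((x - y) \<bullet> \<xi>) * Phi t s (norm \<xi>)) + Phi s s (norm \<xi>)))"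
    by (intro Bochner_Integration.integral_cong) (auto simp: algebra_simps)
  finally show ?thesis .
qed

lemma sd_Hoelder:
  assumes "0 \<le> a"
  obtains C \<theta> where "0 < C" "0 < \<theta>"
    "\<And>p q. fst p \<in> {a..a'} \<Longrightarrow> fst q \<in> {a..a'} \<Longrightarrow> sd X p q \<le> C * dist p q powr \<theta>"
proof -
  \<comment> \<open>Half of 2 - \<beta> stays strictly below the critical exponent; the square root
    halves it once more.\<close>
  define \<theta> where "\<theta> = min 1 ((2 - \<beta>) / 2)"
  have \<theta>: "0 < \<theta>" "\<theta> \<le> 1" "\<theta> < 2 - \<beta>" using \<beta> by (auto simp: \<theta>_def min_def)
  define T where "T = max 1 a'"
  have T: "1 \<le> T" "a' \<le> T" by (auto simp: T_def)
  define I where "I = (LINT \<xi>|lborel. two_power \<beta> (2 - \<beta> - \<theta>) (\<xi> :: real ^ 'n))"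
  have I: "0 \<le> I" unfolding I_def by (intro integral_nonneg_AE AE_I2 two_power_nonneg)
  define K where "K = c0 * (8 * T ^ 3 * I)"
  have K: "0 \<le> K" using I T c0_pos by (simp add: K_def)
  show thesis
  proof (rule that[of "sqrt K + 1" "\<theta> / 2"])
    fix p q :: "real \<times> (real ^ 'n)" assume "fst p \<in> {a..a'}" "fst q \<in> {a..a'}"
    obtain t x where p: "p = (t, x)" by (cases p)
    obtain s y where q: "q = (s, y)" by (cases q)
    have t: "0 \<le> t" "t \<le> T" and s: "0 \<le> s" "s \<le> T"
      using \<open>fst p \<in> _\<close> \<open>fst q \<in> _\<close> assms T by (auto simp: p q)
    have d: "\<bar>t - s\<bar> \<le> dist p q" "norm (x - y) \<le> dist p q"
      using dist_fst_le[of p q] dist_snd_le[of p q] by (auto simp: p q dist_norm)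
    have "(sd X p q)\<^sup>2 \<le> c0 * (4 * T ^ 3 * (\<bar>t - s\<bar> powr \<theta> + norm (x - y) powr \<theta>) * I)"
      unfolding p q sd_square[OF t(1) s(1)] I_def
      using c0_pos spectral_increment_bound[OF t s T(1) \<theta>(1,2) \<beta>(1) \<theta>(3), of "x - y"]
      by (intro mult_left_mono) auto
    also have "\<dots> \<le> c0 * (4 * T ^ 3 * (dist p q powr \<theta> + dist p q powr \<theta>) * I)"
      using c0_pos I T d \<theta> by (intro mult_left_mono mult_right_mono add_mono powr_mono2) auto
    also have "\<dots> = K * dist p q powr \<theta>" by (simp add: K_def)
    finally have "sd X p q \<le> sqrt (K * dist p q powr \<theta>)"
      by (rule real_le_rsqrt)
    also have "\<dots> = sqrt K * dist p q powr (\<theta> / 2)"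
      by (simp add: real_sqrt_mult powr_half_sqrt_powr)
    also have "\<dots> \<le> (sqrt K + 1) * dist p q powr (\<theta> / 2)"
      by (intro mult_right_mono) auto
    finally show "sd X p q \<le> (sqrt K + 1) * dist p q powr (\<theta> / 2)" .
  qed (use K \<theta> in \<open>auto intro: add_nonneg_pos\<close>)
qed

text \<open>At a fixed time the covariance depends on the difference of the positions only, so the
  four terms form a second difference in r - s.\<close>

lemma ip_increments:
  fixes e :: "real ^ 'n" and r s h t :: real
  assumes t: "0 \<le> t"
  shows "ip (\<lambda>\<omega>. X (t, r *\<^sub>R e) \<omega> - X (t, (r + h) *\<^sub>R e) \<omega>) (\<lambda>\<omega>. X (t, s *\<^sub>R e) \<omega> - X (t, (s + h) *\<^sub>R e) \<omega>)
    = c0 * incr_cov \<beta> e t (r - s) h" (is "?lhs = _")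
proof -
  let ?w = "\<lambda>z \<xi>. mu \<beta> \<xi> * (cos (z * (e \<bullet> \<xi>)) * Phi t t (norm \<xi>))"
  define R where "R z = (LINT \<xi>|lborel. ?w z \<xi>)" for z
  have int: "integrable lborel (\<lambda>\<xi>. ?w z \<xi>)" for z
    using spectral_integrable[OF t t, of "z *\<^sub>R e"] by simp
  have mem: "X (t, z) \<in> wave_space u" for z using t by (intro X_mem) auto
  have ipR: "ip (X (t, z *\<^sub>R e)) (X (t, w *\<^sub>R e)) = c0 * R (z - w)" for z w
  proof -
    have "(z *\<^sub>R e - w *\<^sub>R e) \<bullet> \<xi> = (z - w) * (e \<bullet> \<xi>)" for \<xi>
      by (simp add: inner_diff_left left_diff_distrib)
    then show ?thesis unfolding ip_X[OF t t] R_def by (simp only:)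
  qed
  have "?lhs
      = c0 * (2 * R (r - s) - R (r - s - h) - R (r - s + h))"
  proof -
    have "c0 * R (r - s) - c0 * R (r - (s + h)) - (c0 * R (r + h - s) - c0 * R (r + h - (s + h)))
        = c0 * (2 * R (r - s) - R (r - s - h) - R (r - s + h))"
      by (simp add: algebra_simps)
    then show ?thesis
      unfolding ip_diff_diff[OF mem mem mem mem] ipR .
  qed
  also have "2 * R (r - s) - R (r - s - h) - R (r - s + h)
      = (LINT \<xi>|lborel. 2 * (?w (r - s) \<xi>)
          - ?w (r - s - h) \<xi>
          - ?w (r - s + h) \<xi>)"
    using int by (simp add: R_def)
  also have "\<dots> = incr_cov \<beta> e t (r - s) h"
    unfolding incr_cov_def
  proof (intro Bochner_Integration.integral_cong refl)
    fix \<xi> :: "real ^ 'n"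
    let ?d = "(r - s) * (e \<bullet> \<xi>)" and ?h = "h * (e \<bullet> \<xi>)"
    have "(r - s - h) * (e \<bullet> \<xi>) = ?d - ?h" "(r - s + h) * (e \<bullet> \<xi>) = ?d + ?h"
      by (simp_all add: algebra_simps)
    then show "2 * (mu \<beta> \<xi> * (cos ?d * Phi t t (norm \<xi>)))
          - ?w (r - s - h) \<xi>
          - ?w (r - s + h) \<xi>
        = mu \<beta> \<xi> * (2 * (cos ?d * (1 - cos ?h)) * Phi t t (norm \<xi>))"
      by (simp only: cos_diff cos_add) (simp add: algebra_simps)
  qed
  finally show ?thesis .
qed

lemma incr_cov_minus: "incr_cov \<beta> e t (- d) h = incr_cov \<beta> e t d h"
  by (simp add: incr_cov_def)

end

context wave_solution begin

text \<open>All increments lie on one coordinate segment at the initial time of the box, which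
  reduces the problem to one spatial dimension.\<close>

lemma sd_lower_oscillation:
  assumes a: "0 < a" "a < a'" and b: "0 < b"
  obtains \<eta> where "0 < \<eta>" "\<And>\<epsilon>. 0 < \<epsilon> \<Longrightarrow> AE \<omega> in M. \<exists>p\<in>wave_box a a' b. \<exists>q\<in>wave_box a a' b.
    0 < sd X p q \<and> sd X p q \<le> \<epsilon> \<and> \<eta> * gam X p q \<le> \<bar>X p \<omega> - X q \<omega>\<bar>"
proof -
  define \<alpha> where "\<alpha> = 2 - \<beta>"
  have \<alpha>: "0 < \<alpha>" using \<beta> by (simp add: \<alpha>_def)
  fix i0 :: 'n
  define e :: "real ^ 'n" where "e = axis i0 1"
  have e: "norm e = 1" by (simp add: e_def norm_axis_1)
  obtain v C \<tau> x0 where vC: "0 < v" "0 < C" "0 < \<tau>" and x0: "0 < x0" "x0 < 1"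
    and diag: "\<And>h. 0 < h \<Longrightarrow> h \<le> x0 \<Longrightarrow> v * h powr (2 - \<beta>) \<le> incr_cov \<beta> e a 0 h"
    and off: "\<And>d h. 0 < h \<Longrightarrow> h \<le> x0 * d \<Longrightarrow> h \<le> 1 \<Longrightarrow> d \<le> max 1 b \<Longrightarrow>
       \<bar>incr_cov \<beta> e a d h\<bar> \<le> C * h powr (2 - \<beta>) * (h / d) powr \<tau>"
    using incr_cov_bounds[OF \<beta> e a(1), of "max 1 b"] by (metis max.cobounded1)
  obtain Ch \<theta> where Ch: "0 < Ch" "0 < \<theta>"
    and hoelder: "\<And>p q. fst p \<in> {a..a'} \<Longrightarrow> fst q \<in> {a..a'} \<Longrightarrow> sd X p q \<le> Ch * dist p q powr \<theta>"
    using sd_Hoelder[of a a'] a by (metis less_imp_le)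
  \<comment> \<open>Then h / d \<le> N^(1 - P), and its power \<tau> is N^(-2): one factor 1 / N
    outweighs the number of variables, the other provides smallness.\<close>
  define P where "P = 1 + 2 / \<tau>"
  have P: "1 < P" "(1 - P) * \<tau> = - 2" using vC by (auto simp: P_def)
  define h where "h N = b * real N powr (- P)" for N :: nat
  define p where "p N j = (a, (real j * b / real N) *\<^sub>R e)" for N j :: nat
  define q where "q N j = (a, (real j * b / real N + h N) *\<^sub>R e)" for N j :: nat
  define D where "D N j = (if j < N then (\<lambda>\<omega>. X (p N j) \<omega> - X (q N j) \<omega>) else (\<lambda>_. 0))" for N j
  define V where "V N = c0 * incr_cov \<beta> e a 0 (h N)" for N
  define \<rho> where "\<rho> N = c0 * (C * h N powr \<alpha> * real N powr (- 2))" for N :: nat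
  \<comment> \<open>The standard deviation is at least N^(-m) / \<open>K1\<close>; using m + 1 below
    absorbs \<open>K1\<close> and the summand 1 in the logarithm.\<close>
  define m where "m = P * \<alpha> / 2"
  define K1 where "K1 = 1 / sqrt (c0 * v * b powr \<alpha>)"
  have K1: "0 < K1" using c0_pos vC b by (simp add: K1_def)
  have m: "0 < m" using P \<alpha> by (simp add: m_def)
  have hx: "h N = (b / real N) * real N powr (1 - P)" if "1 \<le> N" for N
    using that by (simp add: h_def powr_diff powr_minus_divide)

  have "\<forall>\<^sub>F N::nat in sequentially. real N powr (1 - P) \<le> x0"
    using P x0 by real_asymp
  moreover have "\<forall>\<^sub>F N::nat in sequentially. b * real N powr (- P) \<le> x0"
    using P x0 b by real_asymp
  moreover have "\<forall>\<^sub>F N::nat in sequentially. 1 + K1 * real N powr m \<le> real N powr (m + 1)"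
    using K1 m by real_asymp
  moreover have "\<forall>\<^sub>F N::nat in sequentially. 8 * C / real N \<le> v"
    using vC by real_asymp
  ultimately have "\<forall>\<^sub>F N::nat in sequentially. real N powr (1 - P) \<le> x0 \<and> h N \<le> x0 \<and>
      1 + K1 * real N powr m \<le> real N powr (m + 1) \<and> 8 * C / real N \<le> v \<and> 1 \<le> N"
    using eventually_ge_at_top[of 1] unfolding h_def by eventually_elim auto
  then obtain N1 where "\<forall>N\<ge>N1. real N powr (1 - P) \<le> x0 \<and> h N \<le> x0 \<and>
      1 + K1 * real N powr m \<le> real N powr (m + 1) \<and> 8 * C / real N \<le> v \<and> 1 \<le> N"
    unfolding eventually_sequentially by blast
  then have N1: "real N powr (1 - P) \<le> x0" "h N \<le> x0" "1 + K1 * real N powr m \<le> real N powr (m + 1)"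
    "8 * C / real N \<le> v" "1 \<le> N" if "N1 \<le> N" for N
    using that by auto
  have h_pos: "0 < h N" if "N1 \<le> N" for N
    using N1(5)[OF that] b by (simp add: h_def)
  have V_lower: "c0 * (v * h N powr \<alpha>) \<le> V N" if "N1 \<le> N" for N
    unfolding V_def \<alpha>_def using c0_pos h_pos[OF that] N1(2)[OF that] diag by (intro mult_left_mono) auto
  have V_pos: "0 < V N" if "N1 \<le> N" for N
  proof -
    have "0 < c0 * (v * h N powr \<alpha>)" using c0_pos vC h_pos[OF that] by simp
    then show ?thesis using V_lower[OF that] by linarith
  qed
  have ip_D: "ip (D N i) (D N j) = c0 * incr_cov \<beta> e a (real i * b / real N - real j * b / real N) (h N)"
    if "i < N" "j < N" for N i j
    using that a by (simp only: D_def p_def q_def if_True ip_increments[of a] less_imp_le)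
  have D_mem: "D N j \<in> wave_space u" for N j
    using a by (auto simp: D_def p_def q_def intro!: diff_mem X_mem zero_mem)
  have ip_off: "\<bar>ip (D N i) (D N j)\<bar> \<le> \<rho> N" if N: "N1 \<le> N" and ij: "i < N" "j < N" "i \<noteq> j" for N i j
  proof -
    let ?d = "real i * b / real N - real j * b / real N"
    define d where "d = \<bar>?d\<bar>"
    have Npos: "0 < real N" using N1(5)[OF N] by simp
    have d_eq: "d = \<bar>real i - real j\<bar> * b / real N"
      using b Npos by (simp add: d_def diff_divide_distrib[symmetric] left_diff_distrib[symmetric] abs_mult)
    have "1 \<le> \<bar>real i - real j\<bar>" "\<bar>real i - real j\<bar> \<le> real N" using ij by linarith+
    then have d: "b / real N \<le> d" "d \<le> b"
      using b Npos unfolding d_eq by (auto simp: field_simps mult_left_mono)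
    have bN: "0 < b / real N" using b Npos by simp
    have dpos: "0 < d" using bN d(1) by linarith
    have "h N \<le> (b / real N) * x0"
      unfolding hx[OF N1(5)[OF N]] using N1(1)[OF N] bN by (intro mult_left_mono) auto
    also have "\<dots> \<le> x0 * d" using mult_left_mono[OF d(1), of x0] x0 by (simp add: mult.commute)
    finally have hd: "h N \<le> x0 * d" .
    \<comment> \<open>Evenness in d permits passing to the absolute distance.\<close>
    have "incr_cov \<beta> e a (?d) (h N) = incr_cov \<beta> e a d (h N)"
      unfolding d_def abs_if by (simp add: incr_cov_minus[of e a ?d, symmetric])
    then have "\<bar>ip (D N i) (D N j)\<bar> = c0 * \<bar>incr_cov \<beta> e a d (h N)\<bar>"
      using ip_D[OF ij(1,2)] c0_pos by (simp add: abs_mult)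
    also have "\<dots> \<le> c0 * (C * h N powr \<alpha> * (h N / d) powr \<tau>)"
      unfolding \<alpha>_def using c0_pos h_pos[OF N] hd N1(2)[OF N] x0 d(2) by (intro mult_left_mono off) auto
    also have "\<dots> \<le> c0 * (C * h N powr \<alpha> * real N powr (- 2))"
    proof -
      have "h N / d \<le> h N / (b / real N)"
        using d(1) dpos bN h_pos[OF N] by (intro divide_left_mono mult_pos_pos) auto
      also have "\<dots> = real N powr (1 - P)" unfolding hx[OF N1(5)[OF N]] using b Npos by simp
      finally have "(h N / d) powr \<tau> \<le> (real N powr (1 - P)) powr \<tau>"
        using vC h_pos[OF N] dpos by (intro powr_mono2) auto
      also have "\<dots> = real N powr (- 2)" using P by (simp add: powr_powr)
      finally show ?thesis using c0_pos vC by (intro mult_left_mono) auto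
    qed
    finally show ?thesis by (simp add: \<rho>_def)
  qed
  have small: "8 * real N * \<rho> N \<le> V N" if N: "N1 \<le> N" for N
  proof -
    have "8 * real N * \<rho> N = c0 * (h N powr \<alpha> * (8 * C * (real N * real N powr (- 2))))"
      by (simp add: \<rho>_def mult_ac)
    also have "real N * real N powr (- 2) = 1 / real N"
      using N1(5)[OF N] by (simp add: powr_minus_divide powr_numeral power2_eq_square)
    also have "c0 * (h N powr \<alpha> * (8 * C * (1 / real N))) \<le> c0 * (h N powr \<alpha> * v)"
      using c0_pos N1(4)[OF N] by (intro mult_left_mono) auto
    also have "\<dots> \<le> V N" using V_lower[OF N] by (simp add: mult_ac)
    finally show ?thesis .
  qed
  have ln_le: "ln (1 + 1 / sqrt (V N)) \<le> (m + 1) * ln (real N)" if N: "N1 \<le> N" for N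
  proof -
    have Npos: "0 < real N" using N1(5)[OF N] by simp
    have "1 / sqrt (V N) \<le> 1 / sqrt (c0 * (v * h N powr \<alpha>))"
      using V_lower[OF N] V_pos[OF N] c0_pos vC h_pos[OF N]
      by (intro divide_left_mono real_sqrt_le_mono) auto
    also have "\<dots> = K1 * real N powr m"
    proof -
      have "h N powr \<alpha> = b powr \<alpha> * (real N powr (- m))\<^sup>2"
        using b Npos by (simp add: h_def powr_mult powr_powr m_def power2_eq_square powr_add[symmetric])
      then have "sqrt (c0 * (v * h N powr \<alpha>)) = sqrt (c0 * v * b powr \<alpha> * (real N powr (- m))\<^sup>2)"
        by (simp add: mult_ac)
      also have "\<dots> = sqrt (c0 * v * b powr \<alpha>) * real N powr (- m)"
        by (simp add: real_sqrt_mult)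
      finally show ?thesis by (simp add: K1_def powr_minus_divide)
    qed
    finally have "1 + 1 / sqrt (V N) \<le> real N powr (m + 1)"
      using N1(3)[OF N] by linarith
    moreover have "0 < 1 + 1 / sqrt (V N)" using V_pos[OF N] by (intro add_pos_pos) auto
    ultimately have "ln (1 + 1 / sqrt (V N)) \<le> ln (real N powr (m + 1))"
      by (intro ln_mono) auto
    then show ?thesis using Npos by (simp add: ln_powr)
  qed
  define \<eta> where "\<eta> = 1 / sqrt (8 * (m + 1))"
  show thesis
  proof (rule that[of \<eta>])
    show "0 < \<eta>" using m by (simp add: \<eta>_def)
    fix \<epsilon> :: real assume \<epsilon>: "0 < \<epsilon>"
    have "\<forall>\<^sub>F N::nat in sequentially. Ch * (b * real N powr (- P)) powr \<theta> \<le> \<epsilon>"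
      using \<epsilon> Ch P b by real_asymp
    then obtain N2 where N2: "\<And>N. N2 \<le> N \<Longrightarrow> Ch * h N powr \<theta> \<le> \<epsilon>"
      unfolding eventually_sequentially h_def by blast
    let ?\<gamma> = "\<lambda>N. sqrt (V N) * sqrt (ln (1 + 1 / sqrt (V N)))"
    have "AE \<omega> in M. \<exists>N\<ge>max N1 N2. \<exists>i<N. (1 / sqrt (8 * (m + 1))) * ?\<gamma> N < \<bar>D N i \<omega>\<bar>"
    proof (rule lower_oscillation[where D=D and V=V and \<rho>=\<rho> and Q="m + 1" and ?N1.0=N1])
      show "ip (D N i) (D N i) = V N" if "i < N" for N i
        using ip_D[OF that that] by (simp add: V_def)
      show "0 \<le> \<rho> N" for N using c0_pos vC by (simp add: \<rho>_def)
    qed (use D_mem V_pos ip_off small ln_le m in auto)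
    then show "AE \<omega> in M. \<exists>p\<in>wave_box a a' b. \<exists>q\<in>wave_box a a' b.
        0 < sd X p q \<and> sd X p q \<le> \<epsilon> \<and> \<eta> * gam X p q \<le> \<bar>X p \<omega> - X q \<omega>\<bar>"
    proof eventually_elim
      case (elim \<omega>)
      then obtain N i where N: "N1 \<le> N" "N2 \<le> N" "i < N"
        and big: "\<eta> * ?\<gamma> N < \<bar>D N i \<omega>\<bar>"
        by (auto simp: \<eta>_def)
      have Npos: "0 < real N" using N1(5)[OF N(1)] by simp
      have sdV: "sd X (p N i) (q N i) = sqrt (V N)"
        using ip_D[OF N(3) N(3)] N(3) by (simp add: sd_def D_def V_def)
      have hb: "h N \<le> b / real N"
        using mult_left_mono[of "real N powr (1 - P)" 1 "b / real N"] N1(1)[OF N(1)] x0 b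
        unfolding hx[OF N1(5)[OF N(1)]] by auto
      \<comment> \<open>As i < N and h \<le> b / N, the right end of each increment is still in
        [0, b].\<close>
      have ib: "0 \<le> real i * b / real N" "real i * b / real N + b / real N \<le> b"
      proof -
        have "(real i + 1) * b \<le> real N * b" using N(3) b by (intro mult_right_mono) auto
        then show "real i * b / real N + b / real N \<le> b"
          using Npos by (simp add: add_divide_distrib[symmetric] field_simps)
      qed (use b in simp)
      have box: "(a, r *\<^sub>R e) \<in> wave_box a a' b" if "0 \<le> r" "r \<le> b" for r
        using that a b by (auto simp: wave_box_def e_def axis_def)
      have p_box: "p N i \<in> wave_box a a' b"
        unfolding p_def using ib b Npos by (intro box) (auto intro: order.trans[rotated])
      have q_box: "q N i \<in> wave_box a a' b"
        unfolding q_def using ib hb h_pos[OF N(1)] by (intro box) linarith+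
      have "sd X (p N i) (q N i) \<le> Ch * dist (p N i) (q N i) powr \<theta>"
        using a by (intro hoelder) (auto simp: p_def q_def)
      also have "dist (p N i) (q N i) = h N"
        using e h_pos[OF N(1)] by (simp add: p_def q_def dist_Pair_Pair dist_norm scaleR_diff_left[symmetric])
      also have "Ch * h N powr \<theta> \<le> \<epsilon>" by (rule N2[OF N(2)])
      finally have sd_le: "sd X (p N i) (q N i) \<le> \<epsilon>" .
      have "\<eta> * gam X (p N i) (q N i) \<le> \<bar>X (p N i) \<omega> - X (q N i) \<omega>\<bar>"
        using big N(3) unfolding gam_def sdV by (simp add: D_def)
      moreover have "0 < sd X (p N i) (q N i)" using sdV V_pos[OF N(1)] by simp
      ultimately show ?case using p_box q_box sd_le by blast
    qed
  qed
qed

end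

lemma bounded_wave_box: "bounded (wave_box a a' b :: (real \<times> (real ^ 'n)) set)"
proof -
  have "{x :: real ^ 'n. \<forall>i. - b \<le> x $ i \<and> x $ i \<le> b} = cbox (\<chi> i. - b) (\<chi> i. b)"
    by (auto simp: mem_box_cart)
  then show ?thesis
    unfolding wave_box_def by (simp add: bounded_Times)
qed

theorem theorem3p1:
  fixes M :: "'a measure" and u :: "'a \<Rightarrow> real \<times> (real ^ 'n) \<Rightarrow> real"
    and \<beta> a a' b :: real
  assumes "(0 < \<beta> \<and> \<beta> < min (real CARD('n)) 2) \<or> (CARD('n) = 1 \<and> \<beta> = 1)"
    and "stoch_wave_solution M \<beta> u"
    and "0 < a" and "a < a'" and "0 < b"
  shows "\<exists>K>0. AE \<omega> in M.
    ((\<lambda>\<epsilon>. SUP (p, q)\<in>{(p, q). p \<in> wave_box a a' b \<and> q \<in> wave_box a a' b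
                          \<and> 0 < wave_sigma M u p q \<and> wave_sigma M u p q \<le> \<epsilon>}.
           ereal (\<bar>u \<omega> p - u \<omega> q\<bar> / wave_gamma M u p q))
      \<longlongrightarrow> ereal K) (at_right 0)"
proof -
  let ?W = "wave_box a a' b :: (real \<times> (real ^ 'n)) set"
  interpret wave_solution M u \<beta>
    using assms(1,2) by unfold_locales
  have sigma: "wave_sigma M u = sd X"
    by (simp add: fun_eq_iff wave_sigma_def sd_def ip_def X_def power2_eq_square)
  have gamma: "wave_gamma M u = gam X"
    by (simp add: fun_eq_iff wave_gamma_def gam_def sigma)
  obtain \<eta> where \<eta>: "0 < \<eta>" and lower: "\<And>\<epsilon>. 0 < \<epsilon> \<Longrightarrow> AE \<omega> in M.
      \<exists>p\<in>?W. \<exists>q\<in>?W.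
        0 < sd X p q \<and> sd X p q \<le> \<epsilon> \<and> \<eta> * gam X p q \<le> \<bar>X p \<omega> - X q \<omega>\<bar>"
    by (rule sd_lower_oscillation[OF assms(3-5)]) (rule that)
  obtain C \<theta> where C: "0 < C" "0 < \<theta>"
    and hoelder: "\<And>p q. fst p \<in> {a..a'} \<Longrightarrow> fst q \<in> {a..a'} \<Longrightarrow> sd X p q \<le> C * dist p q powr \<theta>"
    using sd_Hoelder[of a a'] assms(3) by (metis less_imp_le)
  have box_time: "fst p \<in> {a..a'}" "0 \<le> fst p" if "p \<in> ?W" for p
    using that assms(3) by (auto simp: wave_box_def)
  have "\<exists>K>0. AE \<omega> in M.
    ((\<lambda>\<epsilon>. SUP (p, q)\<in>{(p, q). p \<in> ?W \<and> q \<in> ?W \<and> 0 < sd X p q \<and> sd X p q \<le> \<epsilon>}.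
        ereal (\<bar>X p \<omega> - X q \<omega>\<bar> / gam X p q)) \<longlongrightarrow> ereal K) (at_right 0)"
  proof (rule exact_modulus[OF bounded_wave_box _ _ _ C _ \<eta> lower])
    have "(a, 0) \<in> ?W" using assms(3-5) by (simp add: wave_box_def)
    then show "?W \<noteq> {}" by blast
    show "X p \<in> wave_space u" if "p \<in> ?W" for p
      using box_time[OF that] by (intro X_mem)
    show "continuous_on (?W) (\<lambda>p. X p \<omega>)" if "\<omega> \<in> space M" for \<omega>
    proof -
      have "continuous_on {p. 0 \<le> fst p} (u \<omega>)"
        using sol that by (simp add: stoch_wave_solution_def)
      then have "continuous_on (?W) (u \<omega>)"
        by (rule continuous_on_subset) (use box_time in auto)
      then show ?thesis by (simp add: X_def)
    qed
    show "sd X p q \<le> C * dist p q powr \<theta>" if "p \<in> ?W" "q \<in> ?W" for p q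
      using box_time that by (intro hoelder) auto
  qed
  then show ?thesis
    unfolding sigma gamma X_def .
qed

end
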